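(* Let $G$ be a locally compact group. Then a functional $\varphi\in L^{\infty}(G)=L^{1}(G)^{*}$ is right tame if and only if $\mathfrak{G}\circledast\varphi=\{\omega\circledast\varphi:\omega\in\mathfrak{G}\}$ is co-tame.
   Context: All vector spaces are over $\mathbb{R}$; $B_{V}$ is the closed unit ball of a Banach space $V$. $G$ is a locally compact group with left Haar measure $\lambda$, assumed $\sigma$-finite and complete, on the $\sigma$-algebra $\Sigma$. $\mathcal{A}:=L^{1}(G)$ is the Banach algebra with convolution $(a\star b)(g)=\int_{G}a(h)b(h^{-1}g)\,d\lambda(h)$, and $\mathcal{A}^{*}$ is identified with $L^{\infty}(G)$ via $\langle\varphi,a\rangle=\int_{G}a\varphi\,d\lambda$. By the Yosida–Hewitt theorem, $\mathcal{A}^{**}=L^{\infty}(G)^{*}$ is isometrically identified with the space $\mathrm{ba}_{\lambda}(G)$ of (bounded, real-valued) finitely additive measures on $\Sigma$ whose null sets include all $\lambda$-null sets, acting by integration. Put $\mathfrak{G}:=\{\omega\in\mathrm{ba}_{\lambda}(G): \omega(G)=1\text{ and }\omega(A)\in\{0,1\}\text{ for all }A\in\Sigma\}\subseteq\mathcal{A}^{**}$. $\mathfrak{G}$ is weak-star compact, and so is $\mathfrak{G}\circledast\varphi\subseteq\mathcal{A}^{*}$. Actions: for $a,b\in\mathcal{A}$, $\varphi\in\mathcal{A}^{*}$, $\mu\in\mathcal{A}^{**}$: $\langle\varphi\circledast a,b\rangle:=\langle\varphi,a\star b\rangle$ and $\langle\mu\circledast\varphi,b\rangle:=\langle\mu,\varphi\circledast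 b\rangle$. A bounded family $\{f_{n}\}_{n\in\mathbb{N}}$ of real functions on a set $X$ is independent if there are reals $a<b$ such that for all finite disjoint $N,M\subseteq\mathbb{N}$ there is $x\in X$ with $f_{n}(x)\le a$ for $n\in N$ and $f_{m}(x)\ge b$ for $m\in M$. A bounded subset $C$ of a Banach space $V$ is tame if it contains no $\ell^{1}$-sequence; equivalently, $C$ contains no sequence that is independent over $B_{V^{*}}$. A weak-star compact subset $M\subseteq V^{*}$ is co-tame if $B_{V}$ is tame as a family of functions on $M$, i.e. $B_{V}$ contains no sequence that is independent over $M$. $\varphi\in\mathcal{A}^{*}$ is right tame if $\varphi\circledast B_{\mathcal{A}}=\{\varphi\circledast a:a\in B_{\mathcal{A}}\}$ is a tame subset of $\mathcal{A}^{*}$. *)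

theory Defs
  imports "HOL-Analysis.Analysis"
begin

section \<open>Tame and co-tame sets in Banach spaces\<close>

definition independent_on :: "'x set \<Rightarrow> (nat \<Rightarrow> 'x \<Rightarrow> real) \<Rightarrow> bool" where
  "independent_on X f \<longleftrightarrow>
     (\<exists>K. \<forall>n. \<forall>x\<in>X. \<bar>f n x\<bar> \<le> K) \<and>
     (\<exists>a b. a < b \<and>
        (\<forall>N M. finite N \<longrightarrow> finite M \<longrightarrow> N \<inter> M = {} \<longrightarrow>
           (\<exists>x\<in>X. (\<forall>n\<in>N. f n x \<le> a) \<and> (\<forall>m\<in>M. f m x \<ge> b))))"

text \<open>A sequence equivalent to the standard unit vector basis of \<open>\<ell>\<^sup>1\<close>.\<close>

definition l1_sequence :: "(nat \<Rightarrow> 'v::real_normed_vector) \<Rightarrow> bool" where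
  "l1_sequence x \<longleftrightarrow>
     (\<exists>\<delta>>0. \<exists>K. \<forall>n c. \<delta> * (\<Sum>i<n. \<bar>c i\<bar>) \<le> norm (\<Sum>i<n. c i *\<^sub>R x i) \<and>
                     norm (\<Sum>i<n. c i *\<^sub>R x i) \<le> K * (\<Sum>i<n. \<bar>c i\<bar>))"

definition tame :: "'v::real_normed_vector set \<Rightarrow> bool" where
  "tame C \<longleftrightarrow> bounded C \<and> \<not> (\<exists>x. range x \<subseteq> C \<and> l1_sequence x)"

text \<open>On real-valued bounded linear maps, \<^const>\<open>strong_operator_topology\<close> (pointwise
  convergence on the domain) is the weak-star topology.\<close>

definition weak_star_compact :: "('v::real_normed_vector \<Rightarrow>\<^sub>L real) set \<Rightarrow> bool" where
  "weak_star_compact M \<longleftrightarrow> compactin strong_operator_topology M"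

definition co_tame :: "('v::real_normed_vector \<Rightarrow>\<^sub>L real) set \<Rightarrow> bool" where
  "co_tame M \<longleftrightarrow> weak_star_compact M \<and>
     \<not> (\<exists>v. range v \<subseteq> cball 0 1 \<and> independent_on M (\<lambda>n \<psi>. blinfun_apply \<psi> (v n)))"


section \<open>Locally compact groups with left Haar measure\<close>

text \<open>Groups are written additively, as in \<^class>\<open>topological_group_add\<close>, but are not assumed
  to be commutative: \<open>- h + g\<close> stands for \<open>h\<close>-inverse times \<open>g\<close>.\<close>

class locally_compact_group = topological_group_add + t2_space +
  assumes locally_compact: "\<exists>U K. open U \<and> compact K \<and> x \<in> U \<and> U \<subseteq> K"

text \<open>\<open>sigma_sets UNIV {S. open S}\<close> is \<open>sets borel\<close>; \<^const>\<open>borel\<close> itself is not available inside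
  a class definition.\<close>

definition (in locally_compact_group) left_haar_measure :: "'a measure \<Rightarrow> bool" where
  "left_haar_measure \<mu> \<longleftrightarrow>
     sets \<mu> = sigma_sets UNIV {S. open S} \<and>
     emeasure \<mu> UNIV \<noteq> 0 \<and>
     (\<forall>K. compact K \<longrightarrow> emeasure \<mu> K < \<infinity>) \<and>
     (\<forall>A\<in>sets \<mu>. emeasure \<mu> A = (INF U\<in>{U. open U \<and> A \<subseteq> U}. emeasure \<mu> U)) \<and>
     (\<forall>U. open U \<longrightarrow> emeasure \<mu> U = (SUP K\<in>{K. compact K \<and> K \<subseteq> U}. emeasure \<mu> K)) \<and>
     (\<forall>g. \<forall>A\<in>sets \<mu>. emeasure \<mu> ((\<lambda>x. g + x) ` A) = emeasure \<mu> A)"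

text \<open>The class fixes one left Haar measure, completed; thus \<open>sets haar\<close> is the completed Borel
  sigma-algebra.\<close>

class haar_group = locally_compact_group +
  fixes haar :: "'a measure"
  assumes haar_completion: "\<exists>\<mu>. left_haar_measure \<mu> \<and> haar = completion \<mu>"
    and haar_sigma_finite: "sigma_finite_measure haar"


section \<open>The Banach space \<open>L\<^sup>1(G)\<close>\<close>

quotient_type (overloaded) 'g L1 = "'g::haar_group \<Rightarrow> real" / partial:
  "\<lambda>f g. integrable haar f \<and> integrable haar g \<and> (AE x in haar. f x = g x)"
proof (rule part_equivpI)
  show "\<exists>x::'g \<Rightarrow> real. integrable haar x \<and> integrable haar x \<and> (AE y in haar. x y = x y)"
    by (rule exI[of _ "\<lambda>_. 0"]) simp
qed (auto intro!: sympI transpI elim: eventually_mono eventually_elim2)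

instantiation L1 :: (haar_group) real_normed_vector
begin

lift_definition zero_L1 :: "'a L1" is "\<lambda>_. 0" by simp

lift_definition plus_L1 :: "'a L1 \<Rightarrow> 'a L1 \<Rightarrow> 'a L1" is "\<lambda>f g x. f x + g x"
  by (auto elim: eventually_elim2)

lift_definition minus_L1 :: "'a L1 \<Rightarrow> 'a L1 \<Rightarrow> 'a L1" is "\<lambda>f g x. f x - g x"
  by (auto elim: eventually_elim2)

lift_definition uminus_L1 :: "'a L1 \<Rightarrow> 'a L1" is "\<lambda>f x. - f x"
  by auto

lift_definition scaleR_L1 :: "real \<Rightarrow> 'a L1 \<Rightarrow> 'a L1" is "\<lambda>r f x. r * f x"
  by (auto elim: eventually_mono)

lift_definition norm_L1 :: "'a L1 \<Rightarrow> real" is "\<lambda>f. LINT x|haar. \<bar>f x\<bar>"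
  by (rule integral_cong_AE) (auto elim: eventually_mono)

definition dist_L1 :: "'a L1 \<Rightarrow> 'a L1 \<Rightarrow> real" where
  "dist_L1 a b = norm (a - b)"

definition sgn_L1 :: "'a L1 \<Rightarrow> 'a L1" where
  "sgn_L1 a = scaleR (inverse (norm a)) a"

definition uniformity_L1 :: "('a L1 \<times> 'a L1) filter" where
  "uniformity_L1 = (INF e\<in>{0<..}. principal {(x, y). dist x y < e})"

definition open_L1 :: "'a L1 set \<Rightarrow> bool" where
  "open_L1 U \<longleftrightarrow> (\<forall>x\<in>U. eventually (\<lambda>(x', y). x' = x \<longrightarrow> y \<in> U) uniformity)"

instance
proof
  fix a b c :: "'a L1" and r s :: real
  show "a + b + c = a + (b + c)" by transfer (simp add: add.assoc)
  show "a + b = b + a" by transfer (simp add: add.commute)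
  show "0 + a = a" by transfer simp
  show "- a + a = 0" by transfer simp
  show "a - b = a + - b" by transfer simp
  show "r *\<^sub>R (a + b) = r *\<^sub>R a + r *\<^sub>R b" by transfer (simp add: algebra_simps)
  show "(r + s) *\<^sub>R a = r *\<^sub>R a + s *\<^sub>R a" by transfer (simp add: algebra_simps)
  show "r *\<^sub>R s *\<^sub>R a = (r * s) *\<^sub>R a" by transfer (simp add: algebra_simps)
  show "1 *\<^sub>R a = a" by transfer simp
  show "dist a b = norm (a - b)" by (rule dist_L1_def)
  show "sgn a = scaleR (inverse (norm a)) a" by (rule sgn_L1_def)
  show "(uniformity :: ('a L1 \<times> 'a L1) filter) = (INF e\<in>{0<..}. principal {(x, y). dist x y < e})"
    by (rule uniformity_L1_def)
  show "open U \<longleftrightarrow> (\<forall>x\<in>U. \<forall>\<^sub>F (x', y) in uniformity. x' = x \<longrightarrow> y \<in> U)" for U :: "'a L1 set"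
    by (rule open_L1_def)
  show "(norm a = 0) = (a = 0)"
    by transfer (simp add: integral_nonneg_eq_0_iff_AE)
  show "norm (a + b) \<le> norm a + norm b"
  proof transfer
    fix f g :: "'a \<Rightarrow> real"
    assume "integrable haar f \<and> integrable haar f \<and> (AE x in haar. f x = f x)"
      and "integrable haar g \<and> integrable haar g \<and> (AE x in haar. g x = g x)"
    then have fg: "integrable haar f" "integrable haar g" by auto
    then have "(LINT x|haar. \<bar>f x + g x\<bar>) \<le> (LINT x|haar. \<bar>f x\<bar> + \<bar>g x\<bar>)"
      by (intro integral_mono) auto
    with fg show "(LINT x|haar. \<bar>f x + g x\<bar>) \<le> (LINT x|haar. \<bar>f x\<bar>) + (LINT x|haar. \<bar>g x\<bar>)"
      by simp
  qed
  show "norm (r *\<^sub>R a) = \<bar>r\<bar> * norm a"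
    by transfer (simp add: abs_mult)
qed

end


section \<open>Convolution and the module actions\<close>

text \<open>The class of \<open>a \<star> b\<close> does not depend on the representatives chosen by \<^const>\<open>rep_L1\<close>, and
  norms are submultiplicative, so that \<^const>\<open>Blinfun\<close> below is only applied to bounded linear
  maps.\<close>

definition conv :: "'g::haar_group L1 \<Rightarrow> 'g L1 \<Rightarrow> 'g L1" (infixl "\<star>" 70) where
  "a \<star> b = abs_L1 (\<lambda>g. LINT h|haar. rep_L1 a h * rep_L1 b (- h + g))"

type_synonym 'g L1_dual = "'g L1 \<Rightarrow>\<^sub>L real"
type_synonym 'g L1_bidual = "'g L1_dual \<Rightarrow>\<^sub>L real"

definition dual_act :: "'g::haar_group L1_dual \<Rightarrow> 'g L1 \<Rightarrow> 'g L1_dual" where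
  "dual_act \<phi> a = Blinfun (\<lambda>b. blinfun_apply \<phi> (a \<star> b))"

definition bidual_act :: "'g::haar_group L1_bidual \<Rightarrow> 'g L1_dual \<Rightarrow> 'g L1_dual" where
  "bidual_act \<mu> \<phi> = Blinfun (\<lambda>b. blinfun_apply \<mu> (dual_act \<phi> b))"

definition right_tame :: "'g::haar_group L1_dual \<Rightarrow> bool" where
  "right_tame \<phi> \<longleftrightarrow> tame (dual_act \<phi> ` cball 0 1)"


section \<open>Finitely additive measures as elements of the bidual\<close>

text \<open>The functional on \<open>L\<^sup>1(G)\<close> given by (the class of) an essentially bounded function.\<close>

definition Linfty_functional :: "('g::haar_group \<Rightarrow> real) \<Rightarrow> 'g L1_dual" where
  "Linfty_functional f = Blinfun (\<lambda>a. LINT g|haar. rep_L1 a g * f g)"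

definition ba_haar :: "('g::haar_group set \<Rightarrow> real) set" where
  "ba_haar = {\<omega>.
     (\<forall>A\<in>sets haar. \<forall>B\<in>sets haar. A \<inter> B = {} \<longrightarrow> \<omega> (A \<union> B) = \<omega> A + \<omega> B) \<and>
     (\<exists>K. \<forall>A\<in>sets haar. \<bar>\<omega> A\<bar> \<le> K) \<and>
     (\<forall>A\<in>null_sets haar. \<omega> A = 0)}"

text \<open>Integration of bounded measurable functions against a bounded finitely additive measure,
  by uniform approximation with simple functions.\<close>

definition simple_charge_integral :: "('g set \<Rightarrow> real) \<Rightarrow> ('g \<Rightarrow> real) \<Rightarrow> real" where
  "simple_charge_integral \<omega> s = (\<Sum>y\<in>range s. y * \<omega> (s -` {y}))"

definition has_charge_integral ::
  "('g::haar_group set \<Rightarrow> real) \<Rightarrow> ('g \<Rightarrow> real) \<Rightarrow> real \<Rightarrow> bool" where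
  "has_charge_integral \<omega> f I \<longleftrightarrow>
     (\<exists>s. (\<forall>n. simple_function haar (s n)) \<and> uniform_limit UNIV s f sequentially \<and>
          (\<lambda>n. simple_charge_integral \<omega> (s n)) \<longlonglongrightarrow> I)"

text \<open>The Yosida--Hewitt correspondence. Every class in \<open>L\<^sup>\<infinity>(G)\<close> has a bounded representative,
  so it suffices to integrate bounded functions.\<close>

definition acts_by_integration ::
  "'g::haar_group L1_bidual \<Rightarrow> ('g set \<Rightarrow> real) \<Rightarrow> bool" where
  "acts_by_integration \<mu> \<omega> \<longleftrightarrow>
     (\<forall>f\<in>borel_measurable haar. bounded (range f) \<longrightarrow>
        has_charge_integral \<omega> f (blinfun_apply \<mu> (Linfty_functional f)))"

definition zero_one_charges :: "'g::haar_group L1_bidual set" where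
  "zero_one_charges = {\<mu>. \<exists>\<omega>\<in>ba_haar. acts_by_integration \<mu> \<omega> \<and>
     \<omega> UNIV = 1 \<and> (\<forall>A\<in>sets haar. \<omega> A \<in> {0, 1})}"

end

theory Submission
  imports Defs "HOL-Library.Diagonal_Subsequence"
begin

text \<open>
  Write \<open>G\<close> for the set of zero-one charges, the Gelfand spectrum of \<open>L\<^sup>\<infinity>\<close>. It is weak-star compact
  and norming for \<open>L\<^sup>\<infinity>\<close>, and \<open>(\<omega> \<circledast> \<phi>) a = \<omega> (\<phi> \<circledast> a)\<close>; so both sides speak about the sequences
  \<open>\<phi> \<circledast> a\<^sub>n\<close>, as elements of \<open>L\<^sup>\<infinity>\<close> and as functions on \<open>G\<close>. An independent sequence of bounded
  functions is an \<open>\<ell>\<^sup>1\<close>-sequence for the supremum norm. Conversely, a bounded sequence without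
  independent subsequence has a pointwise convergent subsequence by Rosenthal's dichotomy; the
  differences of consecutive terms tend to zero pointwise on the compact set \<open>G\<close>, so convex
  combinations of them are uniformly small by a combinatorial form of Ptak's lemma, which is
  impossible for an \<open>\<ell>\<^sup>1\<close>-sequence.

  The group need not be second countable, so the convolution kernel \<open>(h, g) \<mapsto> a h * b (- h + g)\<close> need
  not be measurable for the product sigma-algebra; it is replaced by an almost everywhere limit of
  kernels of compact support, which are.
\<close>

section \<open>Rosenthal's dichotomy\<close>

text \<open>A bounded sequence of continuous functions tending to zero pointwise on a compact space
  is weakly null, by Riesz representation and dominated convergence, and Mazur's theorem then gives
  small convex combinations. The averaging argument replaces this route and needs no measures on
  \<open>G\<close>. It bounds averages only from above, so it is applied to absolute values of
  differences; opposite coefficients on the two terms of each pair then give a combination with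
  coefficient sum 2 and supremum norm at most \<delta>, although the lower bound demands 2 \<delta>.

  For charges everything rests on one fact: on each set of charge one, a bounded measurable
  \<open>f\<close> takes values arbitrarily close to its integral. To compare this with norms, each
  functional on \<open>L1\<close> must come from a bounded function, which is where Radon-Nikodym
  enters.

  In the convolution integral the variable \<open>h\<close> occurs as \<open>- h + g\<close>.
  Replacing \<open>b\<close> by an almost everywhere limit is therefore harmless only if inversion
  preserves null sets; it need not preserve Haar measure itself.\<close>

definition settled :: "(nat \<Rightarrow> 'x \<Rightarrow> bool) \<Rightarrow> (nat \<Rightarrow> 'x \<Rightarrow> bool) \<Rightarrow> 'x set \<Rightarrow> nat set \<Rightarrow> bool" where
  "settled P Q X L \<longleftrightarrow> (\<forall>x\<in>X. finite {n\<in>L. P n x} \<or> finite {n\<in>L. Q n x})"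

text \<open>With \<open>P\<close> and \<open>Q\<close> read as \<open>f n x \<le> a\<close> and
  \<open>f n x \<ge> b\<close>, a settled index set is one along which no point of \<open>X\<close>
  crosses the gap infinitely often. Wildness is the hereditary failure of this, so it survives every
  later thinning of the index set.\<close>

definition wild :: "(nat \<Rightarrow> 'x \<Rightarrow> bool) \<Rightarrow> (nat \<Rightarrow> 'x \<Rightarrow> bool) \<Rightarrow> 'x set \<Rightarrow> nat set \<Rightarrow> bool" where
  "wild P Q X L \<longleftrightarrow> (\<forall>L'\<subseteq>L. infinite L' \<longrightarrow> \<not> settled P Q X L')"

lemma wild_subset: "wild P Q X L \<Longrightarrow> L' \<subseteq> L \<Longrightarrow> wild P Q X L'"
  unfolding wild_def by blast

lemma wild_nonempty: "wild P Q X L \<Longrightarrow> infinite L \<Longrightarrow> X \<noteq> {}"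
  unfolding wild_def settled_def by blast

text \<open>Finitely many indices do not affect settledness. Diagonal sequences, which enter a given
  index set only from some term on, therefore inherit it.\<close>

lemma settled_almost_subset:
  assumes "settled P Q X L" "finite (D - L)"
  shows "settled P Q X D"
  unfolding settled_def
proof
  fix x assume "x \<in> X"
  have sub: "{n\<in>D. R n x} \<subseteq> {n\<in>L. R n x} \<union> (D - L)" for R :: "nat \<Rightarrow> 'a \<Rightarrow> bool" by blast
  have *: "finite {n\<in>D. R n x}" if "finite {n\<in>L. R n x}" for R :: "nat \<Rightarrow> 'a \<Rightarrow> bool"
    using finite_subset[OF sub[of R]] that assms(2) by blast
  show "finite {n\<in>D. P n x} \<or> finite {n\<in>D. Q n x}"
    using assms(1) \<open>x \<in> X\<close> *[of P] *[of Q] unfolding settled_def by blast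
qed

text \<open>If every choice of \<open>n\<close> failed, each would leave some \<open>X\<close> in
  \<open>F\<close> with one of its two halves settled along a smaller index set. Iterating gives
  indices \<open>n k\<close> and decreasing sets \<open>M k\<close>; since \<open>F\<close> is
  finite, one pair of a set and a half recurs infinitely often, and the indices with that pair form
  a settled subset of \<open>L\<close> for this very \<open>X\<close>, against wildness.\<close>

lemma wild_split:
  assumes "infinite L" "finite F" and wild: "\<And>X. X \<in> F \<Longrightarrow> wild P Q X L"
  shows "\<exists>n\<in>L. \<exists>L'\<subseteq>L. infinite L' \<and>
           (\<forall>X\<in>F. wild P Q (X \<inter> {x. P n x}) L' \<and> wild P Q (X \<inter> {x. Q n x}) L')"
proof (rule ccontr)
  assume neg: "\<not> ?thesis"
  define R where "R = (\<lambda>(c::bool) n x. if c then P n x else Q n x)"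
  have ex: "\<exists>X\<in>F. \<exists>c. \<exists>L''\<subseteq>L'. infinite L'' \<and> settled P Q (X \<inter> {x. R c n x}) L''"
    if "n \<in> L" "L' \<subseteq> L" "infinite L'" for n L'
  proof -
    from neg that obtain X where "X \<in> F"
      and "\<not> wild P Q (X \<inter> {x. P n x}) L' \<or> \<not> wild P Q (X \<inter> {x. Q n x}) L'" by blast
    then show ?thesis
    proof (elim disjE)
      assume "\<not> wild P Q (X \<inter> {x. P n x}) L'"
      then show ?thesis using \<open>X \<in> F\<close> unfolding wild_def R_def
        by (intro bexI[of _ X] exI[of _ True]) auto
    next
      assume "\<not> wild P Q (X \<inter> {x. Q n x}) L'"
      then show ?thesis using \<open>X \<in> F\<close> unfolding wild_def R_def
        by (intro bexI[of _ X] exI[of _ False]) auto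
    qed
  qed
  have "\<exists>f :: nat \<Rightarrow> nat \<times> nat set \<times> 'a set \<times> bool. \<forall>k.
     (case f k of (n, M, X, c) \<Rightarrow> n \<in> L \<and> M \<subseteq> L \<and> infinite M \<and> X \<in> F \<and> settled P Q (X \<inter> {x. R c n x}) M) \<and>
     (case f k of (n, M, X, c) \<Rightarrow> case f (Suc k) of (n', M', X', c') \<Rightarrow>
        n < n' \<and> n' \<in> M \<and> M' \<subseteq> M)" (is "\<exists>f. \<forall>k. ?A (f k) \<and> ?B (f k) (f (Suc k))")
  proof (rule dependent_nat_choice)
    obtain n where "n \<in> L" using \<open>infinite L\<close> by (metis finite.emptyI equals0I)
    then obtain X c M where "X \<in> F" "M \<subseteq> L" "infinite M" "settled P Q (X \<inter> {x. R c n x}) M"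
      using ex[of n L] \<open>infinite L\<close> by blast
    then show "\<exists>y. ?A y" using \<open>n \<in> L\<close> by (intro exI[of _ "(n, M, X, c)"]) simp
  next
    fix y :: "nat \<times> nat set \<times> 'a set \<times> bool" and k :: nat
    obtain n M X c where y: "y = (n, M, X, c)" by (cases y)
    assume "?A y"
    then have *: "M \<subseteq> L" "infinite M" by (auto simp: y)
    obtain n' where n': "n' \<in> M" "n < n'" using \<open>infinite M\<close> unfolding infinite_nat_iff_unbounded by blast
    then obtain X' c' M' where "X' \<in> F" "M' \<subseteq> M" "infinite M'" "settled P Q (X' \<inter> {x. R c' n' x}) M'"
      using ex[of n' M] * by blast
    then show "\<exists>y'. ?A y' \<and> ?B y y'" using n' *
      by (intro exI[of _ "(n', M', X', c')"]) (auto simp: y)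
  qed
  then obtain f where "\<forall>k. ?A (f k) \<and> ?B (f k) (f (Suc k))" ..
  then have f: "\<And>k. ?A (f k)" "\<And>k. ?B (f k) (f (Suc k))" by auto
  define n where "n = (\<lambda>k. fst (f k))"
  define M where "M = (\<lambda>k. fst (snd (f k)))"
  define X where "X = (\<lambda>k. fst (snd (snd (f k))))"
  define c where "c = (\<lambda>k. snd (snd (snd (f k))))"
  have A: "n k \<in> L" "M k \<subseteq> L" "X k \<in> F" "settled P Q (X k \<inter> {x. R (c k) (n k) x}) (M k)" for k
    using f(1)[of k] by (auto simp: n_def M_def X_def c_def split: prod.splits)
  have B: "n k < n (Suc k)" "n (Suc k) \<in> M k" "M (Suc k) \<subseteq> M k" for k
    using f(2)[of k] by (auto simp: n_def M_def split: prod.splits)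
  have mono: "strict_mono n" using B(1) by (simp add: strict_mono_Suc_iff)
  have antiM: "M j \<subseteq> M k" if "k \<le> j" for j k
    using lift_Suc_antimono_le[of M, OF B(3) that] .
  have nM: "n j \<in> M k" if "k < j" for j k
    using that antiM[of k "j - 1"] B(2)[of "j - 1"] by (cases j) auto
  have "finite ((\<lambda>k. (X k, c k)) ` UNIV)"
    by (rule finite_subset[of _ "F \<times> UNIV"]) (use A(3) \<open>finite F\<close> in auto)
  from pigeonhole_infinite[OF infinite_UNIV_nat this]
  obtain k0 where k0: "infinite {k. X k = X k0 \<and> c k = c k0}" by auto
  define K where "K = {k. X k = X k0 \<and> c k = c k0}"
  define D where "D = n ` K"
  have infD: "infinite D" unfolding D_def K_def using k0 mono finite_imageD strict_mono_imp_inj_on inj_on_subset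
    by (metis subset_UNIV)
  have "settled P Q (X k0) D"
    unfolding settled_def
  proof
    fix x assume x: "x \<in> X k0"
    show "finite {m\<in>D. P m x} \<or> finite {m\<in>D. Q m x}"
    proof (cases "\<exists>k\<in>K. R (c k0) (n k) x")
      case True
      then obtain k where k: "k \<in> K" "R (c k0) (n k) x" by blast
      \<comment> \<open>All indices chosen after stage \<open>k\<close> lie in \<open>M k\<close>,
        so \<open>D\<close> inherits the settledness of the half containing
        \<open>x\<close>.\<close>
      have "D - M k \<subseteq> n ` {..k}" unfolding D_def using nM[of k] by (force simp: not_le[symmetric])
      then have "finite (D - M k)" using finite_surj by blast
      then have "settled P Q (X k \<inter> {x. R (c k) (n k) x}) D"
        using settled_almost_subset[OF A(4)] by blast
      then show ?thesis using k x unfolding settled_def K_def by auto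
    next
      case False
      \<comment> \<open>The point avoids the recurring half at every index of \<open>D\<close>, so
        one of the two index sets is even empty.\<close>
      then have "{m\<in>D. R (c k0) m x} = {}" unfolding D_def by auto
      then show ?thesis unfolding R_def by (cases "c k0") (auto simp del: Collect_empty_eq)
    qed
  qed
  moreover have "D \<subseteq> L" unfolding D_def using A(1) by auto
  ultimately show False using wild[OF A(3)[of k0]] infD unfolding wild_def by blast
qed

text \<open>Stage \<open>k\<close> carries the family of all \<open>2 ^ k\<close> cells cut out by
  the sign patterns of the first \<open>k\<close> chosen indices. Splitting keeps every cell wild
  for the current infinite index set, and a wild set is nonempty, so every pattern is
  realised.\<close>

lemma wild_imp_independent:
  assumes "infinite L" "wild P Q X L"
  shows "\<exists>r. strict_mono r \<and> (\<forall>k s. \<exists>x\<in>X. \<forall>i<k::nat. if s i then P (r i) x else Q (r i) x)"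
proof -
  let ?A = "\<lambda>(y :: nat \<times> nat set \<times> 'a set set). case y of (n, M, F) \<Rightarrow>
     infinite M \<and> finite F \<and> (\<forall>X\<in>F. wild P Q X M)"
  let ?B = "\<lambda>(y :: nat \<times> nat set \<times> 'a set set) y'. case y of (n, M, F) \<Rightarrow> case y' of (n', M', F') \<Rightarrow>
     M' \<subseteq> M \<inter> {n'<..} \<and> n' \<in> M \<and> F' = (\<lambda>X. X \<inter> {x. P n' x}) ` F \<union> (\<lambda>X. X \<inter> {x. Q n' x}) ` F"
  \<comment> \<open>The clause at \<open>k = 0\<close> pins the starting family to the single set
    \<open>X\<close>; intersecting with \<open>{n'<..}\<close> forces the chosen indices to
    increase.\<close>
  have "\<exists>f. \<forall>k. (?A (f k) \<and> (k = 0 \<longrightarrow> snd (snd (f k)) = {X})) \<and> ?B (f k) (f (Suc k))"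
  proof (rule dependent_nat_choice)
    show "\<exists>y. ?A y \<and> (0 = (0::nat) \<longrightarrow> snd (snd y) = {X})"
      using assms by (intro exI[of _ "(0, L, {X})"]) simp
  next
    fix y :: "nat \<times> nat set \<times> 'a set set" and k :: nat
    obtain n M F where y: "y = (n, M, F)" by (cases y)
    assume "?A y \<and> (k = 0 \<longrightarrow> snd (snd y) = {X})"
    then have *: "infinite M" "finite F" "\<And>X. X \<in> F \<Longrightarrow> wild P Q X M" by (auto simp: y)
    obtain n' M' where n': "n' \<in> M" "M' \<subseteq> M" "infinite M'"
      "\<And>X. X \<in> F \<Longrightarrow> wild P Q (X \<inter> {x. P n' x}) M'"
      "\<And>X. X \<in> F \<Longrightarrow> wild P Q (X \<inter> {x. Q n' x}) M'"
      using wild_split[OF *] by blast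
    have "M' \<subseteq> (M' \<inter> {n'<..}) \<union> {..n'}" by auto
    then have inf: "infinite (M' \<inter> {n'<..})" using \<open>infinite M'\<close>
      by (meson finite_UnI finite_atMost finite_subset)
    show "\<exists>y'. (?A y' \<and> (Suc k = 0 \<longrightarrow> snd (snd y') = {X})) \<and> ?B y y'"
      using * n' inf
      by (intro exI[of _ "(n', M' \<inter> {n'<..}, (\<lambda>X. X \<inter> {x. P n' x}) ` F \<union> (\<lambda>X. X \<inter> {x. Q n' x}) ` F)"])
         (auto simp: y intro: wild_subset[of P Q _ M', OF _ Int_lower1])
  qed
  then obtain f where "\<forall>k. (?A (f k) \<and> (k = 0 \<longrightarrow> snd (snd (f k)) = {X})) \<and> ?B (f k) (f (Suc k))" ..
  then have f: "\<And>k. ?A (f k)" "snd (snd (f 0)) = {X}" "\<And>k. ?B (f k) (f (Suc k))" by auto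
  \<comment> \<open>Shifted by one, because the index stored at stage 0 is a dummy.\<close>
  define r where "r = (\<lambda>k. fst (f (Suc k)))"
  define M where "M = (\<lambda>k. fst (snd (f k)))"
  define F where "F = (\<lambda>k. snd (snd (f k)))"
  have A: "infinite (M k)" "\<And>X. X \<in> F k \<Longrightarrow> wild P Q X (M k)" for k
    using f(1)[of k] by (auto simp: M_def F_def split: prod.splits)
  have B: "M (Suc k) \<subseteq> M k" "M (Suc k) \<subseteq> {r k<..}" "r k \<in> M k"
    "F (Suc k) = (\<lambda>X. X \<inter> {x. P (r k) x}) ` F k \<union> (\<lambda>X. X \<inter> {x. Q (r k) x}) ` F k" for k
    using f(3)[of k] by (auto simp: M_def F_def r_def split: prod.splits)
  have "r k < r (Suc k)" for k using B(2)[of k] B(3)[of "Suc k"] by auto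
  then have mono: "strict_mono r" by (simp add: strict_mono_Suc_iff)
  have F0: "F 0 = {X}" using f(2) by (simp add: F_def)
  have inF: "X \<inter> {x. \<forall>i<k. if s i then P (r i) x else Q (r i) x} \<in> F k" for k and s :: "nat \<Rightarrow> bool"
  proof (induction k)
    case 0
    then show ?case by (simp add: F0)
  next
    case (Suc k)
    have "X \<inter> {x. \<forall>i<Suc k. if s i then P (r i) x else Q (r i) x} =
      (X \<inter> {x. \<forall>i<k. if s i then P (r i) x else Q (r i) x}) \<inter>
        (if s k then {x. P (r k) x} else {x. Q (r k) x})"
      by (auto simp: less_Suc_eq split: if_splits)
    with Suc show ?case by (auto simp: B(4))
  qed
  have "\<exists>x\<in>X. \<forall>i<k. if s i then P (r i) x else Q (r i) x" for k and s :: "nat \<Rightarrow> bool"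
    using wild_nonempty[OF A(2)[OF inF[of k s]] A(1)] by blast
  with mono show ?thesis by blast
qed

lemma independent_onI:
  assumes bdd: "\<And>n x. x \<in> X \<Longrightarrow> \<bar>f n x\<bar> \<le> K" and "a < b"
    and ind: "\<And>k s. \<exists>x\<in>X. \<forall>i<k::nat. if s i then f i x \<le> a else f i x \<ge> b"
  shows "independent_on X f"
  unfolding independent_on_def
proof (intro conjI)
  show "\<exists>K. \<forall>n. \<forall>x\<in>X. \<bar>f n x\<bar> \<le> K" using bdd by blast
  have "\<forall>N M. finite N \<longrightarrow> finite M \<longrightarrow> N \<inter> M = {} \<longrightarrow>
           (\<exists>x\<in>X. (\<forall>n\<in>N. f n x \<le> a) \<and> (\<forall>m\<in>M. f m x \<ge> b))"
  proof (intro allI impI)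
    fix N M :: "nat set" assume fin: "finite N" "finite M" and disj: "N \<inter> M = {}"
    obtain k where k: "N \<union> M \<subseteq> {..<k}" using fin finite_nat_iff_bounded by (metis finite_UnI)
    obtain x where x: "x \<in> X" "\<And>i. i < k \<Longrightarrow> if i \<in> N then f i x \<le> a else f i x \<ge> b"
      using ind[of k "\<lambda>i. i \<in> N"] by blast
    have "(\<forall>n\<in>N. f n x \<le> a) \<and> (\<forall>m\<in>M. f m x \<ge> b)"
    proof (intro conjI ballI)
      fix n assume "n \<in> N" then show "f n x \<le> a" using x(2)[of n] k by auto
    next
      fix m assume "m \<in> M" then show "f m x \<ge> b" using x(2)[of m] k disj by (cases "m \<in> N") auto
    qed
    then show "\<exists>x\<in>X. (\<forall>n\<in>N. f n x \<le> a) \<and> (\<forall>m\<in>M. f m x \<ge> b)" using x(1) by blast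
  qed
  with \<open>a < b\<close> show "\<exists>a b. a < b \<and> (\<forall>N M. finite N \<longrightarrow> finite M \<longrightarrow> N \<inter> M = {} \<longrightarrow>
           (\<exists>x\<in>X. (\<forall>n\<in>N. f n x \<le> a) \<and> (\<forall>m\<in>M. f m x \<ge> b)))" by blast
qed

text \<open>Only the rational pairs \<open>a < b\<close> matter, so a diagonal sequence handles all of them at once.\<close>

theorem rosenthal_dichotomy:
  fixes f :: "nat \<Rightarrow> 'x \<Rightarrow> real"
  assumes bdd: "\<And>n x. x \<in> X \<Longrightarrow> \<bar>f n x\<bar> \<le> K"
  obtains r where "strict_mono r" "independent_on X (\<lambda>n. f (r n))"
  | r where "strict_mono r" "\<And>x. x \<in> X \<Longrightarrow> convergent (\<lambda>n. f (r n) x)"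
proof (cases "\<exists>r. strict_mono r \<and> independent_on X (\<lambda>n. f (r n))")
  case True
  then show ?thesis using that(1) by blast
next
  case False
  \<comment> \<open>Without an independent subsequence no infinite index set is wild at any gap;
    this is the thinning step for the diagonal sequence.\<close>
  have ex: "\<exists>L'\<subseteq>L. infinite L' \<and> settled (\<lambda>n x. f n x \<le> a) (\<lambda>n x. f n x \<ge> b) X L'"
    if "infinite L" "a < b" for L a b
  proof (rule ccontr)
    assume "\<not> ?thesis"
    then have "wild (\<lambda>n x. f n x \<le> a) (\<lambda>n x. f n x \<ge> b) X L" unfolding wild_def by blast
    from wild_imp_independent[OF \<open>infinite L\<close> this]
    obtain r where r: "strict_mono r"
      "\<And>k s. \<exists>x\<in>X. \<forall>i<k::nat. if s i then f (r i) x \<le> a else f (r i) x \<ge> b" by blast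
    have "independent_on X (\<lambda>n. f (r n))" by (rule independent_onI[OF bdd \<open>a < b\<close> r(2)])
    with r(1) False show False by blast
  qed
  define p where "p = (\<lambda>n. from_nat n :: rat \<times> rat)"
  define Z where "Z = (\<lambda>n (s :: nat \<Rightarrow> nat). fst (p n) < snd (p n) \<longrightarrow>
    settled (\<lambda>i x. f i x \<le> of_rat (fst (p n))) (\<lambda>i x. f i x \<ge> of_rat (snd (p n))) X (range s))"
  interpret subseqs Z
  proof
    fix n and s :: "nat \<Rightarrow> nat" assume s: "strict_mono s"
    show "\<exists>r'. strict_mono r' \<and> Z n (s \<circ> r')"
    proof (cases "fst (p n) < snd (p n)")
      case True
      then have "real_of_rat (fst (p n)) < of_rat (snd (p n))" by (simp add: of_rat_less)
      moreover have "infinite (range s)" using s by (simp add: range_inj_infinite strict_mono_imp_inj_on)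
      ultimately obtain L' where L': "L' \<subseteq> range s" "infinite L'"
        "settled (\<lambda>i x. f i x \<le> of_rat (fst (p n))) (\<lambda>i x. f i x \<ge> of_rat (snd (p n))) X L'"
        using ex by blast
      have "s ` (s -` L') = L'" using L'(1) by blast
      then have "infinite (s -` L')" using L'(2) by (metis finite_imageI)
      from infinite_enumerate[OF this] obtain r' :: "nat \<Rightarrow> nat" where r': "strict_mono r' \<and> (\<forall>i. r' i \<in> s -` L')" ..
      have "range (s \<circ> r') \<subseteq> L'" using r' by auto
      then have "settled (\<lambda>i x. f i x \<le> of_rat (fst (p n))) (\<lambda>i x. f i x \<ge> of_rat (snd (p n))) X (range (s \<circ> r'))"
        by (intro settled_almost_subset[OF L'(3)]) (simp add: Diff_eq_empty_iff[THEN iffD2])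
      then show ?thesis using r' unfolding Z_def by blast
    next
      case False
      then show ?thesis unfolding Z_def by (blast intro: strict_mono_id)
    qed
  qed
  have stable: "Z n (s \<circ> r)" if "Z n s" for r s n
  proof -
    have "range (s \<circ> r) - range s = {}" by auto
    then have "settled P Q X (range s) \<Longrightarrow> settled P Q X (range (s \<circ> r))" for P Q :: "nat \<Rightarrow> 'x \<Rightarrow> bool"
      by (metis settled_almost_subset finite.emptyI)
    then show ?thesis using that unfolding Z_def by blast
  qed
  define d where "d = diagseq"
  have d: "strict_mono d" using subseq_diagseq by (simp add: d_def)
  have alt: "finite {i. f (d i) x \<le> of_rat a} \<or> finite {i. f (d i) x \<ge> of_rat b}"
    if "x \<in> X" "a < b" for x a b
  proof -
    define n where "n = to_nat (a, b)"
    have p: "p n = (a, b)" by (simp add: p_def n_def)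
    \<comment> \<open>Only the terms after position \<open>n\<close> of the diagonal sequence form a
      subsequence of the one treating the \<open>n\<close>-th pair; the other finitely many are
      added back below.\<close>
    define e where "e = d \<circ> (+) (Suc n)"
    have "Z n e" unfolding e_def d_def by (rule diagseq_holds) (rule stable)
    then have "finite {m\<in>range e. f m x \<le> of_rat a} \<or> finite {m\<in>range e. f m x \<ge> of_rat b}"
      using that unfolding Z_def p settled_def by simp
    moreover have "finite {i. R (d i)}" if "finite {m\<in>range e. R m}" for R :: "nat \<Rightarrow> bool"
    proof -
      have "inj e" unfolding e_def
        by (intro inj_compose strict_mono_imp_inj_on[OF d]) simp
      moreover have "{m\<in>range e. R m} = e ` {i. R (e i)}" by auto
      ultimately have "finite {i. R (e i)}"
        using that by (metis finite_imageD inj_on_subset subset_UNIV)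
      moreover have "{i. R (d i)} \<subseteq> {..n} \<union> (+) (Suc n) ` {i. R (e i)}"
      proof
        fix i assume "i \<in> {i. R (d i)}"
        then show "i \<in> {..n} \<union> (+) (Suc n) ` {i. R (e i)}"
          by (cases "i \<le> n") (auto simp: e_def image_iff intro!: exI[of _ "i - Suc n"])
      qed
      ultimately show ?thesis by (meson finite_UnI finite_atMost finite_imageI finite_subset)
    qed
    note this[of "\<lambda>m. f m x \<le> of_rat a"] this[of "\<lambda>m. f m x \<ge> of_rat b"]
    ultimately show ?thesis by blast
  qed
  have "convergent (\<lambda>n. f (d n) x)" if x: "x \<in> X" for x
  proof -
    define g where "g = (\<lambda>n. f (d n) x)"
    have "bounded (range g)" unfolding bounded_iff g_def using bdd[OF x] by auto
    then obtain l s where s: "strict_mono s" "(g \<circ> s) \<longlonglongrightarrow> l"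
      using bounded_imp_convergent_subsequence by blast
    have inf: "infinite {i. g i \<in> U}" if "open U" "l \<in> U" for U
    proof -
      have "eventually (\<lambda>i. g (s i) \<in> U) sequentially"
        using topological_tendstoD[OF s(2) that] by simp
      then obtain N where "\<And>i. N \<le> i \<Longrightarrow> g (s i) \<in> U" by (auto simp: eventually_sequentially)
      then have "{N..} \<subseteq> {i. g (s i) \<in> U}" by auto
      then have "infinite {i. g (s i) \<in> U}" using infinite_Ici infinite_super by blast
      then have "infinite (s ` {i. g (s i) \<in> U})"
        using finite_imageD[OF _ inj_on_subset[OF strict_mono_imp_inj_on[OF s(1)] subset_UNIV]] by blast
      moreover have "s ` {i. g (s i) \<in> U} \<subseteq> {i. g i \<in> U}" by auto
      ultimately show ?thesis using finite_subset by blast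
    qed
    have "g \<longlonglongrightarrow> l"
    proof (rule tendstoI)
      fix e :: real assume "e > 0"
      \<comment> \<open>A rational gap between \<open>l\<close> and \<open>l + e\<close>: infinitely
        many terms lie near the cluster point, hence below \<open>q\<close>, so only finitely many
        exceed \<open>q'\<close>. The pair \<open>p\<close>, \<open>p'\<close> does the same from
        below.\<close>
      obtain q where q: "l < of_rat q" "of_rat q < l + e/2" using of_rat_dense[of l "l + e/2"] \<open>e > 0\<close> by auto
      obtain q' where q': "l + e/2 < of_rat q'" "of_rat q' < l + e" using of_rat_dense[of "l + e/2" "l + e"] \<open>e > 0\<close> by auto
      have "q < q'" using q q' by (metis less_trans of_rat_less)
      then have "finite {i. g i \<le> of_rat q} \<or> finite {i. g i \<ge> of_rat q'}" using alt[OF x] by (simp add: g_def)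
      moreover have "infinite {i. g i \<le> of_rat q}"
        by (rule infinite_super[OF _ inf[of "{..<of_rat q}"]]) (use q in auto)
      ultimately have 1: "finite {i. g i \<ge> of_rat q'}" by blast
      obtain p where p: "l - e < of_rat p" "of_rat p < l - e/2" using of_rat_dense[of "l - e" "l - e/2"] \<open>e > 0\<close> by auto
      obtain p' where p': "l - e/2 < of_rat p'" "of_rat p' < l" using of_rat_dense[of "l - e/2" l] \<open>e > 0\<close> by auto
      have "p < p'" using p p' by (metis less_trans of_rat_less)
      then have "finite {i. g i \<le> of_rat p} \<or> finite {i. g i \<ge> of_rat p'}" using alt[OF x] by (simp add: g_def)
      moreover have "infinite {i. g i \<ge> of_rat p'}"
        by (rule infinite_super[OF _ inf[of "{of_rat p'<..}"]]) (use p' in auto)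
      ultimately have 2: "finite {i. g i \<le> of_rat p}" by blast
      have "finite {i. \<not> dist (g i) l < e}"
        by (rule finite_subset[OF _ finite_UnI[OF 1 2]]) (use p q' in \<open>auto simp: dist_real_def\<close>)
      then show "eventually (\<lambda>i. dist (g i) l < e) sequentially"
        by (simp add: eventually_cofinite cofinite_eq_sequentially[symmetric])
    qed
    then show ?thesis unfolding g_def convergent_def by blast
  qed
  then show ?thesis using that(2) d by blast
qed

section \<open>Convex combinations of a pointwise null sequence\<close>

text \<open>A pair \<open>(A, u)\<close> stands for a convex combination \<open>u\<close> of the \<open>h i\<close> with \<open>i \<in> A\<close>; only the
  two estimates below are used of it.\<close>

definition averages :: "(nat \<Rightarrow> 'x \<Rightarrow> real) \<Rightarrow> 'x set \<Rightarrow> real \<Rightarrow> real \<Rightarrow> (nat set \<times> ('x \<Rightarrow> real)) set" where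
  "averages h X K \<eta> = {(A, u). finite A \<and> (\<forall>x\<in>X. u x \<le> K) \<and>
     (\<forall>x\<in>X. (\<forall>i\<in>A. h i x < \<eta>) \<longrightarrow> u x \<le> \<eta>)}"

text \<open>A convex family containing members supported arbitrarily far out. Keeping it abstract
  allows passing from all convex combinations to those that are already small somewhere.\<close>

definition large :: "(nat set \<times> ('x \<Rightarrow> real)) set \<Rightarrow> bool" where
  "large S \<longleftrightarrow> (\<forall>N. \<exists>A u. (A, u) \<in> S \<and> A \<subseteq> {N..}) \<and>
     (\<forall>A u B v t. (A, u) \<in> S \<longrightarrow> (B, v) \<in> S \<longrightarrow> 0 \<le> t \<longrightarrow> t \<le> 1 \<longrightarrow>
        (A \<union> B, \<lambda>x. t * u x + (1 - t) * v x) \<in> S)"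

text \<open>The quantifier over all large families, instead of just the convex combinations of
  \<open>h\<close>, is what makes smallness on several sets achievable simultaneously: the members
  small on one set again form a large family, to which the condition for the next set
  applies.\<close>

definition smallable :: "(nat \<Rightarrow> 'x \<Rightarrow> real) \<Rightarrow> 'x set \<Rightarrow> real \<Rightarrow> real \<Rightarrow> 'x set \<Rightarrow> bool" where
  "smallable h X K \<eta> Y \<longleftrightarrow> (\<forall>S. large S \<longrightarrow> S \<subseteq> averages h X K \<eta> \<longrightarrow>
     (\<forall>\<epsilon>>\<eta>. \<exists>A u. (A, u) \<in> S \<and> (\<forall>x\<in>Y. u x \<le> \<epsilon>)))"

lemma largeD:
  assumes "large S"
  shows "\<exists>A u. (A, u) \<in> S \<and> A \<subseteq> {N..}"
    and "(A, u) \<in> S \<Longrightarrow> (B, v) \<in> S \<Longrightarrow> 0 \<le> t \<Longrightarrow> t \<le> 1 \<Longrightarrow> (A \<union> B, \<lambda>x. t * u x + (1 - t) * v x) \<in> S"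
  using assms unfolding large_def by blast+

lemma large_tail: "large S \<Longrightarrow> large {(A, u)\<in>S. A \<subseteq> {N..}}"
  unfolding large_def
proof (intro conjI allI impI, goal_cases)
  case (1 M)
  then obtain A u where "(A, u) \<in> S" "A \<subseteq> {max N M..}" by blast
  then show ?case by (intro exI[of _ A] exI[of _ u]) auto
next
  case 2
  then show ?case by auto
qed

lemma smallableD:
  assumes "smallable h X K \<eta> Y" "large S" "S \<subseteq> averages h X K \<eta>" "\<epsilon> > \<eta>"
  shows "\<exists>A u. (A, u) \<in> S \<and> A \<subseteq> {N..} \<and> (\<forall>x\<in>Y. u x \<le> \<epsilon>)"
proof -
  have "{(A, u)\<in>S. A \<subseteq> {N..}} \<subseteq> averages h X K \<eta>" using assms(3) by auto
  then have "\<exists>A u. (A, u) \<in> {(A, u)\<in>S. A \<subseteq> {N..}} \<and> (\<forall>x\<in>Y. u x \<le> \<epsilon>)"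
    using assms(1) large_tail[OF assms(2)] assms(4) unfolding smallable_def by blast
  then show ?thesis by auto
qed

lemma smallable_large:
  assumes "smallable h X K \<eta> Y" "large S" "S \<subseteq> averages h X K \<eta>" "\<epsilon> > \<eta>"
  shows "large {(A, u)\<in>S. \<forall>x\<in>Y. u x \<le> \<epsilon>}"
  unfolding large_def
proof (intro conjI allI impI, goal_cases)
  case (1 N)
  then show ?case using smallableD[OF assms, of N] by auto
next
  case (2 A u B v t)
  have "t * u x + (1 - t) * v x \<le> \<epsilon>" if "x \<in> Y" for x
    using convex_bound_le[of "u x" \<epsilon> "v x" t "1 - t"] 2 that by auto
  then show ?case using 2 largeD(2)[OF assms(2)] by auto
qed

lemma smallable_large_finite:
  assumes "finite I" "\<And>i. i \<in> I \<Longrightarrow> smallable h X K \<eta> (Y i)"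
    and "large S" "S \<subseteq> averages h X K \<eta>" "\<epsilon> > \<eta>"
  shows "large {(A, u)\<in>S. \<forall>i\<in>I. \<forall>x\<in>Y i. u x \<le> \<epsilon>}"
  using assms(1,2)
proof (induction I)
  case empty
  then show ?case using assms(3) by simp
next
  case (insert j I)
  let ?S = "{(A, u)\<in>S. \<forall>i\<in>I. \<forall>x\<in>Y i. u x \<le> \<epsilon>}"
  have "large {(A, u)\<in>?S. \<forall>x\<in>Y j. u x \<le> \<epsilon>}"
    by (rule smallable_large) (use insert assms(4,5) in auto)
  moreover have "{(A, u)\<in>?S. \<forall>x\<in>Y j. u x \<le> \<epsilon>} = {(A, u)\<in>S. \<forall>i\<in>insert j I. \<forall>x\<in>Y i. u x \<le> \<epsilon>}" by auto
  ultimately show ?case by simp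
qed

text \<open>Average many members of \<open>S\<close>, each chosen small on the sets \<open>{h n \<ge> \<eta>}\<close> of the earlier ones:
  at any given point at most one of them then exceeds \<open>e\<close>.\<close>

lemma smallable_step:
  assumes K: "0 \<le> K" and sm: "\<And>n. N \<le> n \<Longrightarrow> smallable h X K \<eta> (Y \<inter> {x. h n x \<ge> \<eta>})"
    and "Y \<subseteq> X" "0 < \<eta>"
  shows "smallable h X K \<eta> Y"
  unfolding smallable_def
proof (intro allI impI)
  fix S :: "(nat set \<times> ('a \<Rightarrow> real)) set" and \<epsilon> :: real
  assume S0: "large S" "S \<subseteq> averages h X K \<eta>" and \<epsilon>: "\<eta> < \<epsilon>"
  define S' where "S' = {(A, u)\<in>S. A \<subseteq> {N..}}"
  have S: "large S'" "S' \<subseteq> averages h X K \<eta>" "\<And>A u. (A, u) \<in> S' \<Longrightarrow> A \<subseteq> {N..}"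
    using large_tail[OF S0(1)] S0(2) by (auto simp: S'_def)
  define e where "e = (\<eta> + \<epsilon>) / 2"
  have e: "\<eta> < e" "e < \<epsilon>" "0 < e" using \<epsilon> \<open>0 < \<eta>\<close> by (auto simp: e_def)
  \<comment> \<open>Invariant for the average \<open>u\<close> of \<open>k\<close> members: their
    sum stays below \<open>k * e\<close> up to a single excess \<open>K\<close>, the same for every
    \<open>k\<close>.\<close>
  have "\<exists>A u. (A, u) \<in> S' \<and> (\<forall>x\<in>Y. real k * u x \<le> real k * e + K)" for k
  proof (induction k)
    case 0
    then show ?case using largeD(1)[OF S(1), of 0] K by auto
  next
    case (Suc k)
    then obtain A u where u: "(A, u) \<in> S'" "\<And>x. x \<in> Y \<Longrightarrow> real k * u x \<le> real k * e + K" by blast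
    have avg: "finite A" "\<And>x. x \<in> X \<Longrightarrow> (\<And>i. i \<in> A \<Longrightarrow> h i x < \<eta>) \<Longrightarrow> u x \<le> \<eta>" "A \<subseteq> {N..}"
      using u(1) S(2,3) by (auto simp: averages_def)
    have "large {(B, v)\<in>S'. \<forall>n\<in>A. \<forall>x\<in>Y \<inter> {x. h n x \<ge> \<eta>}. v x \<le> e}"
      by (rule smallable_large_finite[OF avg(1) _ S(1,2) e(1)]) (use avg(3) in \<open>auto intro: sm\<close>)
    from largeD(1)[OF this, of 0] obtain B v where "(B, v) \<in> S'"
      "\<forall>n\<in>A. \<forall>x\<in>Y \<inter> {x. h n x \<ge> \<eta>}. v x \<le> e" by auto
    then have v: "(B, v) \<in> S'" "\<And>n x. n \<in> A \<Longrightarrow> x \<in> Y \<Longrightarrow> h n x \<ge> \<eta> \<Longrightarrow> v x \<le> e" by auto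
    have vK: "v x \<le> K" if "x \<in> Y" for x using v(1) S(2) that \<open>Y \<subseteq> X\<close> by (auto simp: averages_def)
    \<comment> \<open>This weight turns the average of \<open>k\<close> members and the new one
      \<open>v\<close> into the average of \<open>k + 1\<close>.\<close>
    define t where "t = real k / real (Suc k)"
    have t: "0 \<le> t" "t \<le> 1" "real (Suc k) * t = real k" "real (Suc k) * (1 - t) = 1"
      by (auto simp: t_def field_simps)
    have "real (Suc k) * (t * u x + (1 - t) * v x) \<le> real (Suc k) * e + K" if x: "x \<in> Y" for x
    proof -
      have eq: "real (Suc k) * (t * u x + (1 - t) * v x) = real k * u x + v x"
        unfolding distrib_left mult.assoc[symmetric] t by simp
      show ?thesis
      proof (cases "\<exists>n\<in>A. h n x \<ge> \<eta>")
        case True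
        then have "v x \<le> e" using v(2) x by blast
        then show ?thesis unfolding eq using u(2)[OF x] by (simp add: algebra_simps)
      next
        case False
        \<comment> \<open>Here \<open>x\<close> lies in none of the earlier superlevel sets, so
          \<open>u x\<close> is at most \<eta>. No excess has been used at \<open>x\<close> so far,
          and \<open>v\<close> may spend the one allowed \<open>K\<close>.\<close>
        then have "u x \<le> e" using avg(2)[of x] x \<open>Y \<subseteq> X\<close> e by force
        then have "real k * u x \<le> real k * e" by (simp add: mult_left_mono)
        then show ?thesis unfolding eq using vK[OF x] e(3) by (simp add: algebra_simps)
      qed
    qed
    moreover have "(A \<union> B, \<lambda>x. t * u x + (1 - t) * v x) \<in> S'" using largeD(2)[OF S(1) u(1) v(1)] t by blast
    ultimately show ?case by blast
  qed
  \<comment> \<open>For such \<open>k\<close> the excess \<open>K\<close>, divided among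
    \<open>k\<close> members, is less than \<open>\<epsilon> - e\<close>.\<close>
  moreover obtain k where k: "K / (\<epsilon> - e) < real k" using reals_Archimedean2 by blast
  ultimately obtain A u where u: "(A, u) \<in> S'" "\<And>x. x \<in> Y \<Longrightarrow> real k * u x \<le> real k * e + K" by blast
  have kpos: "real k > 0" using k K e by (smt (verit) divide_nonneg_pos)
  have "K \<le> real k * (\<epsilon> - e)" using k e by (simp add: pos_divide_less_eq less_imp_le)
  then have "real k * u x \<le> real k * \<epsilon>" if "x \<in> Y" for x using u(2)[OF that] by (simp add: algebra_simps)
  then have "\<And>x. x \<in> Y \<Longrightarrow> u x \<le> \<epsilon>" using kpos by simp
  then show "\<exists>A u. (A, u) \<in> S \<and> (\<forall>x\<in>Y. u x \<le> \<epsilon>)" using u(1) by (auto simp: S'_def)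
qed

lemma smallable_empty: "smallable h X K \<eta> {}"
  unfolding smallable_def large_def by blast

text \<open>Contrapositive of the averaging step, iterated: a set that is not smallable stays so
  after intersection with a superlevel set of some arbitrarily late \<open>h n\<close>. The
  resulting sets are nonempty because the empty set is smallable.\<close>

lemma not_smallable_imp:
  assumes "0 \<le> K" "0 < \<eta>" "\<not> smallable h X K \<eta> X"
  shows "\<exists>n. strict_mono n \<and> (\<forall>k. \<exists>x\<in>X. \<forall>i<k::nat. h (n i) x \<ge> \<eta>)"
proof -
  have "\<exists>f :: nat \<Rightarrow> nat \<times> 'a set. \<forall>k. (case f k of (n, Y) \<Rightarrow> Y \<subseteq> X \<and> \<not> smallable h X K \<eta> Y) \<and>
      (case f k of (n, Y) \<Rightarrow> case f (Suc k) of (n', Y') \<Rightarrow> n < n' \<and> Y' = Y \<inter> {x. h n' x \<ge> \<eta>})"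
      (is "\<exists>f. \<forall>k. ?A (f k) \<and> ?B (f k) (f (Suc k))")
  proof (rule dependent_nat_choice)
    show "\<exists>y. ?A y" using assms(3) by (intro exI[of _ "(0, X)"]) simp
  next
    fix y :: "nat \<times> 'a set" and k :: nat
    obtain n Y where y: "y = (n, Y)" by (cases y)
    assume "?A y"
    then have "Y \<subseteq> X" "\<not> smallable h X K \<eta> Y" by (auto simp: y)
    then obtain n' where "Suc n \<le> n'" "\<not> smallable h X K \<eta> (Y \<inter> {x. h n' x \<ge> \<eta>})"
      using smallable_step[OF assms(1) _ _ assms(2)] by blast
    then show "\<exists>y'. ?A y' \<and> ?B y y'" using \<open>Y \<subseteq> X\<close>
      by (intro exI[of _ "(n', Y \<inter> {x. h n' x \<ge> \<eta>})"]) (auto simp: y)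
  qed
  then obtain f where "\<forall>k. ?A (f k) \<and> ?B (f k) (f (Suc k))" ..
  then have f: "\<And>k. ?A (f k)" "\<And>k. ?B (f k) (f (Suc k))" by auto
  define n where "n = (\<lambda>k. fst (f (Suc k)))"
  define Y where "Y = (\<lambda>k. snd (f k))"
  have A: "Y k \<subseteq> X" "\<not> smallable h X K \<eta> (Y k)" for k
    using f(1)[of k] by (auto simp: Y_def split: prod.splits)
  have B: "n k < n (Suc k)" "Y (Suc k) = Y k \<inter> {x. h (n k) x \<ge> \<eta>}" for k
    using f(2)[of k] f(2)[of "Suc k"] by (auto simp: n_def Y_def split: prod.splits)
  have "\<forall>x\<in>Y k. \<forall>i<k. h (n i) x \<ge> \<eta>" for k
    by (induction k) (auto simp: B(2) less_Suc_eq)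
  moreover have "Y k \<noteq> {}" for k using A(2)[of k] smallable_empty by metis
  ultimately have "\<exists>x\<in>X. \<forall>i<k. h (n i) x \<ge> \<eta>" for k using A(1)[of k] by blast
  moreover have "strict_mono n" using B(1) by (simp add: strict_mono_Suc_iff)
  ultimately show ?thesis by blast
qed

text \<open>The coefficients are required to vanish off \<open>A\<close> so that two combinations
  can be added over \<open>A \<union> B\<close> without changing either sum.\<close>

lemma convex_combinations_large:
  fixes h :: "nat \<Rightarrow> 'x \<Rightarrow> real"
  assumes h: "\<And>i x. x \<in> X \<Longrightarrow> h i x \<le> K" and "0 < \<eta>"
  defines "S \<equiv> {(A, \<lambda>x. \<Sum>i\<in>A. c i * h i x) | A c. finite A \<and> (\<forall>i. 0 \<le> c i) \<and> (\<forall>i. i \<notin> A \<longrightarrow> c i = 0) \<and> sum c A = 1}"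
  shows "large S" "S \<subseteq> averages h X K \<eta>"
proof -
  show "S \<subseteq> averages h X K \<eta>"
  proof
    fix p assume "p \<in> S"
    then obtain A c where p: "p = (A, \<lambda>x. \<Sum>i\<in>A. c i * h i x)" and c: "finite A" "\<And>i. 0 \<le> c i" "sum c A = 1"
      by (auto simp: S_def)
    have "(\<Sum>i\<in>A. c i * h i x) \<le> B" if "\<And>i. i \<in> A \<Longrightarrow> h i x \<le> B" for x B
    proof -
      have "(\<Sum>i\<in>A. c i * h i x) \<le> (\<Sum>i\<in>A. c i * B)"
        by (intro sum_mono mult_left_mono that c)
      then show ?thesis by (simp add: sum_distrib_right[symmetric] c)
    qed
    then show "p \<in> averages h X K \<eta>" using h c by (auto simp: averages_def p less_imp_le)
  qed
  show "large S"
    unfolding large_def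
  proof (intro conjI allI impI)
    fix N
    have "({N}, \<lambda>x. \<Sum>i\<in>{N}. of_bool (i = N) * h i x) \<in> S"
      unfolding S_def by (intro CollectI exI[of _ "{N}"] exI[of _ "\<lambda>i. of_bool (i = N)"]) auto
    then show "\<exists>A u. (A, u) \<in> S \<and> A \<subseteq> {N..}" by blast
  next
    fix A u B v and t :: real
    assume "(A, u) \<in> S" "(B, v) \<in> S" and t: "0 \<le> t" "t \<le> 1"
    then obtain c d where u: "u = (\<lambda>x. \<Sum>i\<in>A. c i * h i x)" "finite A" "\<And>i. 0 \<le> c i" "\<And>i. i \<notin> A \<Longrightarrow> c i = 0" "sum c A = 1"
      and v: "v = (\<lambda>x. \<Sum>i\<in>B. d i * h i x)" "finite B" "\<And>i. 0 \<le> d i" "\<And>i. i \<notin> B \<Longrightarrow> d i = 0" "sum d B = 1"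
      by (auto simp: S_def)
    define e where "e = (\<lambda>i. t * c i + (1 - t) * d i)"
    have 1: "(\<Sum>i\<in>A. c i * g i) = (\<Sum>i\<in>A \<union> B. c i * g i)" "(\<Sum>i\<in>B. d i * g i) = (\<Sum>i\<in>A \<union> B. d i * g i)" for g
      using u v by (auto intro!: sum.mono_neutral_left)
    have 2: "t * (\<Sum>i\<in>A. c i * g i) + (1 - t) * (\<Sum>i\<in>B. d i * g i) = (\<Sum>i\<in>A \<union> B. e i * g i)" for g
      unfolding 1 e_def by (simp add: sum_distrib_left sum.distrib[symmetric] algebra_simps)
    have "sum e (A \<union> B) = 1" using 2[of "\<lambda>_. 1"] u(5) v(5) by simp
    moreover have "\<And>i. 0 \<le> e i" "\<And>i. i \<notin> A \<union> B \<Longrightarrow> e i = 0" using u v t by (auto simp: e_def)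
    ultimately show "(A \<union> B, \<lambda>x. t * u x + (1 - t) * v x) \<in> S"
      unfolding S_def u(1) v(1) 2 using u(2) v(2) by (intro CollectI exI[of _ "A \<union> B"] exI[of _ e]) auto
  qed
qed

text \<open>If \<open>M\<close> were not smallable, infinitely many closed superlevel sets at height
  \<eta> would have the finite intersection property in the compact set \<open>M\<close>. At a
  common point a subsequence of the \<open>h i\<close> would stay above \<eta> instead of tending to
  0.\<close>

theorem ptak_convex_combination:
  fixes h :: "nat \<Rightarrow> 'x \<Rightarrow> real"
  assumes M: "compactin T M" and cont: "\<And>i. continuous_map T euclideanreal (h i)"
    and bdd: "\<And>i x. x \<in> M \<Longrightarrow> h i x \<le> K"
    and lim: "\<And>x. x \<in> M \<Longrightarrow> (\<lambda>i. h i x) \<longlonglongrightarrow> 0" and "0 < \<epsilon>"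
  obtains A c where "finite A" "\<And>i. 0 \<le> c i" "sum c A = 1" "\<And>x. x \<in> M \<Longrightarrow> (\<Sum>i\<in>A. c i * h i x) \<le> \<epsilon>"
proof -
  define \<eta> where "\<eta> = \<epsilon> / 2"
  define K' where "K' = max K 0"
  have \<eta>: "0 < \<eta>" "\<eta> < \<epsilon>" using \<open>0 < \<epsilon>\<close> by (auto simp: \<eta>_def)
  have bdd': "\<And>i x. x \<in> M \<Longrightarrow> h i x \<le> K'" using bdd by (simp add: K'_def le_max_iff_disj)
  have "smallable h M K' \<eta> M"
  proof (rule ccontr)
    assume "\<not> ?thesis"
    then obtain n where n: "strict_mono n" "\<And>k. \<exists>x\<in>M. \<forall>i<k::nat. h (n i) x \<ge> \<eta>"
      using not_smallable_imp[of K' \<eta> h M] \<eta> by (auto simp: K'_def)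
    define C where "C = (\<lambda>i. {x\<in>topspace T. h (n i) x \<in> {\<eta>..}})"
    have "M \<inter> \<Inter>(range C) \<noteq> {}"
    proof (rule M[unfolded compactin_fip, THEN conjunct2, rule_format])
      show "(\<forall>C\<in>range C. closedin T C) \<and> (\<forall>\<F>. finite \<F> \<and> \<F> \<subseteq> range C \<longrightarrow> M \<inter> \<Inter> \<F> \<noteq> {})"
      proof (intro conjI allI impI ballI)
        fix D assume "D \<in> range C"
        then show "closedin T D"
          unfolding C_def using closedin_continuous_map_preimage[OF cont, of "{\<eta>..}"] by auto
      next
        fix \<F> assume \<F>: "finite \<F> \<and> \<F> \<subseteq> range C"
        then obtain I where I: "finite I" "\<F> = C ` I" by (metis finite_subset_image)
        obtain k where k: "I \<subseteq> {..<k}" using I(1) finite_nat_iff_bounded by blast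
        obtain x where "x \<in> M" "\<forall>i<k. h (n i) x \<ge> \<eta>" using n(2) by blast
        then have "x \<in> M \<inter> \<Inter> \<F>" using k compactin_subset_topspace[OF M] by (auto simp: I C_def)
        then show "M \<inter> \<Inter> \<F> \<noteq> {}" by blast
      qed
    qed
    then obtain x where x: "x \<in> M" "\<And>i. h (n i) x \<ge> \<eta>" by (auto simp: C_def)
    have "(\<lambda>i. h (n i) x) \<longlonglongrightarrow> 0" using LIMSEQ_subseq_LIMSEQ[OF lim[OF x(1)] n(1)] by (simp add: o_def)
    then have "\<eta> \<le> 0" by (rule LIMSEQ_le_const) (use x(2) in auto)
    then show False using \<eta> by simp
  qed
  from this[unfolded smallable_def, rule_format, OF convex_combinations_large[of M h K' \<eta>, OF bdd' \<eta>(1)] \<eta>(2)]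
  obtain A c where "finite A" "\<forall>i. 0 \<le> c i" "sum c A = 1" "\<forall>x\<in>M. (\<Sum>i\<in>A. c i * h i x) \<le> \<epsilon>"
    by auto
  then show ?thesis by (intro that[of A c]) simp_all
qed

section \<open>Sequences equivalent to the unit vector basis on a compact set\<close>

text \<open>The last hypothesis is the lower estimate of an \<open>l1_sequence\<close> for the
  supremum norm over \<open>M\<close>, phrased with an arbitrary upper bound \<open>B\<close> so
  that no supremum has to be formed.\<close>

theorem l1_on_compact_imp_independent:
  fixes f :: "nat \<Rightarrow> 'x \<Rightarrow> real"
  assumes M: "compactin T M" and cont: "\<And>i. continuous_map T euclideanreal (f i)"
    and bdd: "\<And>n x. x \<in> M \<Longrightarrow> \<bar>f n x\<bar> \<le> K"
    and "0 < \<delta>"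
    and l1: "\<And>n c B. (\<And>x. x \<in> M \<Longrightarrow> \<bar>\<Sum>i<n. c i * f i x\<bar> \<le> B) \<Longrightarrow> \<delta> * (\<Sum>i<n. \<bar>c i\<bar>) \<le> B"
  shows "\<exists>r. strict_mono r \<and> independent_on M (\<lambda>n. f (r n))"
proof (cases "\<exists>r. strict_mono r \<and> independent_on M (\<lambda>n. f (r n))")
  case False
  obtain r where 2: "strict_mono r" "\<And>x. x \<in> M \<Longrightarrow> convergent (\<lambda>n. f (r n) x)"
    using rosenthal_dichotomy[of M f K, OF bdd] False by blast
  have l1_finite: "\<delta> * (\<Sum>i\<in>J. \<bar>c i\<bar>) \<le> B"
    if "finite J" "\<And>x. x \<in> M \<Longrightarrow> \<bar>\<Sum>i\<in>J. c i * f i x\<bar> \<le> B" for J c B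
  proof -
    obtain n where n: "J \<subseteq> {..<n}" using \<open>finite J\<close> finite_nat_iff_bounded by blast
    define d where "d = (\<lambda>i. if i \<in> J then c i else 0)"
    have "(\<Sum>i<n. d i * f i x) = (\<Sum>i\<in>J. c i * f i x)" for x
      by (rule sum.mono_neutral_cong_right) (use n in \<open>auto simp: d_def\<close>)
    moreover have "(\<Sum>i<n. \<bar>d i\<bar>) = (\<Sum>i\<in>J. \<bar>c i\<bar>)"
      by (rule sum.mono_neutral_cong_right) (use n in \<open>auto simp: d_def\<close>)
    ultimately show ?thesis using l1[where n=n and c=d and B=B] that(2) by simp
  qed
  have inj: "inj r" using 2(1) by (rule strict_mono_imp_inj_on)
  have l1_r: "\<delta> * (\<Sum>i\<in>J. \<bar>c i\<bar>) \<le> B"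
    if "finite J" "\<And>x. x \<in> M \<Longrightarrow> \<bar>\<Sum>i\<in>J. c i * f (r i) x\<bar> \<le> B" for J c B
  proof -
    have inv: "inv r (r i) = i" for i by (rule inv_f_f[OF inj])
    have re: "(\<Sum>i\<in>r ` J. g i) = (\<Sum>i\<in>J. g (r i))" for g :: "nat \<Rightarrow> real"
      using sum.reindex[of r J g] inj_on_subset[OF inj] by simp
    have "\<bar>\<Sum>i\<in>r ` J. c (inv r i) * f i x\<bar> \<le> B" if "x \<in> M" for x
      unfolding re inv by (rule \<open>\<And>x. x \<in> M \<Longrightarrow> \<bar>\<Sum>i\<in>J. c i * f (r i) x\<bar> \<le> B\<close>[OF that])
    then show ?thesis using l1_finite[where J="r ` J" and c="\<lambda>i. c (inv r i)" and B=B] \<open>finite J\<close> by (simp add: re inv)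
  qed
  \<comment> \<open>The absolute value compensates for the one-sided bound on averages: a
    combination of the \<open>h i\<close> bounded above controls the signed combination of the
    differences on both sides.\<close>
  define h where "h = (\<lambda>i x. \<bar>f (r (2 * i)) x - f (r (2 * i + 1)) x\<bar>)"
  have h1: "continuous_map T euclideanreal (h i)" for i
    unfolding h_def using cont by (intro continuous_intros) auto
  have h2: "h i x \<le> 2 * K" if "x \<in> M" for i x
    using bdd[OF that, of "r (2 * i)"] bdd[OF that, of "r (2 * i + 1)"] by (simp add: h_def)
  have h3: "(\<lambda>i. h i x) \<longlonglongrightarrow> 0" if x: "x \<in> M" for x
  proof -
    obtain l where l: "(\<lambda>i. f (r i) x) \<longlonglongrightarrow> l" using 2(2)[OF x] by (auto simp: convergent_def)
    have "(\<lambda>i. f (r (2 * i)) x) \<longlonglongrightarrow> l" "(\<lambda>i. f (r (2 * i + 1)) x) \<longlonglongrightarrow> l"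
      using LIMSEQ_subseq_LIMSEQ[OF l, of "\<lambda>i. 2 * i"] LIMSEQ_subseq_LIMSEQ[OF l, of "\<lambda>i. 2 * i + 1"]
      by (auto simp: o_def strict_mono_def)
    from tendsto_rabs[OF tendsto_diff[OF this]] show ?thesis by (simp add: h_def)
  qed
  show ?thesis
  proof (rule ptak_convex_combination[OF M h1 h2 h3 \<open>0 < \<delta>\<close>])
    fix A :: "nat set" and c :: "nat \<Rightarrow> real"
    assume A: "finite A" and c: "\<And>i. 0 \<le> c i" "sum c A = 1"
      and small: "\<And>x. x \<in> M \<Longrightarrow> (\<Sum>i\<in>A. c i * h i x) \<le> \<delta>"
    define d where "d = (\<lambda>j. if even j then c (j div 2) else - c (j div 2))"
    define J where "J = (\<lambda>i. 2 * i) ` A \<union> (\<lambda>i. 2 * i + 1) ` A"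
    have J: "(\<Sum>j\<in>J. g j) = (\<Sum>i\<in>A. g (2 * i)) + (\<Sum>i\<in>A. g (2 * i + 1))" for g :: "nat \<Rightarrow> real"
    proof -
      have "(\<Sum>j\<in>J. g j) = sum g ((\<lambda>i. 2 * i) ` A) + sum g ((\<lambda>i. 2 * i + 1) ` A)"
        unfolding J_def by (rule sum.union_disjoint) (use A in \<open>auto, presburger\<close>)
      then show ?thesis by (simp add: sum.reindex inj_on_def)
    qed
    have d: "d (2 * i) = c i" "d (2 * i + 1) = - c i" for i by (auto simp: d_def)
    \<comment> \<open>The averages were made at most \<delta>, while the coefficients of the pairs
      have absolute sum 2, so the lower estimate reads
      \<open>2 * \<delta> \<le> \<delta>\<close>.\<close>
    have "\<delta> * (\<Sum>i\<in>J. \<bar>d i\<bar>) \<le> \<delta>"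
    proof (rule l1_r)
      show "finite J" using A by (simp add: J_def)
      fix x assume x: "x \<in> M"
      have "(\<Sum>i\<in>J. d i * f (r i) x) = (\<Sum>i\<in>A. c i * (f (r (2 * i)) x - f (r (2 * i + 1)) x))"
        unfolding J d by (simp add: algebra_simps sum_subtractf sum_negf)
      also have "\<bar>\<dots>\<bar> \<le> (\<Sum>i\<in>A. c i * h i x)"
        by (rule order_trans[OF sum_abs]) (simp add: h_def abs_mult c(1))
      finally show "\<bar>\<Sum>i\<in>J. d i * f (r i) x\<bar> \<le> \<delta>" using small[OF x] by linarith
    qed
    moreover have "(\<Sum>i\<in>J. \<bar>d i\<bar>) = 2" unfolding J d using c by simp
    ultimately show ?thesis using \<open>0 < \<delta>\<close> by simp
  qed
qed blast

section \<open>Functions of compact support on locally compact groups\<close>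

definition compact_support :: "('a::topological_space \<Rightarrow> real) \<Rightarrow> bool" where
  "compact_support f \<longleftrightarrow> continuous_on UNIV f \<and> (\<exists>C. compact C \<and> (\<forall>x. x \<notin> C \<longrightarrow> f x = 0))"

lemma compact_supportI:
  "continuous_on UNIV f \<Longrightarrow> compact C \<Longrightarrow> (\<And>x. x \<notin> C \<Longrightarrow> f x = 0) \<Longrightarrow> compact_support f"
  unfolding compact_support_def by blast

lemma compact_support_borel: "compact_support f \<Longrightarrow> f \<in> borel_measurable borel"
  unfolding compact_support_def by (auto intro: borel_measurable_continuous_onI)

lemma compact_support_bounded:
  assumes "compact_support f"
  obtains B where "\<And>x. \<bar>f x\<bar> \<le> B" "0 \<le> B"
proof -
  obtain C where C: "compact C" "\<And>x. x \<notin> C \<Longrightarrow> f x = 0" and f: "continuous_on UNIV f"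
    using assms unfolding compact_support_def by blast
  have "bounded (f ` C)"
    using compact_continuous_image[OF continuous_on_subset[OF f subset_UNIV] C(1)] compact_imp_bounded by blast
  then obtain B where B: "\<And>x. x \<in> C \<Longrightarrow> \<bar>f x\<bar> \<le> B" unfolding bounded_iff by auto
  have "\<bar>f x\<bar> \<le> max B 0" for x using B[of x] C(2)[of x] by (cases "x \<in> C") auto
  then show ?thesis using that[of "max B 0"] by simp
qed

text \<open>The product of the Borel sigma-algebras may be smaller than the Borel sigma-algebra of the
  product; continuous functions of compact support are measurable for the smaller one.\<close>

lemma compact_support_borel_product_nonneg:
  fixes F :: "'a::topological_space \<times> 'b::topological_space \<Rightarrow> real"
  assumes "compact_support F" and nonneg: "\<And>z. 0 \<le> F z"
  shows "F \<in> borel_measurable (borel \<Otimes>\<^sub>M borel)"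
proof (rule borel_measurable_iff_greater[THEN iffD2], intro allI)
  fix r :: real
  obtain C where C: "compact C" "\<And>x. x \<notin> C \<Longrightarrow> F x = 0" and F: "continuous_on UNIV F"
    using assms(1) unfolding compact_support_def by blast
  have "{z. r < F z} \<in> sets (borel \<Otimes>\<^sub>M borel)"
  proof (cases "r < 0")
    case True
    then have "{z. r < F z} = space (borel \<Otimes>\<^sub>M borel)"
      using nonneg by (auto simp: space_pair_measure intro: less_le_trans)
    then show ?thesis by (metis sets.top)
  next
    case False
    have op: "open {z. r < F z}" using F by (intro open_Collect_less continuous_on_const)
    \<comment> \<open>Since \<open>r\<close> is nonnegative here, the level
      \<open>r + 1 / Suc n\<close> is positive and its superlevel set is a closed subset of
      \<open>C\<close>. Being compact, it is covered by finitely many open rectangles inside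
      \<open>{z. r < F z}\<close>; their union is the interpolating set.\<close>
    have "\<exists>B\<in>sets (borel \<Otimes>\<^sub>M borel). {z. r + 1 / Suc n \<le> F z} \<subseteq> B \<and> B \<subseteq> {z. r < F z}" for n
    proof -
      have "closed {z. r + 1 / Suc n \<le> F z}" using F by (intro closed_Collect_le continuous_on_const)
      moreover have "{z. r + 1 / Suc n \<le> F z} \<subseteq> C"
      proof (rule subsetI, rule ccontr)
        fix z assume "z \<in> {z. r + 1 / Suc n \<le> F z}" "z \<notin> C"
        then have "r + 1 / Suc n \<le> 0" using C(2)[of z] by simp
        moreover have "r + 1 / Suc n > 0" using False by (intro add_nonneg_pos) auto
        ultimately show False by linarith
      qed
      ultimately have cpt: "compact {z. r + 1 / Suc n \<le> F z}"
        using C(1) by (metis Int_absorb1 compact_Int_closed)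
      have sub: "{z. r + 1 / Suc n \<le> F z} \<subseteq> {z. r < F z}"
        by (auto intro: less_le_trans[of r "r + 1 / real (Suc n)"])
      define \<C> where "\<C> = {A \<times> B | A B. open A \<and> open B \<and> A \<times> B \<subseteq> {z. r < F z}}"
      have "{z. r + 1 / Suc n \<le> F z} \<subseteq> \<Union>\<C>"
      proof
        fix z assume "z \<in> {z. r + 1 / Suc n \<le> F z}"
        then have "z \<in> {z. r < F z}" using sub by blast
        then obtain A B where "open A" "open B" "z \<in> A \<times> B" "A \<times> B \<subseteq> {z. r < F z}"
          by (rule open_prod_elim[OF op])
        then have "A \<times> B \<in> \<C>" unfolding \<C>_def by blast
        then show "z \<in> \<Union>\<C>" using \<open>z \<in> A \<times> B\<close> by (rule UnionI)
      qed
      moreover have "\<And>D. D \<in> \<C> \<Longrightarrow> open D" unfolding \<C>_def by (auto intro: open_Times)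
      ultimately obtain \<D> where D: "\<D> \<subseteq> \<C>" "finite \<D>" "{z. r + 1 / Suc n \<le> F z} \<subseteq> \<Union>\<D>"
        by (rule compactE[OF cpt])
      have "D \<in> \<C> \<Longrightarrow> D \<in> sets (borel \<Otimes>\<^sub>M borel)" for D unfolding \<C>_def by auto
      then have "\<Union>\<D> \<in> sets (borel \<Otimes>\<^sub>M borel)" using D by (intro sets.finite_Union) auto
      then show ?thesis using D unfolding \<C>_def by (intro bexI[of _ "\<Union>\<D>"]) auto
    qed
    then obtain B where B: "\<And>n. B n \<in> sets (borel \<Otimes>\<^sub>M borel)"
      "\<And>n. {z. r + 1 / Suc n \<le> F z} \<subseteq> B n" "\<And>n. B n \<subseteq> {z. r < F z}" by metis
    have "{z. r < F z} = (\<Union>n. B n)"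
    proof
      show "{z. r < F z} \<subseteq> (\<Union>n. B n)"
      proof
        fix z assume "z \<in> {z. r < F z}"
        then obtain n where "inverse (real (Suc n)) < F z - r" using reals_Archimedean[of "F z - r"] by auto
        then have "r + 1 / Suc n \<le> F z" by (simp add: inverse_eq_divide)
        then show "z \<in> (\<Union>n. B n)" using B(2)[of n] by blast
      qed
    qed (use B(3) in blast)
    then show ?thesis using B(1) by (metis sets.countable_UN subset_UNIV image_subset_iff)
  qed
  then show "{w \<in> space (borel \<Otimes>\<^sub>M borel). r < F w} \<in> sets (borel \<Otimes>\<^sub>M borel)"
    by (simp add: space_pair_measure)
qed

lemma compact_support_borel_product:
  fixes F :: "'a::topological_space \<times> 'b::topological_space \<Rightarrow> real"
  assumes "compact_support F"
  shows "F \<in> borel_measurable (borel \<Otimes>\<^sub>M borel)"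
proof -
  obtain C where C: "compact C" "\<And>x. x \<notin> C \<Longrightarrow> F x = 0" and F: "continuous_on UNIV F"
    using assms unfolding compact_support_def by blast
  have "compact_support (\<lambda>z. max (F z) 0)" "compact_support (\<lambda>z. max (- F z) 0)"
    by (rule compact_supportI[OF _ C(1)]; use F C(2) in \<open>auto intro!: continuous_intros\<close>)+
  then have "(\<lambda>z. max (F z) 0 - max (- F z) 0) \<in> borel_measurable (borel \<Otimes>\<^sub>M borel)"
    by (intro borel_measurable_diff compact_support_borel_product_nonneg) auto
  moreover have "(\<lambda>z. max (F z) 0 - max (- F z) 0) = F" by (auto simp: max_def)
  ultimately show ?thesis by simp
qed

lemma euclidean_completely_regular:
  "completely_regular_space (euclidean :: 'a::locally_compact_group topology)"
proof (rule locally_compact_regular_imp_completely_regular_space)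
  show "locally_compact_space (euclidean :: 'a topology)"
    unfolding locally_compact_space_def using locally_compact by (auto 4 4)
  show "Hausdorff_space (euclidean :: 'a topology) \<or> regular_space (euclidean :: 'a topology)"
    unfolding Hausdorff_space_def using hausdorff by (auto simp: disjnt_def)
qed

lemma compact_in_open_relatively_compact:
  fixes K :: "'a::locally_compact_group set"
  assumes "compact K" "open U" "K \<subseteq> U"
  obtains V C where "open V" "compact C" "K \<subseteq> V" "V \<subseteq> C" "V \<subseteq> U"
proof -
  have "\<forall>x::'a. \<exists>W. \<exists>C. open W \<and> compact C \<and> x \<in> W \<and> W \<subseteq> C" using locally_compact by blast
  then obtain W where "\<forall>x::'a. \<exists>C. open (W x) \<and> compact C \<and> x \<in> W x \<and> W x \<subseteq> C" by (rule choice[THEN exE])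
  then obtain C where W: "\<forall>x::'a. open (W x) \<and> compact (C x) \<and> x \<in> W x \<and> W x \<subseteq> C x" by (rule choice[THEN exE])
  have "K \<subseteq> (\<Union>x\<in>K. W x)" using W by blast
  then obtain D where D: "D \<subseteq> K" "finite D" "K \<subseteq> (\<Union>x\<in>D. W x)"
    using compactE_image[OF assms(1), of K W] W by metis
  show ?thesis
  proof (rule that[of "(\<Union>x\<in>D. W x) \<inter> U" "\<Union>x\<in>D. C x"])
    show "compact (\<Union>x\<in>D. C x)" using D(2) W by (intro compact_UN) auto
    show "open ((\<Union>x\<in>D. W x) \<inter> U)" using W assms(2) by (intro open_UN open_Int) auto
    show "K \<subseteq> (\<Union>x\<in>D. W x) \<inter> U" "(\<Union>x\<in>D. W x) \<inter> U \<subseteq> (\<Union>x\<in>D. C x)" "(\<Union>x\<in>D. W x) \<inter> U \<subseteq> U"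
      using D(3) W assms(3) by blast+
  qed
qed

text \<open>Separating \<open>K\<close> from the complement of a relatively compact open
  \<open>V\<close> inside \<open>U\<close>, not of \<open>U\<close> itself, is what gives the
  function compact support.\<close>

lemma urysohn_compact_open:
  fixes K :: "'a::locally_compact_group set"
  assumes "compact K" "open U" "K \<subseteq> U"
  obtains f where "compact_support f" "\<And>x. 0 \<le> f x" "\<And>x. f x \<le> 1"
    "\<And>x. x \<in> K \<Longrightarrow> f x = 1" "\<And>x. x \<notin> U \<Longrightarrow> f x = 0"
proof -
  obtain V C where V: "open V" "compact C" "K \<subseteq> V" "V \<subseteq> C" "V \<subseteq> U"
    using compact_in_open_relatively_compact[OF assms] by blast
  have "disjnt K (- V)" using V(3) by (auto simp: disjnt_def)
  then obtain f where f: "continuous_map euclidean (top_of_set {0..1::real}) f" "f ` (- V) \<subseteq> {0}" "f ` K \<subseteq> {1}"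
    using Urysohn_completely_regular_compact_closed[of 0 1 "euclidean :: 'a topology" K "- V"]
      euclidean_completely_regular assms(1) V(1) by (auto simp: closed_Compl)
  have f01: "f x \<in> {0..1}" for x using f(1) by (auto simp: continuous_map_in_subtopology)
  have cont: "continuous_on UNIV f" using f(1) by (auto simp: continuous_map_in_subtopology)
  have "compact_support f"
    by (rule compact_supportI[OF cont V(2)]) (use f(2) V(4) in auto)
  moreover have "f x = 0" if "x \<notin> U" for x using f(2) V(5) that by blast
  ultimately show ?thesis using f01 f(3) by (intro that[of f]) auto
qed

section \<open>Haar measure and convolution\<close>

text \<open>The uncompleted Borel measure: translations, inversion and the product sigma-algebra are
  handled here, and the results are carried over to the completed \<open>haar\<close>
  afterwards.\<close>

locale sigma_finite_left_haar =
  fixes \<mu> :: "'g::locally_compact_group measure"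
  assumes left_haar: "left_haar_measure \<mu>"
    and sigma_finite_haar: "sigma_finite_measure \<mu>"
begin

sublocale sigma_finite_measure \<mu> by (rule sigma_finite_haar)
sublocale pair: pair_sigma_finite \<mu> \<mu> by standard

lemma sets_mu [measurable_cong, simp]: "sets \<mu> = sets borel"
  using left_haar unfolding left_haar_measure_def borel_def by simp

lemma space_mu [simp]: "space \<mu> = UNIV"
  using sets_eq_imp_space_eq[OF sets_mu] by simp

lemma emeasure_nonzero: "emeasure \<mu> UNIV \<noteq> 0"
  and emeasure_compact: "compact K \<Longrightarrow> emeasure \<mu> K < \<infinity>"
  and outer_regular: "A \<in> sets borel \<Longrightarrow> emeasure \<mu> A = (INF U\<in>{U. open U \<and> A \<subseteq> U}. emeasure \<mu> U)"
  and inner_regular_open: "open U \<Longrightarrow> emeasure \<mu> U = (SUP K\<in>{K. compact K \<and> K \<subseteq> U}. emeasure \<mu> K)"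
  and emeasure_translate: "A \<in> sets borel \<Longrightarrow> emeasure \<mu> ((\<lambda>x. g + x) ` A) = emeasure \<mu> A"
  using left_haar unfolding left_haar_measure_def sets_mu[symmetric] by auto

lemma borel_compact': "compact (K :: 'g set) \<Longrightarrow> K \<in> sets borel"
  by (simp add: compact_imp_closed)

lemma compact_support_integrable:
  assumes "compact_support f"
  shows "integrable \<mu> f"
proof -
  obtain C where C: "compact C" "\<And>x. x \<notin> C \<Longrightarrow> f x = 0" using assms unfolding compact_support_def by blast
  obtain B where B: "\<And>x. \<bar>f x\<bar> \<le> B" using compact_support_bounded[OF assms] by blast
  have "integrable \<mu> (\<lambda>x. B * indicator C x)"
    using emeasure_compact[OF C(1)] borel_compact'[OF C(1)] by (intro integrable_mult_right integrable_real_indicator) auto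
  moreover have "f \<in> borel_measurable \<mu>" using compact_support_borel[OF assms] by simp
  ultimately show ?thesis
    by (rule Bochner_Integration.integrable_bound) (use B C(2) in \<open>auto simp: indicator_def intro!: AE_I2 order_trans[OF _ abs_ge_self]\<close>)
qed

section \<open>Translations, positivity on open sets and regularity\<close>

lemma continuous_left_translation: "continuous_on UNIV (\<lambda>x::'g. g + x)"
  by (intro continuous_intros)

lemma measurable_left_translation [measurable]: "(\<lambda>x::'g. g + x) \<in> borel \<rightarrow>\<^sub>M borel"
  by (intro borel_measurable_continuous_onI continuous_left_translation)

lemma measurable_uminus_group [measurable]: "(\<lambda>x::'g. - x) \<in> borel \<rightarrow>\<^sub>M borel"
  by (intro borel_measurable_continuous_onI continuous_intros)

lemma measurable_right_translation [measurable]: "(\<lambda>x::'g. x + g) \<in> borel \<rightarrow>\<^sub>M borel"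
  by (intro borel_measurable_continuous_onI continuous_intros)

lemma distr_left_translation: "distr \<mu> borel (\<lambda>x. g + x) = \<mu>"
proof (rule measure_eqI)
  fix A assume "A \<in> sets (distr \<mu> borel ((+) g))"
  then have A: "A \<in> sets borel" by simp
  have "(\<lambda>x. g + x) -` A = (\<lambda>x. - g + x) ` A"
  proof
    show "(+) g -` A \<subseteq> (+) (- g) ` A"
    proof
      fix x assume "x \<in> (+) g -` A"
      then show "x \<in> (+) (- g) ` A" by (intro image_eqI[of _ _ "g + x"]) (auto simp: add.assoc[symmetric])
    qed
  qed (auto simp: add.assoc[symmetric])
  then show "emeasure (distr \<mu> borel ((+) g)) A = emeasure \<mu> A"
    using A emeasure_translate[of A "- g"] by (simp add: emeasure_distr)
qed simp

lemma nn_integral_left_translation: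
  assumes "f \<in> borel_measurable borel"
  shows "(\<integral>\<^sup>+x. f (g + x) \<partial>\<mu>) = (\<integral>\<^sup>+x. f x \<partial>\<mu>)"
proof -
  have "(\<integral>\<^sup>+x. f x \<partial>\<mu>) = (\<integral>\<^sup>+x. f x \<partial>distr \<mu> borel (\<lambda>x. g + x))" by (simp add: distr_left_translation)
  also have "\<dots> = (\<integral>\<^sup>+x. f (g + x) \<partial>\<mu>)"
    using assms by (intro nn_integral_distr) auto
  finally show ?thesis by simp
qed

text \<open>Finitely many translates of a nonempty open set cover any given compact set. If the open
  set were null, all compact sets would be null, and by inner regularity the whole group.\<close>

lemma emeasure_open_pos:
  assumes "open U" "U \<noteq> {}"
  shows "emeasure \<mu> U > 0"
proof (rule ccontr)
  assume "\<not> ?thesis"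
  then have U0: "emeasure \<mu> U = 0" by simp
  obtain u where u: "u \<in> U" using assms(2) by blast
  have K0: "emeasure \<mu> K = 0" if K: "compact K" for K
  proof -
    \<comment> \<open>The left translate of \<open>U\<close> that carries \<open>u\<close> to
      \<open>k\<close>, hence a neighbourhood of \<open>k\<close>.\<close>
    define V where "V = (\<lambda>k. (\<lambda>x. (k - u) + x) ` U)"
    have V: "V k = (\<lambda>x. - (k - u) + x) -` U" for k
    proof
      show "(\<lambda>x. - (k - u) + x) -` U \<subseteq> V k"
      proof
        fix x assume "x \<in> (\<lambda>x. - (k - u) + x) -` U"
        then show "x \<in> V k" unfolding V_def
          by (intro image_eqI[of _ _ "- (k - u) + x"]) (auto simp: add.assoc[symmetric] simp del: minus_diff_eq)
      qed
    qed (auto simp: V_def add.assoc[symmetric] simp del: minus_diff_eq)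
    have "open (V k)" for k
      unfolding V by (intro open_vimage assms(1) continuous_left_translation)
    moreover have "k \<in> V k" for k
      unfolding V_def using u by (intro image_eqI[of _ _ u]) auto
    ultimately obtain D where D: "D \<subseteq> K" "finite D" "K \<subseteq> (\<Union>k\<in>D. V k)"
      using compactE_image[OF K, of K V] by (metis UN_I subsetI)
    have null: "V k \<in> null_sets \<mu>" for k
      using emeasure_translate[of U "k - u"] U0 \<open>open (V k)\<close> assms(1) by (auto simp: null_sets_def V_def)
    have "(\<Union>k\<in>D. V k) \<in> null_sets \<mu>"
      using D(2) null by (intro null_sets.finite_UN) auto
    then have "emeasure \<mu> K \<le> 0" using D(3)
      by (metis emeasure_mono null_setsD1 null_setsD2)
    then show ?thesis by simp
  qed
  have "emeasure \<mu> UNIV = (SUP K\<in>{K. compact K \<and> K \<subseteq> UNIV}. emeasure \<mu> K)"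
    by (rule inner_regular_open) simp
  also have "\<dots> \<le> 0" by (rule SUP_least) (simp add: K0)
  finally show False using emeasure_nonzero by simp
qed

text \<open>Inner regularity is given only for open sets. For a Borel set \<open>E\<close> take an
  open \<open>U\<close> around \<open>E\<close>, a compact \<open>C\<close> in \<open>U\<close>, and
  an open \<open>W\<close> around \<open>U - E\<close>, each nearly of the same measure; then
  \<open>C - W\<close> is compact and contained in \<open>E\<close>.\<close>

lemma regular_approximation:
  assumes E: "E \<in> sets borel" "emeasure \<mu> E < \<infinity>" and "0 < e"
  obtains K U where "compact K" "open U" "K \<subseteq> E" "E \<subseteq> U" "emeasure \<mu> (U - K) < ennreal e"
proof -
  have outer: "\<exists>U. open U \<and> A \<subseteq> U \<and> emeasure \<mu> U < emeasure \<mu> A + ennreal d"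
    if "A \<in> sets borel" "emeasure \<mu> A < \<infinity>" "0 < d" for A d
  proof -
    have "emeasure \<mu> A < emeasure \<mu> A + ennreal d"
      using that by (simp add: ennreal_add_left_cancel_less less_top)
    then have "(INF U\<in>{U. open U \<and> A \<subseteq> U}. emeasure \<mu> U) < emeasure \<mu> A + ennreal d"
      using outer_regular[OF that(1)] by simp
    then show ?thesis unfolding INF_less_iff by auto
  qed
  \<comment> \<open>The three errors, one from \<open>U - C\<close> and two from \<open>W\<close>,
    add up to \<open>3 * d\<close>, strictly below \<open>e\<close>.\<close>
  define d where "d = e / 4"
  have d: "0 < d" using \<open>0 < e\<close> by (simp add: d_def)
  obtain U where U: "open U" "E \<subseteq> U" "emeasure \<mu> U < emeasure \<mu> E + ennreal d"
    using outer[OF E d] by blast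
  have Ufin: "emeasure \<mu> U < \<infinity>" using order.strict_trans2[OF U(3) top_greatest] by simp
  have UE: "emeasure \<mu> (U - E) \<le> ennreal d"
  proof -
    have "emeasure \<mu> (U - E) = emeasure \<mu> U - emeasure \<mu> E"
      using E U by (intro emeasure_Diff) auto
    also have "\<dots> \<le> ennreal d" using U(3) E(2)
      by (metis add.commute ennreal_minus_le_iff infinity_ennreal_def less_imp_le top.not_eq_extremum)
    finally show ?thesis .
  qed
  obtain C where C: "compact C" "C \<subseteq> U" "emeasure \<mu> (U - C) \<le> ennreal d"
  proof (cases "emeasure \<mu> U = 0")
    case True
    then show ?thesis using that[of "{}"] by simp
  next
    case False
    have "emeasure \<mu> U - ennreal d < emeasure \<mu> U"
      using False Ufin d by (intro ennreal_between) (auto simp: less_top zero_less_iff_neq_zero)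
    then have "\<exists>C\<in>{K. compact K \<and> K \<subseteq> U}. emeasure \<mu> U - ennreal d < emeasure \<mu> C"
      using inner_regular_open[OF U(1)] by (metis (no_types, lifting) less_SUP_iff)
    then obtain C where C: "compact C" "C \<subseteq> U" "emeasure \<mu> U - ennreal d < emeasure \<mu> C" by blast
    have "emeasure \<mu> (U - C) = emeasure \<mu> U - emeasure \<mu> C"
      using C U emeasure_compact[OF C(1)] borel_compact' by (intro emeasure_Diff) auto
    also have "\<dots> \<le> ennreal d"
      using less_imp_le[OF C(3)] Ufin by (auto simp: ennreal_minus_le_iff add.commute)
    finally show ?thesis using C that by blast
  qed
  obtain W where W: "open W" "U - E \<subseteq> W" "emeasure \<mu> W < emeasure \<mu> (U - E) + ennreal d"
    using outer[of "U - E" d] UE d E U by (metis borel_open ennreal_less_top infinity_ennreal_def order.strict_trans1 sets.Diff)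
  have Wd: "emeasure \<mu> W \<le> ennreal d + ennreal d"
    using W(3) UE by (meson add_right_mono less_imp_le order_trans)
  show ?thesis
  proof (rule that[of "C - W" U])
    show "compact (C - W)" using C(1) W(1) by (rule compact_diff)
    have "U - (C - W) \<subseteq> (U - C) \<union> W" by blast
    then have "emeasure \<mu> (U - (C - W)) \<le> emeasure \<mu> ((U - C) \<union> W)"
      using U W C borel_compact' by (intro emeasure_mono) auto
    also have "\<dots> \<le> emeasure \<mu> (U - C) + emeasure \<mu> W"
      using U W C borel_compact' by (intro emeasure_subadditive) auto
    also have "\<dots> \<le> ennreal d + (ennreal d + ennreal d)" using C(3) Wd by (rule add_mono)
    also have "\<dots> = ennreal (3 * d)" using d by (simp add: ennreal_plus[symmetric] del: ennreal_plus)
    also have "\<dots> < ennreal e" using \<open>0 < e\<close> by (simp add: d_def ennreal_less_iff)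
    finally show "emeasure \<mu> (U - (C - W)) < ennreal e" .
  qed (use U W C in auto)
qed

section \<open>Approximation of integrable functions by continuous functions of compact
  support\<close>

lemma compact_support_dense:
  assumes "integrable \<mu> f" "0 < e"
  shows "\<exists>g. compact_support g \<and> (LINT x|\<mu>. \<bar>f x - g x\<bar>) < e"
  using assms
proof (induction arbitrary: e rule: integrable_induct)
  case (base A c)
  define d where "d = e / (\<bar>c\<bar> + 1)"
  have d: "0 < d" using base.prems by (simp add: d_def)
  obtain K U where KU: "compact K" "open U" "K \<subseteq> A" "A \<subseteq> U" "emeasure \<mu> (U - K) < ennreal d"
    using regular_approximation[of A d] base d by auto
  obtain g where g: "compact_support g" "\<And>x. 0 \<le> g x" "\<And>x. g x \<le> 1"
    "\<And>x. x \<in> K \<Longrightarrow> g x = 1" "\<And>x. x \<notin> U \<Longrightarrow> g x = 0"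
    using urysohn_compact_open[OF KU(1,2)] KU(3,4) by (metis order_trans)
  have UK: "U - K \<in> sets \<mu>" using KU borel_compact' by auto
  have cs: "compact_support (\<lambda>x. c * g x)"
    using g(1) unfolding compact_support_def by (auto intro!: continuous_intros)
  have "\<bar>indicator A x *\<^sub>R c - c * g x\<bar> \<le> \<bar>c\<bar> * indicator (U - K) x" for x
  proof -
    have "\<bar>indicator A x - g x\<bar> \<le> indicator (U - K) x"
      using g(2,3)[of x] g(4,5)[of x] KU(3,4) by (auto simp: indicator_def)
    then have "\<bar>c\<bar> * \<bar>indicator A x - g x\<bar> \<le> \<bar>c\<bar> * indicator (U - K) x" by (rule mult_left_mono) simp
    then show ?thesis by (simp add: abs_mult[symmetric] algebra_simps)
  qed
  then have "(LINT x|\<mu>. \<bar>indicator A x *\<^sub>R c - c * g x\<bar>) \<le> (LINT x|\<mu>. \<bar>c\<bar> * indicator (U - K) x)"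
    using UK KU(5) base(1,2) compact_support_integrable[OF cs]
    by (intro integral_mono integrable_abs Bochner_Integration.integrable_diff integrable_mult_right integrable_real_indicator integrable_scaleR_left)
       (auto simp: less_top[symmetric] order.strict_trans)
  also have "\<dots> = \<bar>c\<bar> * measure \<mu> (U - K)" using UK by simp
  also have "\<dots> \<le> \<bar>c\<bar> * d"
    using KU(5) d by (intro mult_left_mono) (auto simp: measure_def enn2real_leI less_imp_le)
  also have "\<dots> < e" using base.prems by (simp add: d_def field_simps)
  finally show ?case using cs by blast
next
  case (add f1 f2)
  obtain g1 where g1: "compact_support g1" "(LINT x|\<mu>. \<bar>f1 x - g1 x\<bar>) < e / 2" using add.IH(1)[of "e / 2"] add.prems by auto
  obtain g2 where g2: "compact_support g2" "(LINT x|\<mu>. \<bar>f2 x - g2 x\<bar>) < e / 2" using add.IH(2)[of "e / 2"] add.prems by auto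
  obtain C1 C2 where "compact C1" "compact C2" "\<And>x. x \<notin> C1 \<Longrightarrow> g1 x = 0" "\<And>x. x \<notin> C2 \<Longrightarrow> g2 x = 0"
    using g1(1) g2(1) unfolding compact_support_def by auto
  then have "compact_support (\<lambda>x. g1 x + g2 x)"
    using g1(1) g2(1) by (intro compact_supportI[of _ "C1 \<union> C2"]) (auto simp: compact_support_def intro!: continuous_intros)
  moreover have "(LINT x|\<mu>. \<bar>f1 x + f2 x - (g1 x + g2 x)\<bar>) \<le> (LINT x|\<mu>. \<bar>f1 x - g1 x\<bar> + \<bar>f2 x - g2 x\<bar>)"
    using add.hyps compact_support_integrable[OF g1(1)] compact_support_integrable[OF g2(1)] by (intro integral_mono) auto
  moreover have "\<dots> = (LINT x|\<mu>. \<bar>f1 x - g1 x\<bar>) + (LINT x|\<mu>. \<bar>f2 x - g2 x\<bar>)"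
    using add.hyps compact_support_integrable[OF g1(1)] compact_support_integrable[OF g2(1)] by simp
  ultimately show ?case using g1(2) g2(2) by (intro exI[of _ "\<lambda>x. g1 x + g2 x"]) auto
next
  case (lim f s)
  have "(\<lambda>i. LINT x|\<mu>. \<bar>s i x - f x\<bar>) \<longlonglongrightarrow> (LINT x|\<mu>. 0)"
  proof (rule integral_dominated_convergence[where w="\<lambda>x. 3 * \<bar>f x\<bar>"])
    show "AE x in \<mu>. (\<lambda>i. \<bar>s i x - f x\<bar>) \<longlonglongrightarrow> 0"
      using lim by (auto intro!: AE_I2 tendsto_rabs_zero LIM_zero)
    show "AE x in \<mu>. norm \<bar>s i x - f x\<bar> \<le> 3 * \<bar>f x\<bar>" for i
    proof (rule AE_I2)
      fix x assume "x \<in> space \<mu>"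
      then have "\<bar>s i x\<bar> \<le> 2 * \<bar>f x\<bar>" using lim by auto
      then show "norm \<bar>s i x - f x\<bar> \<le> 3 * \<bar>f x\<bar>" by simp
    qed
  qed (use lim in auto)
  then have "eventually (\<lambda>i. (LINT x|\<mu>. \<bar>s i x - f x\<bar>) < e / 2) sequentially"
    using lim.prems by (intro order_tendstoD) auto
  then obtain i where i: "(LINT x|\<mu>. \<bar>s i x - f x\<bar>) < e / 2" by (auto simp: eventually_sequentially)
  obtain g where g: "compact_support g" "(LINT x|\<mu>. \<bar>s i x - g x\<bar>) < e / 2" using lim.IH[of "e / 2" i] lim.prems by auto
  have "(LINT x|\<mu>. \<bar>f x - g x\<bar>) \<le> (LINT x|\<mu>. \<bar>s i x - f x\<bar> + \<bar>s i x - g x\<bar>)"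
    using lim.hyps compact_support_integrable[OF g(1)] by (intro integral_mono) auto
  moreover have "\<dots> = (LINT x|\<mu>. \<bar>s i x - f x\<bar>) + (LINT x|\<mu>. \<bar>s i x - g x\<bar>)"
    using lim.hyps compact_support_integrable[OF g(1)] by simp
  ultimately show ?case using i g by (intro exI[of _ g]) auto
qed

lemma compact_support_AE_limit:
  assumes "integrable \<mu> f"
  obtains g where "\<And>k. compact_support (g k)" "AE x in \<mu>. (\<lambda>k. g k x) \<longlonglongrightarrow> f x"
proof -
  have "\<forall>k. \<exists>g. compact_support g \<and> (LINT x|\<mu>. \<bar>f x - g x\<bar>) < 1 / real (Suc k)"
    using compact_support_dense[OF assms] by simp
  then obtain g where g: "\<forall>k. compact_support (g k) \<and> (LINT x|\<mu>. \<bar>f x - g k x\<bar>) < 1 / real (Suc k)"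
    by (rule choice[THEN exE])
  have "(\<lambda>k. LINT x|\<mu>. norm (g k x - f x)) \<longlonglongrightarrow> 0"
  proof (rule tendsto_sandwich[where f="\<lambda>_. 0"])
    show "eventually (\<lambda>k. (LINT x|\<mu>. norm (g k x - f x)) \<le> 1 / real (Suc k)) sequentially"
      using g by (auto simp: abs_minus_commute less_imp_le)
    show "(\<lambda>k. 1 / real (Suc k)) \<longlonglongrightarrow> 0" by (rule LIMSEQ_Suc[OF lim_1_over_n])
  qed auto
  moreover have "integrable \<mu> (\<lambda>x. g k x - f x)" for k
    using assms g compact_support_integrable by auto
  ultimately obtain r where r: "strict_mono r" "AE x in \<mu>. (\<lambda>n. g (r n) x - f x) \<longlonglongrightarrow> 0"
    using tendsto_L1_AE_subseq[of \<mu> "\<lambda>k x. g k x - f x"] by auto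
  show ?thesis
    by (rule that[of "\<lambda>k. g (r k)"]) (use g r in \<open>auto elim!: eventually_mono simp: LIM_zero_iff\<close>)
qed

section \<open>Null sets under translation and inversion\<close>

lemma AE_left_translation:
  assumes "AE x in \<mu>. P x"
  shows "AE x in \<mu>. P (g + x)"
proof -
  obtain N where N: "N \<in> null_sets \<mu>" "{x. \<not> P x} \<subseteq> N" using assms unfolding eventually_ae_filter by auto
  have "emeasure \<mu> ((\<lambda>x. g + x) -` N) = emeasure (distr \<mu> borel (\<lambda>x. g + x)) N"
    using N(1) by (subst emeasure_distr) auto
  then have "(\<lambda>x. g + x) -` N \<in> null_sets \<mu>"
    using N(1) measurable_sets[OF measurable_left_translation[of g], of N]
    by (auto simp: distr_left_translation null_sets_def)
  then show ?thesis by (rule AE_I') (use N(2) in auto)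
qed

text \<open>The kernels vanish off continuous images of \<open>C \<times> D\<close>, hence off
  compact sets. The second is the first, with its arguments swapped, after replacing
  \<open>h\<close> by \<open>g + h\<close>.\<close>

lemma compact_support_convolution_kernel:
  fixes \<phi> \<psi> :: "'g \<Rightarrow> real"
  assumes "compact_support \<phi>" "compact_support \<psi>"
  shows "compact_support (\<lambda>(h, g). \<phi> h * \<psi> (- h + g))"
    and "compact_support (\<lambda>(g, h). \<phi> (g + h) * \<psi> (- h))"
proof -
  obtain C D where C: "compact C" "\<And>x. x \<notin> C \<Longrightarrow> \<phi> x = 0" and D: "compact D" "\<And>x. x \<notin> D \<Longrightarrow> \<psi> x = 0"
    using assms unfolding compact_support_def by blast
  have cont: "continuous_on UNIV \<phi>" "continuous_on UNIV \<psi>" using assms unfolding compact_support_def by auto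
  have comp: "continuous_on UNIV (\<lambda>z::'g \<times> 'g. \<phi> (p z))" "continuous_on UNIV (\<lambda>z::'g \<times> 'g. \<psi> (p z))"
    if "continuous_on UNIV p" for p
    using that cont by (auto intro: continuous_on_compose2)
  have CD: "compact (C \<times> D)" using C(1) D(1) by (rule compact_Times)
  show "compact_support (\<lambda>(h, g). \<phi> h * \<psi> (- h + g))"
  proof (rule compact_supportI)
    show "continuous_on UNIV (\<lambda>(h, g). \<phi> h * \<psi> (- h + g))"
      unfolding case_prod_beta by (intro continuous_on_mult comp continuous_intros)
    show "compact ((\<lambda>(h, x). (h, h + x)) ` (C \<times> D))"
      unfolding case_prod_beta by (intro compact_continuous_image CD continuous_intros)
    fix z :: "'g \<times> 'g" assume z: "z \<notin> (\<lambda>(h, x). (h, h + x)) ` (C \<times> D)"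
    obtain h g where hg: "z = (h, g)" by (cases z)
    have "h \<notin> C \<or> - h + g \<notin> D"
    proof (rule ccontr)
      assume "\<not> ?thesis"
      then have "(\<lambda>(h, x). (h, h + x)) (h, - h + g) \<in> (\<lambda>(h, x). (h, h + x)) ` (C \<times> D)"
        by (intro imageI) simp
      then show False using z by (simp add: hg add.assoc[symmetric])
    qed
    then show "(case z of (h, g) \<Rightarrow> \<phi> h * \<psi> (- h + g)) = 0" using C(2) D(2) by (auto simp: hg)
  qed
  show "compact_support (\<lambda>(g, h). \<phi> (g + h) * \<psi> (- h))"
  proof (rule compact_supportI)
    show "continuous_on UNIV (\<lambda>(g, h). \<phi> (g + h) * \<psi> (- h))"
      unfolding case_prod_beta by (intro continuous_on_mult comp continuous_intros)
    show "compact ((\<lambda>(c, d). (c + d, - d)) ` (C \<times> D))"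
      unfolding case_prod_beta by (intro compact_continuous_image CD continuous_intros)
    fix z :: "'g \<times> 'g" assume z: "z \<notin> (\<lambda>(c, d). (c + d, - d)) ` (C \<times> D)"
    obtain g h where gh: "z = (g, h)" by (cases z)
    have "g + h \<notin> C \<or> - h \<notin> D"
    proof (rule ccontr)
      assume "\<not> ?thesis"
      then have "(\<lambda>(c, d). (c + d, - d)) (g + h, - h) \<in> (\<lambda>(c, d). (c + d, - d)) ` (C \<times> D)"
        by (intro imageI) simp
      then show False using z by (simp add: gh add.assoc)
    qed
    then show "(case z of (g, h) \<Rightarrow> \<phi> (g + h) * \<psi> (- h)) = 0" using C(2) D(2) by (auto simp: gh)
  qed
qed

text \<open>Up to a constant, inversion maps the measure of density \<open>h \<mapsto> \<integral> \<phi> (g + h) dg\<close> to Haar measure;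
  this positive density takes the place of the modular function.\<close>

lemma nn_integral_reflection:
  assumes "compact_support \<phi>" "compact_support \<psi>" "\<And>x. 0 \<le> \<phi> x" "\<And>x. 0 \<le> \<psi> x"
  shows "(\<integral>\<^sup>+h. ennreal (\<psi> (- h)) * (\<integral>\<^sup>+g. ennreal (\<phi> (g + h)) \<partial>\<mu>) \<partial>\<mu>) =
    (\<integral>\<^sup>+x. ennreal (\<phi> x) \<partial>\<mu>) * (\<integral>\<^sup>+x. ennreal (\<psi> x) \<partial>\<mu>)"
    and "(\<lambda>h. ennreal (\<psi> (- h)) * (\<integral>\<^sup>+g. ennreal (\<phi> (g + h)) \<partial>\<mu>)) \<in> borel_measurable \<mu>"
proof -
  have [measurable]: "\<phi> \<in> borel_measurable borel" "\<psi> \<in> borel_measurable borel"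
    using assms compact_support_borel by auto
  have [measurable]: "(\<lambda>(h, g). ennreal (\<phi> h * \<psi> (- h + g))) \<in> borel_measurable (\<mu> \<Otimes>\<^sub>M \<mu>)"
    "(\<lambda>(g, h). ennreal (\<phi> (g + h) * \<psi> (- h))) \<in> borel_measurable (\<mu> \<Otimes>\<^sub>M \<mu>)"
  proof -
    have eq: "borel_measurable (\<mu> \<Otimes>\<^sub>M \<mu>) = borel_measurable (borel \<Otimes>\<^sub>M (borel :: 'g measure))"
      by (intro measurable_cong_sets sets_pair_measure_cong) auto
    show "(\<lambda>(h, g). ennreal (\<phi> h * \<psi> (- h + g))) \<in> borel_measurable (\<mu> \<Otimes>\<^sub>M \<mu>)"
    "(\<lambda>(g, h). ennreal (\<phi> (g + h) * \<psi> (- h))) \<in> borel_measurable (\<mu> \<Otimes>\<^sub>M \<mu>)"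
      using compact_support_convolution_kernel[OF assms(1,2), THEN compact_support_borel_product]
      unfolding eq case_prod_beta by (auto intro: measurable_compose[OF _ measurable_ennreal])
  qed
  have "(\<integral>\<^sup>+x. ennreal (\<phi> x) \<partial>\<mu>) * (\<integral>\<^sup>+x. ennreal (\<psi> x) \<partial>\<mu>) =
      (\<integral>\<^sup>+h. ennreal (\<phi> h) * (\<integral>\<^sup>+g. ennreal (\<psi> (- h + g)) \<partial>\<mu>) \<partial>\<mu>)"
    by (simp add: nn_integral_left_translation[of "\<lambda>x. ennreal (\<psi> x)"] nn_integral_multc)
  also have "\<dots> = (\<integral>\<^sup>+h. (\<integral>\<^sup>+g. ennreal (\<phi> h * \<psi> (- h + g)) \<partial>\<mu>) \<partial>\<mu>)"
    using assms(3,4) by (intro nn_integral_cong, subst nn_integral_cmult[symmetric]) (auto simp: ennreal_mult)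
  also have "\<dots> = (\<integral>\<^sup>+g. (\<integral>\<^sup>+h. ennreal (\<phi> h * \<psi> (- h + g)) \<partial>\<mu>) \<partial>\<mu>)"
    by (rule pair.Fubini'[symmetric]) measurable
  \<comment> \<open>Left invariance in \<open>h\<close> for fixed \<open>g\<close> turns
    \<open>\<psi> (- h + g)\<close> into \<open>\<psi> (- h)\<close>; this is how the inversion
    appears.\<close>
  also have "\<dots> = (\<integral>\<^sup>+g. (\<integral>\<^sup>+h. ennreal (\<phi> (g + h) * \<psi> (- h)) \<partial>\<mu>) \<partial>\<mu>)"
  proof (rule nn_integral_cong)
    fix g
    have "(\<integral>\<^sup>+h. ennreal (\<phi> h * \<psi> (- h + g)) \<partial>\<mu>) =
      (\<integral>\<^sup>+h. ennreal (\<phi> (g + h) * \<psi> (- (g + h) + g)) \<partial>\<mu>)"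
      by (rule nn_integral_left_translation[symmetric]) measurable
    also have "\<dots> = (\<integral>\<^sup>+h. ennreal (\<phi> (g + h) * \<psi> (- h)) \<partial>\<mu>)"
      by (simp add: minus_add add.assoc)
    finally show "(\<integral>\<^sup>+h. ennreal (\<phi> h * \<psi> (- h + g)) \<partial>\<mu>) = (\<integral>\<^sup>+h. ennreal (\<phi> (g + h) * \<psi> (- h)) \<partial>\<mu>)" .
  qed
  also have "\<dots> = (\<integral>\<^sup>+h. (\<integral>\<^sup>+g. ennreal (\<phi> (g + h) * \<psi> (- h)) \<partial>\<mu>) \<partial>\<mu>)"
    by (rule pair.Fubini'[symmetric]) measurable
  also have "\<dots> = (\<integral>\<^sup>+h. ennreal (\<psi> (- h)) * (\<integral>\<^sup>+g. ennreal (\<phi> (g + h)) \<partial>\<mu>) \<partial>\<mu>)"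
    using assms(3,4) by (intro nn_integral_cong, subst nn_integral_cmult[symmetric]) (auto simp: ennreal_mult mult.commute)
  finally show "(\<integral>\<^sup>+h. ennreal (\<psi> (- h)) * (\<integral>\<^sup>+g. ennreal (\<phi> (g + h)) \<partial>\<mu>) \<partial>\<mu>) =
    (\<integral>\<^sup>+x. ennreal (\<phi> x) \<partial>\<mu>) * (\<integral>\<^sup>+x. ennreal (\<psi> x) \<partial>\<mu>)" by simp
  have "(\<lambda>h. \<integral>\<^sup>+g. ennreal (\<phi> (g + h) * \<psi> (- h)) \<partial>\<mu>) \<in> borel_measurable \<mu>" by measurable
  moreover have "(\<integral>\<^sup>+g. ennreal (\<phi> (g + h) * \<psi> (- h)) \<partial>\<mu>) = ennreal (\<psi> (- h)) * (\<integral>\<^sup>+g. ennreal (\<phi> (g + h)) \<partial>\<mu>)" for h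
    using assms(3,4) by (subst nn_integral_cmult[symmetric]) (auto simp: ennreal_mult mult.commute)
  ultimately show "(\<lambda>h. ennreal (\<psi> (- h)) * (\<integral>\<^sup>+g. ennreal (\<phi> (g + h)) \<partial>\<mu>)) \<in> borel_measurable \<mu>"
    by simp
qed

lemma compact_reflection_null:
  assumes K: "compact K" and null: "uminus ` K \<in> null_sets \<mu>"
  shows "K \<in> null_sets \<mu>"
proof -
  have mK: "compact (uminus ` K)" using K by (intro compact_continuous_image continuous_intros)
  have KB: "K \<in> sets \<mu>" using borel_compact'[OF K] by simp
  have "\<exists>\<phi>. compact_support \<phi> \<and> (\<forall>x. 0 \<le> \<phi> x) \<and> \<phi> (0::'g) = 1"
    by (rule urysohn_compact_open[of "{0::'g}" UNIV]) auto
  then obtain \<phi> where \<phi>: "compact_support \<phi>" "\<And>x. 0 \<le> \<phi> x" "\<phi> (0::'g) = 1" by blast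
  define D where "D = (\<lambda>h. \<integral>\<^sup>+g. ennreal (\<phi> (g + h)) \<partial>\<mu>)"
  have \<phi>_meas [measurable]: "\<phi> \<in> borel_measurable borel" using compact_support_borel[OF \<phi>(1)] .
  have Dpos: "D h \<noteq> 0" for h
  proof
    assume "D h = 0"
    then have "AE g in \<mu>. ennreal (\<phi> (g + h)) = 0"
      unfolding D_def by (subst (asm) nn_integral_0_iff_AE) measurable
    then have "AE g in \<mu>. \<not> 0 < \<phi> (g + h)" by eventually_elim (auto simp: ennreal_eq_0_iff)
    moreover have op: "open {g. 0 < \<phi> (g + h)}"
    proof -
      have "continuous_on UNIV (\<lambda>g. \<phi> (g + h))"
        using \<phi>(1) by (intro continuous_on_compose2[of UNIV \<phi> UNIV "\<lambda>g. g + h"] continuous_intros)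
          (auto simp: compact_support_def)
      then show ?thesis by (intro open_Collect_less continuous_on_const)
    qed
    ultimately have "emeasure \<mu> {g. 0 < \<phi> (g + h)} = 0"
      by (subst (asm) AE_iff_measurable[of "{g. 0 < \<phi> (g + h)}"]) auto
    moreover have "- h \<in> {g. 0 < \<phi> (g + h)}" using \<phi>(3) by simp
    then have "{g. 0 < \<phi> (g + h)} \<noteq> {}" by blast
    ultimately show False using emeasure_open_pos[OF op] by simp
  qed
  define c where "c = (\<integral>\<^sup>+x. ennreal (\<phi> x) \<partial>\<mu>)"
  have c: "c < \<infinity>"
    using compact_support_integrable[OF \<phi>(1)] \<phi>(2) unfolding c_def by (simp add: nn_integral_eq_integral)
  have cover: "\<exists>\<psi>. compact_support \<psi> \<and> (\<forall>x. 0 \<le> \<psi> x) \<and> (\<forall>x\<in>uminus ` K. \<psi> x = 1) \<and> (\<integral>\<^sup>+x. ennreal (\<psi> x) \<partial>\<mu>) \<le> ennreal e"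
    if "0 < e" for e
  proof -
    have "uminus ` K \<in> sets borel" "emeasure \<mu> (uminus ` K) < \<infinity>"
      using borel_compact'[OF mK] null by auto
    note reg = regular_approximation[OF this \<open>0 < e\<close>]
    have "\<exists>C U. compact C \<and> open U \<and> C \<subseteq> uminus ` K \<and> uminus ` K \<subseteq> U \<and> emeasure \<mu> (U - C) < ennreal e"
      by (rule reg) blast
    then obtain C U where U: "open U" "uminus ` K \<subseteq> U" "C \<subseteq> uminus ` K" "emeasure \<mu> (U - C) < ennreal e" "compact C"
      by auto
    have "emeasure \<mu> C = 0" using U(3) null by (metis emeasure_mono le_zero_eq null_setsD1 null_setsD2)
    then have "emeasure \<mu> (U - C) = emeasure \<mu> U"
      using U(1) borel_compact'[OF U(5)] by (intro emeasure_Diff_null_set) (auto simp: null_sets_def)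
    then have Ue: "emeasure \<mu> U \<le> ennreal e" using U(4) by simp
    obtain \<psi> where \<psi>: "compact_support \<psi>" "\<And>x. 0 \<le> \<psi> x" "\<And>x. \<psi> x \<le> 1" "\<And>x. x \<in> uminus ` K \<Longrightarrow> \<psi> x = 1"
      "\<And>x. x \<notin> U \<Longrightarrow> \<psi> x = 0"
      using urysohn_compact_open[OF mK U(1,2)] by metis
    have "(\<integral>\<^sup>+x. ennreal (\<psi> x) \<partial>\<mu>) \<le> (\<integral>\<^sup>+x. indicator U x \<partial>\<mu>)"
      using \<psi>(3,5) by (intro nn_integral_mono) (auto simp: indicator_def)
    also have "\<dots> \<le> ennreal e" using U(1) Ue by simp
    finally show ?thesis using \<psi> by auto
  qed
  have bound: "(\<integral>\<^sup>+h. indicator K h * D h \<partial>\<mu>) \<le> c * ennreal e" if "0 < e" for e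
  proof -
    obtain \<psi> where \<psi>: "compact_support \<psi>" "\<And>x. 0 \<le> \<psi> x" "\<And>x. x \<in> uminus ` K \<Longrightarrow> \<psi> x = 1"
      "(\<integral>\<^sup>+x. ennreal (\<psi> x) \<partial>\<mu>) \<le> ennreal e"
      using cover[OF \<open>0 < e\<close>] by auto
    have "(\<integral>\<^sup>+h. indicator K h * D h \<partial>\<mu>) \<le> (\<integral>\<^sup>+h. ennreal (\<psi> (- h)) * D h \<partial>\<mu>)"
      using \<psi>(3) by (intro nn_integral_mono) (auto simp: indicator_def)
    also have "\<dots> = c * (\<integral>\<^sup>+x. ennreal (\<psi> x) \<partial>\<mu>)"
      unfolding D_def c_def by (rule nn_integral_reflection(1)[OF \<phi>(1) \<psi>(1) \<phi>(2) \<psi>(2)])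
    also have "\<dots> \<le> c * ennreal e" using \<psi>(4) by (rule mult_left_mono) simp
    finally show ?thesis .
  qed
  have int0: "(\<integral>\<^sup>+h. indicator K h * D h \<partial>\<mu>) = 0"
  proof (rule ccontr)
    assume ne: "(\<integral>\<^sup>+h. indicator K h * D h \<partial>\<mu>) \<noteq> 0"
    \<comment> \<open>The finite constant \<open>c\<close> is absorbed by applying the bound with
      \<open>e / (r + 1)\<close>.\<close>
    obtain r where r: "c = ennreal r" "0 \<le> r" using c by (cases c) auto
    have "(\<integral>\<^sup>+h. indicator K h * D h \<partial>\<mu>) \<le> ennreal e" if "0 < e" for e
    proof -
      have "r / (r + 1) \<le> 1" using r(2) by simp
      then have "e * (r / (r + 1)) \<le> e * 1" using that by (intro mult_left_mono) auto
      then have "r * (e / (r + 1)) \<le> e" by (simp add: mult.commute)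
      moreover have "c * ennreal (e / (r + 1)) = ennreal (r * (e / (r + 1)))"
        unfolding r(1) using r(2) that by (intro ennreal_mult[symmetric]) auto
      ultimately have "c * ennreal (e / (r + 1)) \<le> ennreal e" by (simp only: ennreal_leI)
      moreover have "0 < e / (r + 1)" using r(2) that by simp
      note bound[OF this]
      ultimately show ?thesis by (rule order_trans[rotated])
    qed
    then have "(\<integral>\<^sup>+h. indicator K h * D h \<partial>\<mu>) \<le> 0"
      by - (rule ennreal_le_epsilon, simp)
    then show False using ne by simp
  qed
  obtain \<psi> where \<psi>: "compact_support \<psi>" "\<And>x. 0 \<le> \<psi> x" "\<And>x. x \<in> uminus ` K \<Longrightarrow> \<psi> x = 1"
    using cover[of 1] by auto
  have "(\<lambda>h. indicator K h * (ennreal (\<psi> (- h)) * D h)) \<in> borel_measurable \<mu>"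
    unfolding D_def
    by (rule borel_measurable_times_ennreal[OF borel_measurable_indicator[OF KB]
          nn_integral_reflection(2)[OF \<phi>(1) \<psi>(1) \<phi>(2) \<psi>(2)]])
  moreover have "indicator K h * (ennreal (\<psi> (- h)) * D h) = indicator K h * D h" for h
    using \<psi>(3) by (auto simp: indicator_def)
  ultimately have "(\<lambda>h. indicator K h * D h) \<in> borel_measurable \<mu>" by simp
  from nn_integral_0_iff_AE[OF this] int0 have "AE h in \<mu>. indicator K h * D h = 0" by simp
  then have "AE h in \<mu>. h \<notin> K" by eventually_elim (use Dpos in \<open>auto simp: indicator_def split: if_splits\<close>)
  then show ?thesis using KB by (simp add: AE_iff_null_sets)
qed

text \<open>Reduction to compact sets: if the preimage of a null set had positive measure, a part of
  finite positive measure would contain, by regularity, a compact set that is not null but whose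
  reflection lies in the null set.\<close>

lemma AE_uminus:
  assumes "AE x in \<mu>. P x"
  shows "AE x in \<mu>. P (- x)"
proof -
  obtain N where N: "N \<in> null_sets \<mu>" "{x. \<not> P x} \<subseteq> N" using assms unfolding eventually_ae_filter by auto
  define M where "M = (uminus :: 'g \<Rightarrow> 'g) -` N"
  have M: "M \<in> sets borel" using measurable_sets[OF measurable_uminus_group, of N] N(1) by (auto simp: M_def)
  have "emeasure \<mu> M = 0"
  proof (rule ccontr)
    assume "emeasure \<mu> M \<noteq> 0"
    have "\<exists>A :: nat \<Rightarrow> 'g set. range A \<subseteq> sets \<mu> \<and> (\<Union>i. A i) = space \<mu> \<and> (\<forall>i. emeasure \<mu> (A i) \<noteq> \<infinity>)"
      by (rule sigma_finite) blast
    then obtain A :: "nat \<Rightarrow> 'g set" where A: "range A \<subseteq> sets \<mu>" "(\<Union>i. A i) = space \<mu>" "\<And>i. emeasure \<mu> (A i) \<noteq> \<infinity>"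
      by blast
    have "\<exists>i. emeasure \<mu> (M \<inter> A i) \<noteq> 0"
    proof (rule ccontr)
      assume "\<not> ?thesis"
      then have "(\<Union>i. M \<inter> A i) \<in> null_sets \<mu>" using A(1) M by (intro null_sets_UN) (auto simp: null_sets_def)
      moreover have "(\<Union>i. M \<inter> A i) = M" using A(2) by auto
      ultimately show False using \<open>emeasure \<mu> M \<noteq> 0\<close> by auto
    qed
    then obtain i where i: "emeasure \<mu> (M \<inter> A i) \<noteq> 0" by blast
    define E where "E = M \<inter> A i"
    have "emeasure \<mu> E \<le> emeasure \<mu> (A i)" unfolding E_def using A M by (intro emeasure_mono) auto
    then have E: "E \<in> sets borel" "emeasure \<mu> E < \<infinity>" using A M
      by (auto simp: E_def less_top[symmetric]) (metis top.extremum_uniqueI)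
    have "0 < emeasure \<mu> E" using i by (simp add: E_def zero_less_iff_neq_zero)
    moreover obtain t where t: "emeasure \<mu> E = ennreal t" "0 \<le> t" using E(2) by (cases "emeasure \<mu> E") auto
    ultimately have "0 < t / 2" "ennreal (t / 2) < emeasure \<mu> E" by (auto intro!: ennreal_lessI)
    then obtain r where r: "0 < r" "ennreal r < emeasure \<mu> E" by blast
    obtain K U where KU: "compact K" "open U" "K \<subseteq> E" "E \<subseteq> U" "emeasure \<mu> (U - K) < ennreal r"
      using regular_approximation[OF E r(1)] by blast
    have "uminus ` K \<subseteq> N" using KU(3) by (auto simp: E_def M_def)
    moreover have "compact (uminus ` K)" using KU(1) by (intro compact_continuous_image continuous_intros)
    ultimately have "uminus ` K \<in> null_sets \<mu>" using N(1) borel_compact' by (metis null_sets_subset sets_mu)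
    then have K0: "K \<in> null_sets \<mu>" by (rule compact_reflection_null[OF KU(1)])
    have "emeasure \<mu> E \<le> emeasure \<mu> ((U - K) \<union> K)" using KU borel_compact' by (intro emeasure_mono) auto
    also have "\<dots> = emeasure \<mu> (U - K)" using K0 KU borel_compact' by (intro emeasure_Un_null_set) auto
    finally show False using KU(5) r(2) by (metis less_le_trans not_less_iff_gr_or_eq order_less_trans)
  qed
  then have "M \<in> null_sets \<mu>" using M by (auto simp: null_sets_def)
  then show ?thesis by (rule AE_I') (use N(2) in \<open>auto simp: M_def\<close>)
qed

text \<open>For every fixed \<open>g\<close>, altering \<open>b\<close> on a null set alters the
  convolution integrand only at almost no \<open>h\<close>. The substitution is
  \<open>- (- g + h) = - h + g\<close>.\<close>

lemma AE_reflected_translation: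
  assumes "AE x in \<mu>. P x"
  shows "AE h in \<mu>. P (- h + g)"
  using AE_left_translation[OF AE_uminus[OF assms], of "- g"] by (simp add: minus_add)

text \<open>Fubini is applied to the measurable \<open>F\<close>, never to the kernel itself. The
  two are compared section by section: for every \<open>g\<close> they agree at almost all
  \<open>h\<close>, and for almost every \<open>h\<close> at almost all \<open>g\<close>. This is
  enough to transfer the iterated integrals.\<close>

lemma convolution_exists:
  fixes a b :: "'g \<Rightarrow> real"
  assumes a: "integrable \<mu> a" and b: "integrable \<mu> b"
  shows "AE g in \<mu>. integrable \<mu> (\<lambda>h. a h * b (- h + g))"
    and "integrable \<mu> (\<lambda>g. LINT h|\<mu>. a h * b (- h + g))"
    and "(LINT g|\<mu>. \<bar>LINT h|\<mu>. a h * b (- h + g)\<bar>) \<le> (LINT h|\<mu>. \<bar>a h\<bar>) * (LINT h|\<mu>. \<bar>b h\<bar>)"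
proof -
  have [measurable]: "a \<in> borel_measurable borel" "b \<in> borel_measurable borel"
    using borel_measurable_integrable[OF a] borel_measurable_integrable[OF b] by auto
  obtain a' where a': "\<And>k. compact_support (a' k)" "AE x in \<mu>. (\<lambda>k. a' k x) \<longlonglongrightarrow> a x"
    using compact_support_AE_limit[OF a] by blast
  obtain b' where b': "\<And>k. compact_support (b' k)" "AE x in \<mu>. (\<lambda>k. b' k x) \<longlonglongrightarrow> b x"
    using compact_support_AE_limit[OF b] by blast
  \<comment> \<open>Where the approximations diverge the value of \<open>lim\<close> is unspecified,
    yet the function stays measurable for the product sigma-algebra.\<close>
  define F where "F = (\<lambda>(h, g). lim (\<lambda>k. a' k h * b' k (- h + g)))"
  have F [measurable]: "F \<in> borel_measurable (\<mu> \<Otimes>\<^sub>M \<mu>)"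
  proof -
    have eq: "borel_measurable (\<mu> \<Otimes>\<^sub>M \<mu>) = borel_measurable (borel \<Otimes>\<^sub>M (borel :: 'g measure))"
      by (intro measurable_cong_sets sets_pair_measure_cong) auto
    show ?thesis
      unfolding F_def eq case_prod_beta
      by (intro borel_measurable_lim_metric
          compact_support_borel_product[OF compact_support_convolution_kernel(1), OF a'(1) b'(1), unfolded case_prod_beta])
  qed
  have Fg: "AE h in \<mu>. F (h, g) = a h * b (- h + g)" for g
    using a'(2) AE_reflected_translation[OF b'(2), of g]
    by eventually_elim (auto simp: F_def intro!: limI tendsto_mult)
  have Fh: "AE h in \<mu>. AE g in \<mu>. F (h, g) = a h * b (- h + g)"
    using a'(2)
  proof eventually_elim
    case (elim h)
    then show ?case using AE_left_translation[OF b'(2), of "- h"]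
      by (auto elim!: eventually_mono simp: F_def intro!: limI tendsto_mult)
  qed
  have b_trans: "integrable \<mu> (\<lambda>g. b (- h + g))" "(LINT g|\<mu>. \<bar>b (- h + g)\<bar>) = (LINT g|\<mu>. \<bar>b g\<bar>)" for h
  proof -
    have 1: "integrable (distr \<mu> borel (\<lambda>g. - h + g)) b" using b by (simp add: distr_left_translation)
    show "integrable \<mu> (\<lambda>g. b (- h + g))" by (rule integrable_distr[OF _ 1]) measurable
    have "(LINT g|distr \<mu> borel (\<lambda>g. - h + g). \<bar>b g\<bar>) = (LINT g|\<mu>. \<bar>b (- h + g)\<bar>)"
      by (rule integral_distr) measurable
    then show "(LINT g|\<mu>. \<bar>b (- h + g)\<bar>) = (LINT g|\<mu>. \<bar>b g\<bar>)" by (simp add: distr_left_translation)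
  qed
  have norm_F: "AE h in \<mu>. integrable \<mu> (\<lambda>g. F (h, g)) \<and>
      (LINT g|\<mu>. norm (F (h, g))) = \<bar>a h\<bar> * (LINT g|\<mu>. \<bar>b g\<bar>)"
    using Fh
  proof eventually_elim
    case (elim h)
    have "integrable \<mu> (\<lambda>g. F (h, g)) \<longleftrightarrow> integrable \<mu> (\<lambda>g. a h * b (- h + g))"
      by (rule integrable_cong_AE) (use elim in measurable)
    moreover have "(LINT g|\<mu>. norm (F (h, g))) = (LINT g|\<mu>. \<bar>a h\<bar> * \<bar>b (- h + g)\<bar>)"
      by (rule integral_cong_AE) (use elim in \<open>auto simp: abs_mult elim!: eventually_mono\<close>)
    ultimately show ?case using b_trans[of h] by simp
  qed
  have int_F1: "integrable \<mu> (\<lambda>h. LINT g|\<mu>. norm (F (h, g)))"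
  proof (rule integrable_cong_AE_imp)
    show "integrable \<mu> (\<lambda>h. \<bar>a h\<bar> * (LINT g|\<mu>. \<bar>b g\<bar>))" using a by simp
    show "AE h in \<mu>. \<bar>a h\<bar> * (LINT g|\<mu>. \<bar>b g\<bar>) = (LINT g|\<mu>. norm (F (h, g)))"
      using norm_F by eventually_elim simp
  qed measurable
  have int_F: "integrable (\<mu> \<Otimes>\<^sub>M \<mu>) F"
    by (rule pair.Fubini_integrable[OF F int_F1]) (use norm_F in \<open>auto elim!: eventually_mono\<close>)
  have F_curry: "F = (\<lambda>(h, g). F (h, g))" by auto
  have int_F': "integrable (\<mu> \<Otimes>\<^sub>M \<mu>) (\<lambda>(h, g). F (h, g))"
    using int_F F_curry by metis
  have eq: "integrable \<mu> (\<lambda>h. F (h, g)) \<longleftrightarrow> integrable \<mu> (\<lambda>h. a h * b (- h + g))"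
    "(LINT h|\<mu>. F (h, g)) = (LINT h|\<mu>. a h * b (- h + g))" for g
    by ((rule integrable_cong_AE integral_cong_AE), measurable, rule Fg)+
  show "AE g in \<mu>. integrable \<mu> (\<lambda>h. a h * b (- h + g))"
    using pair.AE_integrable_snd[OF int_F'] unfolding eq .
  show "integrable \<mu> (\<lambda>g. LINT h|\<mu>. a h * b (- h + g))"
    using pair.integrable_snd[OF int_F'] unfolding eq .
  then have int2: "integrable \<mu> (\<lambda>g. LINT h|\<mu>. F (h, g))" unfolding eq .
  have int_nF: "integrable (\<mu> \<Otimes>\<^sub>M \<mu>) (\<lambda>(h, g). norm (F (h, g)))"
  proof -
    have "(\<lambda>(h, g). norm (F (h, g))) = (\<lambda>z. norm (F z))" by auto
    then show ?thesis using integrable_norm[OF int_F] by simp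
  qed
  have "(LINT g|\<mu>. \<bar>LINT h|\<mu>. a h * b (- h + g)\<bar>) = (LINT g|\<mu>. \<bar>LINT h|\<mu>. F (h, g)\<bar>)" unfolding eq ..
  also have "\<dots> \<le> (LINT g|\<mu>. LINT h|\<mu>. norm (F (h, g)))"
  proof (rule integral_mono)
    show "integrable \<mu> (\<lambda>g. LINT h|\<mu>. norm (F (h, g)))" using pair.integrable_snd[OF int_nF] .
    show "\<bar>LINT h|\<mu>. F (h, g)\<bar> \<le> (LINT h|\<mu>. norm (F (h, g)))" for g
      using integral_norm_bound[of \<mu> "\<lambda>h. F (h, g)"] by simp
  qed (use int2 in simp)
  also have "\<dots> = (LINT h|\<mu>. LINT g|\<mu>. norm (F (h, g)))" by (rule pair.Fubini_integral[OF int_nF])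
  also have "\<dots> = (LINT h|\<mu>. \<bar>a h\<bar> * (LINT g|\<mu>. \<bar>b g\<bar>))"
    by (rule integral_cong_AE) (use norm_F in \<open>auto elim!: eventually_mono\<close>)
  also have "\<dots> = (LINT h|\<mu>. \<bar>a h\<bar>) * (LINT h|\<mu>. \<bar>b h\<bar>)" by simp
  finally show "(LINT g|\<mu>. \<bar>LINT h|\<mu>. a h * b (- h + g)\<bar>) \<le> (LINT h|\<mu>. \<bar>a h\<bar>) * (LINT h|\<mu>. \<bar>b h\<bar>)" .
qed

end

section \<open>The convolution algebra and its module actions\<close>

lemma borel_measurable_completion_AE:
  assumes f: "f \<in> M \<rightarrow>\<^sub>M N" and ae: "AE x in M. g x = f x" and N: "space N = UNIV"
  shows "g \<in> completion M \<rightarrow>\<^sub>M N"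
proof (rule measurableI)
  obtain Z where Z: "Z \<in> null_sets M" "{x\<in>space M. g x \<noteq> f x} \<subseteq> Z" using ae unfolding eventually_ae_filter by auto
  fix S assume S: "S \<in> sets N"
  show "g -` S \<inter> space (completion M) \<in> sets (completion M)"
  proof (rule sets_completionI[where S="(f -` S \<inter> space M) - Z" and N="g -` S \<inter> space M \<inter> Z" and N'=Z])
    show "g -` S \<inter> space (completion M) = f -` S \<inter> space M - Z \<union> g -` S \<inter> space M \<inter> Z" using Z(2) by auto
    show "f -` S \<inter> space M - Z \<in> sets M" using measurable_sets[OF f S] Z(1) by auto
  qed (use Z in auto)
qed (simp add: N)

text \<open>A covering set of the completion is replaced by its main part together with a null set
  of \<open>M\<close> containing the rest; this is measurable for \<open>M\<close> and has the same
  measure.\<close>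

lemma sigma_finite_completion_imp:
  assumes "sigma_finite_measure (completion M)"
  shows "sigma_finite_measure M"
proof -
  interpret sigma_finite_measure "completion M" by (rule assms)
  have "\<exists>A :: nat \<Rightarrow> _. range A \<subseteq> sets (completion M) \<and> (\<Union>i. A i) = space (completion M) \<and>
      (\<forall>i. emeasure (completion M) (A i) \<noteq> \<infinity>)"
    by (rule sigma_finite) blast
  then obtain A :: "nat \<Rightarrow> _" where A: "\<And>i. A i \<in> sets (completion M)" "(\<Union>i. A i) = space M"
    "\<And>i. emeasure (completion M) (A i) \<noteq> \<infinity>" by (metis rangeI space_completion subsetD)
  have "\<forall>i. \<exists>N. N \<in> null_sets M \<and> null_part M (A i) \<subseteq> N" using null_part[OF A(1)] by blast
  then obtain N where N: "\<forall>i. N i \<in> null_sets M \<and> null_part M (A i) \<subseteq> N i" by (rule choice[THEN exE])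
  define B where "B = (\<lambda>i. main_part M (A i) \<union> N i)"
  have B: "B i \<in> sets M" "A i \<subseteq> B i" for i
    using A(1) N main_part_null_part_Un[OF A(1)[of i]] by (auto simp: B_def simp del: main_part_null_part_Un)
  have "emeasure M (B i) = emeasure M (main_part M (A i))" for i
    using A(1) N unfolding B_def by (intro emeasure_Un_null_set) auto
  then have "emeasure M (B i) \<noteq> \<infinity>" for i using A(1,3)[of i] by simp
  moreover have "\<Union>(range B) = space M"
  proof
    show "\<Union>(range B) \<subseteq> space M" using sets.sets_into_space[OF B(1)] by (intro UN_least)
    show "space M \<subseteq> \<Union>(range B)" unfolding A(2)[symmetric] using B(2) by (intro UN_mono) auto
  qed
  ultimately show ?thesis using B(1)
    by (intro sigma_finite_measure.intro exI[of _ "range B"]) auto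
qed

lemma haar_completion_of_left_haar:
  "\<exists>\<mu> :: 'g::haar_group measure. sigma_finite_left_haar \<mu> \<and> haar = completion \<mu>"
proof -
  obtain \<mu> :: "'g measure" where \<mu>: "left_haar_measure \<mu> \<and> haar = completion \<mu>"
    by (rule haar_completion[THEN exE])
  then have "sigma_finite_measure (completion \<mu>)" using haar_sigma_finite[where 'a='g] by metis
  then have "sigma_finite_measure \<mu>" by (rule sigma_finite_completion_imp)
  then show ?thesis using \<mu> by (auto intro!: sigma_finite_left_haar.intro)
qed

lemma space_haar [simp]: "space (haar :: 'g::haar_group measure) = UNIV"
proof -
  obtain \<mu> :: "'g measure" where "sigma_finite_left_haar \<mu>" "haar = completion \<mu>"
    using haar_completion_of_left_haar by blast
  then show ?thesis using sigma_finite_left_haar.space_mu by (metis space_completion)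
qed

interpretation haar: sigma_finite_measure "haar :: 'g::haar_group measure"
  by (rule haar_sigma_finite)

lemma emeasure_haar_UNIV: "emeasure (haar :: 'g::haar_group measure) UNIV \<noteq> 0"
proof -
  obtain \<mu> :: "'g measure" where \<mu>: "sigma_finite_left_haar \<mu>" "haar = completion \<mu>"
    using haar_completion_of_left_haar by blast
  interpret sigma_finite_left_haar \<mu> by (rule \<mu>(1))
  show ?thesis using emeasure_nonzero by (simp add: \<mu>(2))
qed

text \<open>With Borel versions \<open>a'\<close> and \<open>b'\<close>, the integrands agree for
  almost all \<open>h\<close> at every single \<open>g\<close>, again because inversion preserves
  null sets. The two convolutions are thus equal everywhere as functions of
  \<open>g\<close>.\<close>

lemma haar_convolution_exists:
  fixes a b :: "'g::haar_group \<Rightarrow> real"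
  assumes a: "integrable haar a" and b: "integrable haar b"
  shows "AE g in haar. integrable haar (\<lambda>h. a h * b (- h + g))"
    and "integrable haar (\<lambda>g. LINT h|haar. a h * b (- h + g))"
    and "(LINT g|haar. \<bar>LINT h|haar. a h * b (- h + g)\<bar>) \<le> (LINT h|haar. \<bar>a h\<bar>) * (LINT h|haar. \<bar>b h\<bar>)"
proof -
  obtain \<mu> :: "'g measure" where \<mu>: "sigma_finite_left_haar \<mu>" "haar = completion \<mu>"
    using haar_completion_of_left_haar by blast
  interpret sigma_finite_left_haar \<mu> by (rule \<mu>(1))
  note haar = \<mu>(2)
  obtain a' where a': "a' \<in> borel_measurable \<mu>" "AE x in \<mu>. a x = a' x"
    using completion_ex_borel_measurable_real[of a \<mu>] borel_measurable_integrable[OF a] unfolding haar by blast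
  obtain b' where b': "b' \<in> borel_measurable \<mu>" "AE x in \<mu>. b x = b' x"
    using completion_ex_borel_measurable_real[of b \<mu>] borel_measurable_integrable[OF b] unfolding haar by blast
  have [measurable]: "a' \<in> borel_measurable borel" "b' \<in> borel_measurable borel" using a' b' by auto
  have int: "integrable \<mu> a'" "integrable \<mu> b'"
  proof -
    have "integrable (completion \<mu>) a'"
      by (rule integrable_cong_AE_imp[OF a[unfolded haar]]) (use a' in \<open>auto intro: measurable_completion AE_completion\<close>)
    then show "integrable \<mu> a'" using a'(1) by (simp add: integrable_completion)
    have "integrable (completion \<mu>) b'"
      by (rule integrable_cong_AE_imp[OF b[unfolded haar]]) (use b' in \<open>auto intro: measurable_completion AE_completion\<close>)
    then show "integrable \<mu> b'" using b'(1) by (simp add: integrable_completion)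
  qed
  have norms: "(LINT h|haar. \<bar>a h\<bar>) = (LINT h|\<mu>. \<bar>a' h\<bar>)" "(LINT h|haar. \<bar>b h\<bar>) = (LINT h|\<mu>. \<bar>b' h\<bar>)"
  proof -
    have "(LINT h|haar. \<bar>a h\<bar>) = (LINT h|completion \<mu>. \<bar>a' h\<bar>)" unfolding haar
      by (rule integral_cong_AE) (use a[unfolded haar] a' in \<open>auto intro!: AE_completion measurable_completion elim!: eventually_mono\<close>)
    then show "(LINT h|haar. \<bar>a h\<bar>) = (LINT h|\<mu>. \<bar>a' h\<bar>)" by (subst (asm) integral_completion) auto
    have "(LINT h|haar. \<bar>b h\<bar>) = (LINT h|completion \<mu>. \<bar>b' h\<bar>)" unfolding haar
      by (rule integral_cong_AE) (use b[unfolded haar] b' in \<open>auto intro!: AE_completion measurable_completion elim!: eventually_mono\<close>)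
    then show "(LINT h|haar. \<bar>b h\<bar>) = (LINT h|\<mu>. \<bar>b' h\<bar>)" by (subst (asm) integral_completion) auto
  qed
  have AE_eq: "AE h in \<mu>. a h * b (- h + g) = a' h * b' (- h + g)" for g
    using a'(2) AE_reflected_translation[OF b'(2), of g] by eventually_elim simp
  have meas: "(\<lambda>h. a' h * b' (- h + g)) \<in> borel_measurable \<mu>" for g by measurable
  have meas_c: "(\<lambda>h. a h * b (- h + g)) \<in> borel_measurable (completion \<mu>)" for g
    by (rule borel_measurable_completion_AE[OF meas AE_eq]) simp
  have eq_int: "integrable haar (\<lambda>h. a h * b (- h + g)) \<longleftrightarrow> integrable \<mu> (\<lambda>h. a' h * b' (- h + g))" for g
    unfolding haar integrable_completion[OF meas, symmetric]
    by (rule integrable_cong_AE[OF meas_c measurable_completion[OF meas] AE_completion[OF AE_eq]])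
  have eq_LINT: "(LINT h|haar. a h * b (- h + g)) = (LINT h|\<mu>. a' h * b' (- h + g))" for g
    unfolding haar integral_completion[OF meas, symmetric]
    by (rule integral_cong_AE[OF meas_c measurable_completion[OF meas] AE_completion[OF AE_eq]])
  note conv = convolution_exists[OF int]
  show "AE g in haar. integrable haar (\<lambda>h. a h * b (- h + g))"
    unfolding eq_int unfolding haar by (rule AE_completion[OF conv(1)])
  have "integrable (completion \<mu>) (\<lambda>g. LINT h|\<mu>. a' h * b' (- h + g))"
    using conv(2) by (subst integrable_completion) (auto dest: borel_measurable_integrable)
  then show "integrable haar (\<lambda>g. LINT h|haar. a h * b (- h + g))"
    unfolding eq_LINT unfolding haar .
  have "(LINT g|completion \<mu>. \<bar>LINT h|\<mu>. a' h * b' (- h + g)\<bar>) = (LINT g|\<mu>. \<bar>LINT h|\<mu>. a' h * b' (- h + g)\<bar>)"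
    using conv(2) by (intro integral_completion) auto
  then show "(LINT g|haar. \<bar>LINT h|haar. a h * b (- h + g)\<bar>) \<le> (LINT h|haar. \<bar>a h\<bar>) * (LINT h|haar. \<bar>b h\<bar>)"
    unfolding eq_LINT norms unfolding haar using conv(3) by simp
qed

lemma AE_haar_reflected_translation:
  assumes "AE x in (haar :: 'g::haar_group measure). P x"
  shows "AE h in haar. P (- h + g)"
proof -
  obtain \<mu> :: "'g measure" where \<mu>: "sigma_finite_left_haar \<mu>" "haar = completion \<mu>"
    using haar_completion_of_left_haar by blast
  interpret sigma_finite_left_haar \<mu> by (rule \<mu>(1))
  show ?thesis using assms unfolding \<mu>(2) AE_completion_iff by (rule AE_reflected_translation)
qed

section \<open>Representatives of classes and bilinearity of convolution\<close>

lemma integrable_rep_L1 [simp, measurable]: "integrable haar (rep_L1 a)"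
  using Quotient3_rel_rep[OF Quotient3_L1, of a a] by simp

lemma borel_measurable_rep_L1 [measurable, simp]: "rep_L1 a \<in> borel_measurable haar"
  using integrable_rep_L1 by (rule borel_measurable_integrable)

lemma abs_L1_rep [simp]: "abs_L1 (rep_L1 a) = a"
  using Quotient3_abs_rep[OF Quotient3_L1] by blast

lemma rep_abs_L1: "integrable haar f \<Longrightarrow> AE x in haar. rep_L1 (abs_L1 f) x = f x"
  using Quotient3_rep_abs[OF Quotient3_L1, of f] by simp

lemma L1_eqI: "AE x in haar. rep_L1 a x = rep_L1 b x \<Longrightarrow> a = b"
  using Quotient3_rel_rep[OF Quotient3_L1, of a b] by simp

lemma rep_plus_L1: "AE x in haar. rep_L1 (a + b) x = rep_L1 a x + rep_L1 b x"
proof -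
  have "a + b = abs_L1 (\<lambda>x. rep_L1 a x + rep_L1 b x)"
    using plus_L1.abs_eq[of "rep_L1 a" "rep_L1 b"] by simp
  then show ?thesis by (simp add: rep_abs_L1)
qed

lemma rep_scaleR_L1: "AE x in haar. rep_L1 (r *\<^sub>R a) x = r * rep_L1 a x"
proof -
  have "r *\<^sub>R a = abs_L1 (\<lambda>x. r * rep_L1 a x)"
    using scaleR_L1.abs_eq[of "rep_L1 a" r] by simp
  then show ?thesis by (simp add: rep_abs_L1)
qed

lemma norm_L1_rep: "norm a = (LINT x|haar. \<bar>rep_L1 a x\<bar>)"
  using norm_L1.abs_eq[of "rep_L1 a"] by simp

lemma norm_abs_L1: "integrable haar f \<Longrightarrow> norm (abs_L1 f) = (LINT x|haar. \<bar>f x\<bar>)"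
  using norm_L1.abs_eq[of f] by simp

lemma rep_conv: "AE g in haar. rep_L1 (a \<star> b) g = (LINT h|haar. rep_L1 a h * rep_L1 b (- h + g))"
  unfolding conv_def by (rule rep_abs_L1) (simp add: haar_convolution_exists)

lemma norm_conv: "norm (a \<star> b) \<le> norm a * norm b"
  unfolding conv_def norm_L1_rep[of a] norm_L1_rep[of b]
  by (subst norm_abs_L1) (simp_all add: haar_convolution_exists)

lemma conv_add_left: "(a + b) \<star> c = a \<star> c + b \<star> (c :: 'g::haar_group L1)"
proof (rule L1_eqI)
  note ex = haar_convolution_exists(1)[OF integrable_rep_L1 integrable_rep_L1]
  have eq: "AE h in haar. rep_L1 (a + b) h * rep_L1 c (- h + g) = rep_L1 a h * rep_L1 c (- h + g) + rep_L1 b h * rep_L1 c (- h + g)"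
    for g using rep_plus_L1[of a b] by eventually_elim (simp add: algebra_simps)
  show "AE g in haar. rep_L1 ((a + b) \<star> c) g = rep_L1 (a \<star> c + b \<star> c) g"
    using rep_conv[of "a + b" c] rep_conv[of a c] rep_conv[of b c] rep_plus_L1[of "a \<star> c" "b \<star> c"]
      ex[of "a + b" c] ex[of a c] ex[of b c]
  proof eventually_elim
    case (elim g)
    have "(LINT h|haar. rep_L1 (a + b) h * rep_L1 c (- h + g)) =
      (LINT h|haar. rep_L1 a h * rep_L1 c (- h + g) + rep_L1 b h * rep_L1 c (- h + g))"
      by (rule integral_cong_AE[OF _ _ eq])
        (use elim in \<open>auto intro!: borel_measurable_add dest!: borel_measurable_integrable\<close>)
    then show ?case using elim by simp
  qed
qed

lemma conv_scaleR_left: "(r *\<^sub>R a) \<star> c = r *\<^sub>R (a \<star> (c :: 'g::haar_group L1))"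
proof (rule L1_eqI)
  note ex = haar_convolution_exists(1)[OF integrable_rep_L1 integrable_rep_L1]
  have eq: "AE h in haar. rep_L1 (r *\<^sub>R a) h * rep_L1 c (- h + g) = r * (rep_L1 a h * rep_L1 c (- h + g))"
    for g using rep_scaleR_L1[of r a] by eventually_elim simp
  show "AE g in haar. rep_L1 ((r *\<^sub>R a) \<star> c) g = rep_L1 (r *\<^sub>R (a \<star> c)) g"
    using rep_conv[of "r *\<^sub>R a" c] rep_conv[of a c] rep_scaleR_L1[of r "a \<star> c"] ex[of "r *\<^sub>R a" c] ex[of a c]
  proof eventually_elim
    case (elim g)
    have "(LINT h|haar. rep_L1 (r *\<^sub>R a) h * rep_L1 c (- h + g)) = (LINT h|haar. r * (rep_L1 a h * rep_L1 c (- h + g)))"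
      by (rule integral_cong_AE[OF _ _ eq])
        (use elim in \<open>auto intro!: borel_measurable_times borel_measurable_const dest!: borel_measurable_integrable\<close>)
    then show ?case using elim by simp
  qed
qed

text \<open>Here the almost everywhere additivity of representatives is used at the point
  \<open>- h + g\<close>, so it must first be pulled back along the reflected translation;
  additivity on the left needs no such step.\<close>

lemma conv_add_right: "c \<star> (a + b) = c \<star> a + c \<star> (b :: 'g::haar_group L1)"
proof (rule L1_eqI)
  note ex = haar_convolution_exists(1)[OF integrable_rep_L1 integrable_rep_L1]
  have eq: "AE h in haar. rep_L1 c h * rep_L1 (a + b) (- h + g) = rep_L1 c h * rep_L1 a (- h + g) + rep_L1 c h * rep_L1 b (- h + g)"
    for g using AE_haar_reflected_translation[OF rep_plus_L1[of a b], of g] by eventually_elim (simp add: algebra_simps)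
  show "AE g in haar. rep_L1 (c \<star> (a + b)) g = rep_L1 (c \<star> a + c \<star> b) g"
    using rep_conv[of c "a + b"] rep_conv[of c a] rep_conv[of c b] rep_plus_L1[of "c \<star> a" "c \<star> b"]
      ex[of c "a + b"] ex[of c a] ex[of c b]
  proof eventually_elim
    case (elim g)
    have "(LINT h|haar. rep_L1 c h * rep_L1 (a + b) (- h + g)) =
      (LINT h|haar. rep_L1 c h * rep_L1 a (- h + g) + rep_L1 c h * rep_L1 b (- h + g))"
      by (rule integral_cong_AE[OF _ _ eq])
        (use elim in \<open>auto intro!: borel_measurable_add dest!: borel_measurable_integrable\<close>)
    then show ?case using elim by simp
  qed
qed

lemma conv_scaleR_right: "c \<star> (r *\<^sub>R a) = r *\<^sub>R (c \<star> (a :: 'g::haar_group L1))"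
proof (rule L1_eqI)
  note ex = haar_convolution_exists(1)[OF integrable_rep_L1 integrable_rep_L1]
  have eq: "AE h in haar. rep_L1 c h * rep_L1 (r *\<^sub>R a) (- h + g) = r * (rep_L1 c h * rep_L1 a (- h + g))"
    for g using AE_haar_reflected_translation[OF rep_scaleR_L1[of r a], of g] by eventually_elim simp
  show "AE g in haar. rep_L1 (c \<star> (r *\<^sub>R a)) g = rep_L1 (r *\<^sub>R (c \<star> a)) g"
    using rep_conv[of c "r *\<^sub>R a"] rep_conv[of c a] rep_scaleR_L1[of r "c \<star> a"] ex[of c "r *\<^sub>R a"] ex[of c a]
  proof eventually_elim
    case (elim g)
    have "(LINT h|haar. rep_L1 c h * rep_L1 (r *\<^sub>R a) (- h + g)) = (LINT h|haar. r * (rep_L1 c h * rep_L1 a (- h + g)))"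
      by (rule integral_cong_AE[OF _ _ eq])
        (use elim in \<open>auto intro!: borel_measurable_times borel_measurable_const dest!: borel_measurable_integrable\<close>)
    then show ?case using elim by simp
  qed
qed

interpretation conv: bounded_bilinear "(\<star>) :: 'g::haar_group L1 \<Rightarrow> 'g L1 \<Rightarrow> 'g L1"
  by (rule bounded_bilinear.intro)
    (auto simp: conv_add_left conv_add_right conv_scaleR_left conv_scaleR_right intro!: exI[of _ 1] norm_conv)

lemma dual_act_apply: "blinfun_apply (dual_act \<phi> a) b = blinfun_apply \<phi> (a \<star> b)"
  unfolding dual_act_def
  by (rule bounded_linear_Blinfun_apply[THEN fun_cong])
    (rule bounded_linear_compose[OF blinfun.bounded_linear_right conv.bounded_linear_right])

lemma norm_dual_act: "norm (dual_act \<phi> a) \<le> norm \<phi> * norm a"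
proof (rule norm_blinfun_bound)
  fix b
  have "norm (blinfun_apply \<phi> (a \<star> b)) \<le> norm \<phi> * norm (a \<star> b)" by (rule norm_blinfun)
  also have "\<dots> \<le> norm \<phi> * (norm a * norm b)" by (intro mult_left_mono norm_conv) simp
  finally show "norm (blinfun_apply (dual_act \<phi> a) b) \<le> norm \<phi> * norm a * norm b"
    by (simp add: dual_act_apply mult.assoc)
qed simp

lemma bounded_linear_dual_act: "bounded_linear (dual_act \<phi>)"
proof (rule bounded_linear_intro)
  show "dual_act \<phi> (a + b) = dual_act \<phi> a + dual_act \<phi> b" for a b
    by (rule blinfun_eqI) (simp add: dual_act_apply blinfun.add_left conv.add_left blinfun.add_right)
  show "dual_act \<phi> (r *\<^sub>R a) = r *\<^sub>R dual_act \<phi> a" for r a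
    by (rule blinfun_eqI) (simp add: dual_act_apply blinfun.scaleR_left conv.scaleR_left blinfun.scaleR_right)
  show "norm (dual_act \<phi> a) \<le> norm a * norm \<phi>" for a using norm_dual_act[of \<phi> a] by (simp add: mult.commute)
qed

lemma bidual_act_apply: "blinfun_apply (bidual_act \<mu> \<phi>) b = blinfun_apply \<mu> (dual_act \<phi> b)"
  unfolding bidual_act_def
  by (rule bounded_linear_Blinfun_apply[THEN fun_cong])
    (rule bounded_linear_compose[OF blinfun.bounded_linear_right bounded_linear_dual_act])

section \<open>The dual of the convolution algebra\<close>

lemma abs_L1_add: "integrable haar f \<Longrightarrow> integrable haar g \<Longrightarrow> abs_L1 (\<lambda>x. f x + g x) = abs_L1 f + abs_L1 g"
  using plus_L1.abs_eq[of f g] by simp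

lemma abs_L1_diff: "integrable haar f \<Longrightarrow> integrable haar g \<Longrightarrow> abs_L1 (\<lambda>x. f x - g x) = abs_L1 f - abs_L1 g"
  using minus_L1.abs_eq[of f g] by simp

lemma abs_L1_scaleR: "integrable haar f \<Longrightarrow> abs_L1 (\<lambda>x. r * f x) = r *\<^sub>R abs_L1 f"
  using scaleR_L1.abs_eq[of f r] by simp

lemma abs_L1_sum:
  "(\<And>i. i \<in> I \<Longrightarrow> integrable haar (f i)) \<Longrightarrow> abs_L1 (\<lambda>x. \<Sum>i\<in>I. f i x) = (\<Sum>i\<in>I. abs_L1 (f i))"
proof (induction I rule: infinite_finite_induct)
  case (insert i I)
  then have "abs_L1 (\<lambda>x. f i x + (\<Sum>i\<in>I. f i x)) = abs_L1 (f i) + abs_L1 (\<lambda>x. \<Sum>i\<in>I. f i x)"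
    by (intro abs_L1_add) auto
  then show ?case using insert by simp
qed (simp_all add: zero_L1_def)

lemma abs_L1_dominated_convergence:
  fixes \<phi> :: "'g::haar_group L1_dual"
  assumes s: "\<And>i. integrable haar (s i)" and f: "integrable haar f" and w: "integrable haar w"
    and lim: "\<And>x. (\<lambda>i. s i x) \<longlonglongrightarrow> f x" and dom: "\<And>i x. \<bar>s i x\<bar> \<le> w x"
  shows "(\<lambda>i. blinfun_apply \<phi> (abs_L1 (s i))) \<longlonglongrightarrow> blinfun_apply \<phi> (abs_L1 f)"
proof -
  have "(\<lambda>i. LINT x|haar. \<bar>s i x - f x\<bar>) \<longlonglongrightarrow> (LINT x|(haar :: 'g measure). 0)"
  proof (rule integral_dominated_convergence[where w="\<lambda>x. 2 * w x"])
    show "AE x in haar. (\<lambda>i. \<bar>s i x - f x\<bar>) \<longlonglongrightarrow> 0"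
      using lim by (auto intro!: AE_I2 tendsto_rabs_zero LIM_zero)
    have "\<bar>f x\<bar> \<le> w x" for x
      by (rule LIMSEQ_le_const2[OF tendsto_rabs[OF lim]]) (use dom in auto)
    then show "AE x in haar. norm \<bar>s i x - f x\<bar> \<le> 2 * w x" for i
      using dom[of i] by (intro AE_I2) (smt (verit) real_norm_def)
  qed (use s f w in auto)
  then have "(\<lambda>i. norm (abs_L1 (s i) - abs_L1 f)) \<longlonglongrightarrow> 0"
    using s f by (simp add: abs_L1_diff[symmetric] norm_abs_L1)
  then have "(\<lambda>i. abs_L1 (s i)) \<longlonglongrightarrow> abs_L1 f" by (simp add: tendsto_norm_zero_iff LIM_zero_iff)
  then show ?thesis by (intro tendsto_intros)
qed

lemma integrable_rep_mult:
  fixes f :: "'g::haar_group \<Rightarrow> real"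
  assumes "f \<in> borel_measurable haar" "bounded (range f)"
  shows "integrable haar (\<lambda>x. rep_L1 a x * f x)"
proof -
  obtain B where B: "\<And>x. \<bar>f x\<bar> \<le> B" using assms(2) unfolding bounded_iff by auto
  have "integrable haar (\<lambda>x. B * \<bar>rep_L1 a x\<bar>)" by simp
  then show ?thesis
  proof (rule Bochner_Integration.integrable_bound)
    show "AE x in haar. norm (rep_L1 a x * f x) \<le> norm (B * \<bar>rep_L1 a x\<bar>)"
    proof (rule AE_I2)
      fix x
      have "\<bar>rep_L1 a x\<bar> * \<bar>f x\<bar> \<le> \<bar>rep_L1 a x\<bar> * \<bar>B\<bar>"
        using B[of x] by (intro mult_left_mono) auto
      then show "norm (rep_L1 a x * f x) \<le> norm (B * \<bar>rep_L1 a x\<bar>)" by (simp add: abs_mult mult.commute)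
    qed
  qed (use assms(1) in auto)
qed

text \<open>\<open>B\<close> is an essential bound, possibly smaller than the bound of the range.
  The norm estimate is used in this sharp form, with \<open>B = 0\<close> for null sets and with a
  level exceeded only on a null set for the norming property.\<close>

lemma Linfty_functional_apply:
  fixes f :: "'g::haar_group \<Rightarrow> real"
  assumes f: "f \<in> borel_measurable haar" and B: "AE x in haar. \<bar>f x\<bar> \<le> B" and bdd: "bounded (range f)"
  shows "blinfun_apply (Linfty_functional f) a = (LINT g|haar. rep_L1 a g * f g)"
    and "0 \<le> B \<Longrightarrow> norm (Linfty_functional f) \<le> B"
proof -
  have le: "\<bar>LINT g|haar. rep_L1 a g * f g\<bar> \<le> norm a * B" for a
  proof -
    have "\<bar>LINT g|haar. rep_L1 a g * f g\<bar> \<le> (LINT g|haar. \<bar>rep_L1 a g * f g\<bar>)"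
      using integral_norm_bound[of haar "\<lambda>g. rep_L1 a g * f g"] by simp
    also have "\<dots> \<le> (LINT g|haar. \<bar>rep_L1 a g\<bar> * B)"
    proof (rule integral_mono_AE)
      show "AE x in haar. \<bar>rep_L1 a x * f x\<bar> \<le> \<bar>rep_L1 a x\<bar> * B"
        using B by eventually_elim (simp add: abs_mult mult_left_mono)
    qed (use integrable_rep_mult[OF f bdd] in auto)
    also have "\<dots> = norm a * B" by (simp add: norm_L1_rep)
    finally show ?thesis .
  qed
  have "bounded_linear (\<lambda>a. LINT g|haar. rep_L1 a g * f g)"
  proof (rule bounded_linear_intro)
    fix a b :: "'g L1" and r :: real
    have "(LINT g|haar. rep_L1 (a + b) g * f g) = (LINT g|haar. rep_L1 a g * f g + rep_L1 b g * f g)"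
      using rep_plus_L1[of a b] f by (intro integral_cong_AE) (auto elim!: eventually_mono simp: algebra_simps)
    then show "(LINT g|haar. rep_L1 (a + b) g * f g) = (LINT g|haar. rep_L1 a g * f g) + (LINT g|haar. rep_L1 b g * f g)"
      using integrable_rep_mult[OF f bdd] by simp
    have "(LINT g|haar. rep_L1 (r *\<^sub>R a) g * f g) = (LINT g|haar. r * (rep_L1 a g * f g))"
      using rep_scaleR_L1[of r a] f by (intro integral_cong_AE) (auto elim!: eventually_mono simp: algebra_simps)
    then show "(LINT g|haar. rep_L1 (r *\<^sub>R a) g * f g) = r *\<^sub>R (LINT g|haar. rep_L1 a g * f g)" by simp
  qed (use le in simp)
  then have app: "blinfun_apply (Linfty_functional f) a = (LINT g|haar. rep_L1 a g * f g)" for a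
    unfolding Linfty_functional_def by (simp add: bounded_linear_Blinfun_apply)
  then show "blinfun_apply (Linfty_functional f) a = (LINT g|haar. rep_L1 a g * f g)" .
  show "norm (Linfty_functional f) \<le> B" if "0 \<le> B"
    by (rule norm_blinfun_bound[OF that]) (use le in \<open>simp add: app mult.commute\<close>)
qed

lemma Linfty_apply:
  fixes f :: "'g::haar_group \<Rightarrow> real"
  assumes f: "f \<in> borel_measurable haar" and bdd: "bounded (range f)"
  shows "blinfun_apply (Linfty_functional f) a = (LINT g|haar. rep_L1 a g * f g)"
proof -
  obtain B where "\<And>x. \<bar>f x\<bar> \<le> B" using bdd unfolding bounded_iff by auto
  then show ?thesis by (intro Linfty_functional_apply(1)[OF f _ bdd, of B]) auto
qed

lemma Linfty_apply_abs:
  fixes f :: "'g::haar_group \<Rightarrow> real"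
  assumes f: "f \<in> borel_measurable haar" and bdd: "bounded (range f)" and a: "integrable haar a"
  shows "blinfun_apply (Linfty_functional f) (abs_L1 a) = (LINT g|haar. a g * f g)"
  unfolding Linfty_apply[OF f bdd]
  by (rule integral_cong_AE) (use f a rep_abs_L1[OF a] in \<open>auto elim!: eventually_mono\<close>)

lemma bounded_range_add: "bounded (range f) \<Longrightarrow> bounded (range g) \<Longrightarrow> bounded (range (\<lambda>x. f x + g x))"
  for f g :: "'a \<Rightarrow> 'b::real_normed_vector"
  by (rule bounded_plus_comp)

lemma Linfty_add:
  fixes f g :: "'g::haar_group \<Rightarrow> real"
  assumes "f \<in> borel_measurable haar" "bounded (range f)" "g \<in> borel_measurable haar" "bounded (range g)"
  shows "Linfty_functional (\<lambda>x. f x + g x) = Linfty_functional f + Linfty_functional g"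
proof (rule blinfun_eqI)
  fix a :: "'g L1"
  have "(LINT x|haar. rep_L1 a x * f x + rep_L1 a x * g x) = (LINT x|haar. rep_L1 a x * f x) + (LINT x|haar. rep_L1 a x * g x)"
    by (intro Bochner_Integration.integral_add integrable_rep_mult assms)
  then show "blinfun_apply (Linfty_functional (\<lambda>x. f x + g x)) a = blinfun_apply (Linfty_functional f + Linfty_functional g) a"
    using assms by (simp add: Linfty_apply bounded_range_add blinfun.add_left algebra_simps)
qed

lemma Linfty_cmult:
  fixes f :: "'g::haar_group \<Rightarrow> real"
  assumes "f \<in> borel_measurable haar" "bounded (range f)"
  shows "Linfty_functional (\<lambda>x. c * f x) = c *\<^sub>R Linfty_functional f"
proof (rule blinfun_eqI)
  fix a :: "'g L1"
  have "bounded (range (\<lambda>x. c * f x))" using bounded_scaling[OF assms(2), of c] by (simp add: image_image)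
  moreover have "(LINT x|haar. c * (rep_L1 a x * f x)) = c * (LINT x|haar. rep_L1 a x * f x)" by simp
  ultimately show "blinfun_apply (Linfty_functional (\<lambda>x. c * f x)) a = blinfun_apply (c *\<^sub>R Linfty_functional f) a"
    using assms by (simp add: Linfty_apply blinfun.scaleR_left mult.left_commute)
qed

text \<open>Adding the multiple \<open>\<parallel>\<phi>\<parallel>\<close> of the integral makes \<open>\<phi>\<close> a positive functional, so that
  Radon--Nikodym applies without a Jordan decomposition.\<close>

theorem Linfty_functional_surj:
  fixes \<phi> :: "'g::haar_group L1_dual"
  shows "\<exists>f\<in>borel_measurable haar. bounded (range f) \<and> \<phi> = Linfty_functional f"
proof -
  define C where "C = norm \<phi>"
  have C0: "0 \<le> C" by (simp add: C_def)
  define T where "T = (\<lambda>f. blinfun_apply \<phi> (abs_L1 f) + C * (LINT x|haar. f x))"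
  have T_nonneg: "0 \<le> T f" "T f \<le> 2 * C * (LINT x|haar. f x)" if "integrable haar f" "\<And>x. 0 \<le> f x" for f
  proof -
    have "\<bar>blinfun_apply \<phi> (abs_L1 f)\<bar> \<le> C * norm (abs_L1 f)" using norm_blinfun[of \<phi>] by (simp add: C_def)
    also have "norm (abs_L1 f) = (LINT x|haar. f x)" using that by (simp add: norm_abs_L1)
    finally show "0 \<le> T f" "T f \<le> 2 * C * (LINT x|haar. f x)" unfolding T_def by linarith+
  qed
  have T_sum: "T (\<lambda>x. \<Sum>i\<in>I. s i x) = (\<Sum>i\<in>I. T (s i))" if "\<And>i. integrable haar (s i)" for s and I :: "nat set"
    using that unfolding T_def by (simp add: abs_L1_sum blinfun.sum_right sum.distrib sum_distrib_left)
  \<comment> \<open>The weight replaces \<open>haar\<close> by a finite measure, so that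
    \<open>r\<close> below is finite on every measurable set.\<close>
  obtain w :: "'g \<Rightarrow> real" where w: "w \<in> borel_measurable haar" "\<And>x. 0 < w x" "\<And>x. w x \<le> 1" "integrable haar w"
    using haar.obtain_positive_integrable_function by blast
  have wA: "integrable haar (\<lambda>x. w x * indicator A x)" if "A \<in> sets haar" for A
    using integrable_mult_indicator[OF that w(4)] by (simp add: mult.commute)
  define r where "r = (\<lambda>A. T (\<lambda>x. w x * indicator A x))"
  have r0: "0 \<le> r A" "r A \<le> 2 * C * (LINT x|haar. w x * indicator A x)" if "A \<in> sets haar" for A
    unfolding r_def by (intro T_nonneg wA that; use w(2) in \<open>simp add: less_imp_le\<close>)+
  have r_sums: "(\<lambda>i. r (A i)) sums r (\<Union>i. A i)"
    if A: "range A \<subseteq> sets haar" "disjoint_family A" for A :: "nat \<Rightarrow> 'g set"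
  proof -
    let ?s = "\<lambda>n x. \<Sum>i<n. w x * indicator (A i) x"
    have U: "(\<Union>i. A i) \<in> sets haar" using A(1) by auto
    have lim: "(\<lambda>n. ?s n x) \<longlonglongrightarrow> w x * indicator (\<Union>i. A i) x" for x
    proof -
      have "(\<lambda>i. indicator (A i) x :: real) sums indicator (\<Union>i. A i) x"
        using A(2) by (intro indicator_sums) (auto simp: disjoint_family_on_def)
      then have "(\<lambda>i. w x * indicator (A i) x) sums (w x * indicator (\<Union>i. A i) x)" by (rule sums_mult)
      then show ?thesis by (simp add: sums_def)
    qed
    have eq: "?s n x = w x * indicator (\<Union>i<n. A i) x" for n x
    proof -
      have "indicator (\<Union>i<n. A i) x = (\<Sum>i<n. indicator (A i) x :: real)"
        using A(2) by (intro indicator_UN_disjoint) (auto simp: disjoint_family_on_def)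
      then show ?thesis by (simp add: sum_distrib_left)
    qed
    have dom: "\<bar>?s n x\<bar> \<le> w x" for n x unfolding eq using w(2)[of x] by (simp add: indicator_def)
    have int: "integrable haar (?s n)" for n
      using A(1) by (intro Bochner_Integration.integrable_sum wA) auto
    have "(\<lambda>n. blinfun_apply \<phi> (abs_L1 (?s n)) + C * (LINT x|haar. ?s n x)) \<longlonglongrightarrow>
      blinfun_apply \<phi> (abs_L1 (\<lambda>x. w x * indicator (\<Union>i. A i) x)) + C * (LINT x|haar. w x * indicator (\<Union>i. A i) x)"
    proof (intro tendsto_add tendsto_mult tendsto_const)
      show "(\<lambda>n. blinfun_apply \<phi> (abs_L1 (?s n))) \<longlonglongrightarrow> blinfun_apply \<phi> (abs_L1 (\<lambda>x. w x * indicator (\<Union>i. A i) x))"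
        by (rule abs_L1_dominated_convergence[OF int wA[OF U] w(4) lim dom])
      show "(\<lambda>n. LINT x|haar. ?s n x) \<longlonglongrightarrow> (LINT x|haar. w x * indicator (\<Union>i. A i) x)"
        by (rule integral_dominated_convergence[OF _ _ w(4)]) (use wA[OF U] int lim dom in auto)
    qed
    then have "(\<lambda>n. T (?s n)) \<longlonglongrightarrow> r (\<Union>i. A i)" unfolding r_def T_def .
    moreover have "T (?s n) = (\<Sum>i<n. r (A i))" for n unfolding r_def by (rule T_sum) (use A(1) in \<open>auto intro!: wA\<close>)
    ultimately show ?thesis by (simp add: sums_def)
  qed
  define N where "N = measure_of UNIV (sets (haar :: 'g measure)) (\<lambda>A. ennreal (r A))"
  have sets_N: "sets N = sets haar"
    unfolding N_def using sets.sigma_sets_eq[of "haar :: 'g measure"] by (simp add: sets_measure_of_conv)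
  have r_empty: "r {} = 0" unfolding r_def T_def by (simp add: zero_L1_def[symmetric])
  have N: "emeasure N A = ennreal (r A)" if "A \<in> sets haar" for A
    unfolding N_def
  proof (rule emeasure_measure_of_sigma[OF _ _ _ that])
    show "sigma_algebra UNIV (sets (haar :: 'g measure))" using sets.sigma_algebra_axioms[of "haar :: 'g measure"] by simp
    show "positive (sets haar) (\<lambda>A. ennreal (r A))" by (simp add: positive_def r_empty)
    show "countably_additive (sets haar) (\<lambda>A. ennreal (r A))"
    proof (rule countably_additiveI)
      fix A :: "nat \<Rightarrow> 'g set" assume A: "range A \<subseteq> sets haar" "disjoint_family A"
      show "(\<Sum>i. ennreal (r (A i))) = ennreal (r (\<Union>i. A i))"
        by (rule suminf_ennreal_eq[OF _ r_sums[OF A]]) (use A(1) r0 in auto)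
    qed
  qed
  have "absolutely_continuous haar N"
    unfolding absolutely_continuous_def
  proof
    fix A :: "'g set" assume A: "A \<in> null_sets haar"
    then have "(LINT x|haar. w x * indicator A x) = 0"
      by (intro integral_eq_zero_AE) (auto dest!: AE_not_in elim!: eventually_mono)
    then have "r A = 0" using r0[of A] A by auto
    then show "A \<in> null_sets N" using A N sets_N by (auto simp: null_sets_def)
  qed
  then obtain k where k: "k \<in> borel_measurable haar" "density haar k = N"
    using haar.Radon_Nikodym sets_N by blast
  have k_int: "(\<integral>\<^sup>+x\<in>A. k x \<partial>haar) = ennreal (r A)" if "A \<in> sets haar" for A
    using N[OF that] that k(1) by (simp add: k(2)[symmetric] emeasure_density)
  \<comment> \<open>On the set where the bound fails, \<open>G\<close> dominates \<open>F\<close>,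
    yet the integral of \<open>G\<close> is \<open>r A\<close>, at most the finite integral of
    \<open>F\<close>. So they agree almost everywhere.\<close>
  have k_le: "AE x in haar. k x \<le> ennreal (2 * C * w x)"
  proof -
    define A where "A = {x. ennreal (2 * C * w x) < k x}"
    have A: "A \<in> sets haar"
      using borel_measurable_less[of "\<lambda>x. ennreal (2 * C * w x)" haar k] k(1) w(1)
      by (simp add: A_def pred_def)
    define F where "F = (\<lambda>x. ennreal (2 * C * w x) * indicator A x)"
    define G where "G = (\<lambda>x. k x * indicator A x)"
    have meas: "F \<in> borel_measurable haar" "G \<in> borel_measurable haar"
      using w(1) k(1) A by (auto simp: F_def G_def)
    have F: "(\<integral>\<^sup>+x. F x \<partial>haar) = ennreal (2 * C * (LINT x|haar. w x * indicator A x))"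
    proof -
      have "(\<integral>\<^sup>+x. F x \<partial>haar) = (\<integral>\<^sup>+x. ennreal (2 * C * (w x * indicator A x)) \<partial>haar)"
        by (intro nn_integral_cong) (auto simp: F_def indicator_def)
      also have "\<dots> = ennreal (LINT x|haar. 2 * C * (w x * indicator A x))"
        using wA[OF A] C0 w(2) by (intro nn_integral_eq_integral) (auto simp: less_imp_le)
      finally show ?thesis by simp
    qed
    have "AE x in haar. G x \<le> F x"
    proof (rule ccontr)
      assume "\<not> ?thesis"
      moreover have "AE x in haar. F x \<le> G x" by (auto simp: F_def G_def A_def indicator_def intro!: AE_I2)
      ultimately have "(\<integral>\<^sup>+x. F x \<partial>haar) < (\<integral>\<^sup>+x. G x \<partial>haar)"
        using meas F by (intro nn_integral_less) auto
      also have "\<dots> = ennreal (r A)" using k_int[OF A] by (simp add: G_def)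
      also have "\<dots> \<le> (\<integral>\<^sup>+x. F x \<partial>haar)" unfolding F using r0(2)[OF A] by (rule ennreal_leI)
      finally show False by simp
    qed
    then show ?thesis
    proof eventually_elim
      case (elim x)
      then show ?case by (cases "x \<in> A") (auto simp: F_def G_def A_def not_less)
    qed
  qed
  \<comment> \<open>Solves \<open>k x = w x * (f x + C)\<close> for \<open>f\<close>. The truncation
    to \<open>[- C, C]\<close> makes \<open>f\<close> bounded everywhere and changes it only on the
    null set where \<open>k_le\<close> fails.\<close>
  define f where "f = (\<lambda>x. max (- C) (min C (enn2real (k x) / w x - C)))"
  have f_meas: "f \<in> borel_measurable haar" using k(1) w(1) unfolding f_def by measurable
  have f_bdd: "\<bar>f x\<bar> \<le> C" for x using C0 by (auto simp: f_def)
  have f_range: "bounded (range f)" unfolding bounded_iff using f_bdd by auto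
  have k_f: "AE x in haar. k x = ennreal (w x * (f x + C))"
    using k_le
  proof eventually_elim
    case (elim x)
    obtain t where t: "k x = ennreal t" "0 \<le> t" using elim by (cases "k x") (auto simp: top_unique)
    have "t \<le> 2 * C * w x" using elim C0 w(2)[of x] by (simp add: t ennreal_le_iff less_imp_le)
    then have "t / w x \<le> 2 * C" using w(2)[of x] by (simp add: pos_divide_le_eq)
    moreover have "0 \<le> t / w x" using t w(2)[of x] by simp
    ultimately have "f x = t / w x - C" using t by (simp add: f_def)
    then show ?case using w(2)[of x] by (simp add: t)
  qed
  have base_ind: "blinfun_apply \<phi> (abs_L1 (\<lambda>x. w x * indicator A x)) = (LINT x|haar. w x * indicator A x * f x)"
    if A: "A \<in> sets haar" for A
  proof -
    have int_f: "integrable haar (\<lambda>x. w x * indicator A x * f x)"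
      by (rule Bochner_Integration.integrable_bound[OF integrable_mult_right[OF w(4), of C]])
        (use f_meas w A C0 f_bdd in \<open>auto intro!: AE_I2 mult_mono simp: abs_mult indicator_def mult.commute less_imp_le\<close>)
    have "ennreal (r A) = (\<integral>\<^sup>+x. ennreal (w x * (f x + C)) * indicator A x \<partial>haar)"
      unfolding k_int[OF A, symmetric] using k_f by (intro nn_integral_cong_AE) (auto elim!: eventually_mono)
    also have "\<dots> = (\<integral>\<^sup>+x. ennreal (w x * indicator A x * f x + C * (w x * indicator A x)) \<partial>haar)"
      by (intro nn_integral_cong) (auto simp: indicator_def algebra_simps)
    also have "\<dots> = ennreal (LINT x|haar. w x * indicator A x * f x + C * (w x * indicator A x))"
    proof (rule nn_integral_eq_integral)
      have "0 \<le> w x * indicator A x * f x + C * (w x * indicator A x)" for x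
      proof -
        have "0 \<le> w x * (f x + C)" using w(2)[of x] f_bdd[of x] by (intro mult_nonneg_nonneg) auto
        then show ?thesis by (auto simp: indicator_def algebra_simps)
      qed
      then show "AE x in haar. 0 \<le> w x * indicator A x * f x + C * (w x * indicator A x)" by simp
    qed (use int_f wA[OF A] in auto)
    also have "(LINT x|haar. w x * indicator A x * f x + C * (w x * indicator A x)) =
      (LINT x|haar. w x * indicator A x * f x) + C * (LINT x|haar. w x * indicator A x)"
      using int_f wA[OF A] by simp
    finally have eq: "ennreal (r A) = ennreal ((LINT x|haar. w x * indicator A x * f x) + C * (LINT x|haar. w x * indicator A x))" .
    have "0 \<le> (LINT x|haar. w x * indicator A x * f x) + C * (LINT x|haar. w x * indicator A x)"
    proof -
      have "- (C * (w x * indicator A x)) \<le> w x * indicator A x * f x" for x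
        using f_bdd[of x] w(2)[of x] mult_left_mono[of "- C" "f x" "w x"] by (auto simp: indicator_def mult.commute)
      then have "(LINT x|haar. - (C * (w x * indicator A x))) \<le> (LINT x|haar. w x * indicator A x * f x)"
        using int_f wA[OF A] by (intro integral_mono) auto
      then show ?thesis by simp
    qed
    with eq have "r A = (LINT x|haar. w x * indicator A x * f x) + C * (LINT x|haar. w x * indicator A x)"
      using r0(1)[OF A] by simp
    then show ?thesis by (simp add: r_def T_def)
  qed
  have dens: "integrable haar (\<lambda>x. w x * b x)" if "integrable (density haar w) b" for b :: "'g \<Rightarrow> real"
  proof -
    have "b \<in> borel_measurable haar" using borel_measurable_integrable[OF that] by (simp add: measurable_def)
    then show ?thesis using that integrable_density[of b haar w] w(1,2) by (simp add: less_imp_le)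
  qed
  have dens_f: "integrable haar (\<lambda>x. w x * b x * f x)" if "integrable (density haar w) b" for b :: "'g \<Rightarrow> real"
  proof (rule Bochner_Integration.integrable_bound[OF integrable_mult_right[OF integrable_abs[OF dens[OF that]], of C]])
    show "(\<lambda>x. w x * b x * f x) \<in> borel_measurable haar"
      by (rule borel_measurable_times[OF borel_measurable_integrable[OF dens[OF that]] f_meas])
    show "AE x in haar. norm (w x * b x * f x) \<le> norm (C * \<bar>w x * b x\<bar>)"
    proof (rule AE_I2)
      fix x
      have "\<bar>w x * b x\<bar> * \<bar>f x\<bar> \<le> \<bar>w x * b x\<bar> * C" using f_bdd by (intro mult_left_mono) auto
      then show "norm (w x * b x * f x) \<le> norm (C * \<bar>w x * b x\<bar>)" using C0 by (simp add: abs_mult mult.commute)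
    qed
  qed
  \<comment> \<open>Every integrable function has the form \<open>w * b\<close> with
    \<open>b\<close> integrable for the finite measure of density \<open>w\<close>, so the
    representation is proved by induction on \<open>b\<close>.\<close>
  have rep: "blinfun_apply \<phi> (abs_L1 (\<lambda>x. w x * b x)) = (LINT x|haar. w x * b x * f x)"
    if "integrable (density haar w) b" for b
    using that
  proof (induction rule: integrable_induct)
    case (base A c)
    then have A: "A \<in> sets haar" by simp
    have "(\<lambda>x. w x * (indicator A x *\<^sub>R c)) = (\<lambda>x. c * (w x * indicator A x))"
      "(\<lambda>x. w x * (indicator A x *\<^sub>R c) * f x) = (\<lambda>x. c * (w x * indicator A x * f x))" by (auto simp: fun_eq_iff)
    moreover have "abs_L1 (\<lambda>x. c * (w x * indicator A x)) = c *\<^sub>R abs_L1 (\<lambda>x. w x * indicator A x)"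
      by (rule abs_L1_scaleR[OF wA[OF A]])
    ultimately show ?case by (simp add: blinfun.scaleR_right base_ind[OF A])
  next
    case (add b1 b2)
    then have "abs_L1 (\<lambda>x. w x * b1 x + w x * b2 x) = abs_L1 (\<lambda>x. w x * b1 x) + abs_L1 (\<lambda>x. w x * b2 x)"
      by (intro abs_L1_add dens) auto
    moreover have "(LINT x|haar. w x * b1 x * f x + w x * b2 x * f x) = (LINT x|haar. w x * b1 x * f x) + (LINT x|haar. w x * b2 x * f x)"
      using add by (intro Bochner_Integration.integral_add dens_f) auto
    ultimately show ?case using add by (simp add: algebra_simps blinfun.add_right)
  next
    case (lim b s)
    have bnd: "\<bar>w x * s i x\<bar> \<le> 2 * \<bar>w x * b x\<bar>" for i x
    proof -
      have "\<bar>s i x\<bar> \<le> 2 * \<bar>b x\<bar>" using lim by auto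
      then have "\<bar>w x\<bar> * \<bar>s i x\<bar> \<le> \<bar>w x\<bar> * (2 * \<bar>b x\<bar>)" by (intro mult_left_mono) auto
      then show ?thesis by (simp add: abs_mult)
    qed
    have pt: "(\<lambda>i. w x * s i x) \<longlonglongrightarrow> w x * b x" for x
      using lim by (intro tendsto_mult tendsto_const) auto
    have int_b: "integrable haar (\<lambda>x. 2 * \<bar>w x * b x\<bar>)" using dens[OF lim.hyps(4)] by simp
    have "(\<lambda>i. blinfun_apply \<phi> (abs_L1 (\<lambda>x. w x * s i x))) \<longlonglongrightarrow> blinfun_apply \<phi> (abs_L1 (\<lambda>x. w x * b x))"
      by (rule abs_L1_dominated_convergence[OF dens[OF lim.hyps(1)] dens[OF lim.hyps(4)] int_b pt bnd])
    moreover have "(\<lambda>i. LINT x|haar. w x * s i x * f x) \<longlonglongrightarrow> (LINT x|haar. w x * b x * f x)"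
    proof (rule integral_dominated_convergence[where w="\<lambda>x. C * (2 * \<bar>w x * b x\<bar>)"])
      show "AE x in haar. (\<lambda>i. w x * s i x * f x) \<longlonglongrightarrow> w x * b x * f x"
        by (intro AE_I2 tendsto_mult[OF pt] tendsto_const)
      show "AE x in haar. norm (w x * s i x * f x) \<le> C * (2 * \<bar>w x * b x\<bar>)" for i
      proof (rule AE_I2)
        fix x
        have "\<bar>w x * s i x\<bar> * \<bar>f x\<bar> \<le> (2 * \<bar>w x * b x\<bar>) * C"
          by (rule mult_mono[OF bnd f_bdd]) auto
        then show "norm (w x * s i x * f x) \<le> C * (2 * \<bar>w x * b x\<bar>)" by (simp add: abs_mult mult.commute)
      qed
    qed (use dens_f[OF lim.hyps(4)] dens_f[OF lim.hyps(1)] int_b in auto)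
    ultimately show ?case using lim.IH by (simp add: LIMSEQ_unique)
  qed
  have "\<phi> = Linfty_functional f"
  proof (rule blinfun_eqI)
    fix a :: "'g L1"
    define b where "b = (\<lambda>x. rep_L1 a x / w x)"
    have wb: "(\<lambda>x. w x * b x) = rep_L1 a" using w(2) by (auto simp: b_def fun_eq_iff less_imp_neq[symmetric])
    have "integrable (density haar w) b"
      using integrable_density[of b haar w] w(1,2) wb by (simp add: less_imp_le b_def)
    from rep[OF this] wb have "blinfun_apply \<phi> (abs_L1 (rep_L1 a)) = (LINT x|haar. rep_L1 a x * f x)"
      by (metis (no_types, lifting) Bochner_Integration.integral_cong)
    then show "blinfun_apply \<phi> a = blinfun_apply (Linfty_functional f) a"
      by (simp add: Linfty_apply[OF f_meas f_range])
  qed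
  then show ?thesis using f_meas f_range by blast
qed

section \<open>The zero-one charges\<close>

text \<open>The ball is the image of the linear functions in a product of intervals, a compact set
  by Tychonoff; on it \<open>Blinfun\<close> is continuous because both topologies are those of
  pointwise convergence.\<close>

theorem banach_alaoglu:
  "compactin strong_operator_topology (cball 0 1 :: ('v::real_normed_vector \<Rightarrow>\<^sub>L real) set)"
proof -
  define P where "P = (\<Pi>\<^sub>E x\<in>UNIV. {- norm x..norm (x :: 'v)})"
  define L where "L = P \<inter> {f. \<forall>x y. f (x + y) = f x + f y} \<inter> {f. \<forall>r x. f (r *\<^sub>R x) = r * f x}"
  have "compactin (product_topology (\<lambda>_. euclidean) UNIV) P"
    unfolding P_def by (subst compactin_PiE) auto
  then have "compact P" by (simp add: euclidean_product_topology)
  moreover have "closed {f :: 'v \<Rightarrow> real. \<forall>x y. f (x + y) = f x + f y}"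
    by (intro closed_Collect_all closed_Collect_eq continuous_on_add continuous_on_product_coordinates)
  moreover have "closed {f :: 'v \<Rightarrow> real. \<forall>r x. f (r *\<^sub>R x) = r * f x}"
    by (intro closed_Collect_all closed_Collect_eq continuous_on_mult continuous_on_const continuous_on_product_coordinates)
  ultimately have "compact L" unfolding L_def by (intro compact_Int_closed)
  have bl: "bounded_linear f" if "f \<in> L" for f
  proof (rule bounded_linear_intro)
    show "norm (f x) \<le> norm x * 1" for x
    proof -
      have "f x \<in> {- norm x..norm x}" using that by (auto simp: L_def P_def PiE_def Pi_def)
      then show ?thesis by (simp add: abs_le_iff)
    qed
  qed (use that in \<open>auto simp: L_def\<close>)
  have cont: "continuous_map (top_of_set L) strong_operator_topology Blinfun"
    unfolding continuous_on_strong_operator_topo_iff_coordinatewise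
  proof
    fix x
    have "continuous_on L (\<lambda>f. f x)" by (rule continuous_on_subset[OF continuous_on_product_coordinates]) simp
    moreover have "blinfun_apply (Blinfun f) x = f x" if "f \<in> L" for f using bl[OF that] by (simp add: bounded_linear_Blinfun_apply)
    ultimately have "continuous_on L (\<lambda>f. blinfun_apply (Blinfun f) x)"
      by (rule continuous_on_eq[OF _ sym])
    then show "continuous_map (top_of_set L) euclidean (\<lambda>f. blinfun_apply (Blinfun f) x)" by simp
  qed
  have "cball 0 1 = Blinfun ` L"
  proof
    show "Blinfun ` L \<subseteq> cball 0 1"
    proof clarify
      fix f assume f: "f \<in> L"
      have "norm (Blinfun f) \<le> 1"
      proof (rule norm_blinfun_bound)
        fix x
        have "f x \<in> {- norm x..norm x}" using f by (auto simp: L_def P_def PiE_def Pi_def)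
        then show "norm (blinfun_apply (Blinfun f) x) \<le> 1 * norm x"
          using bl[OF f] by (simp add: bounded_linear_Blinfun_apply abs_le_iff)
      qed simp
      then show "Blinfun f \<in> cball 0 1" by simp
    qed
    show "cball 0 1 \<subseteq> Blinfun ` L"
    proof
      fix \<psi> :: "'v \<Rightarrow>\<^sub>L real" assume "\<psi> \<in> cball 0 1"
      then have n: "norm \<psi> \<le> 1" by simp
      have b: "\<bar>blinfun_apply \<psi> x\<bar> \<le> norm x" for x
      proof -
        have "norm (blinfun_apply \<psi> x) \<le> norm \<psi> * norm x" by (rule norm_blinfun)
        also have "\<dots> \<le> 1 * norm x" by (rule mult_right_mono[OF n]) simp
        finally show ?thesis by simp
      qed
      then have "blinfun_apply \<psi> \<in> L"
        using b by (auto simp: L_def P_def blinfun.add_right blinfun.scaleR_right abs_le_iff minus_le_iff)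
      moreover have "Blinfun (blinfun_apply \<psi>) = \<psi>" by (simp add: blinfun_apply_inverse)
      ultimately show "\<psi> \<in> Blinfun ` L" by (metis imageI)
    qed
  qed
  moreover have "compactin (top_of_set L) L" using \<open>compact L\<close> by simp
  ultimately show ?thesis using image_compactin[OF _ cont] by metis
qed

section \<open>Indicator functionals and essential bounds\<close>

abbreviation chi :: "'g::haar_group set \<Rightarrow> 'g L1_dual" where
  "chi A \<equiv> Linfty_functional (indicator A)"

lemma bounded_range_indicator: "bounded (range (indicator A :: 'a \<Rightarrow> real))"
  unfolding bounded_iff by (auto intro!: exI[of _ 1] simp: indicator_def)

lemma chi_apply_abs:
  fixes a :: "'g::haar_group \<Rightarrow> real"
  assumes "A \<in> sets haar" "integrable haar a"
  shows "blinfun_apply (chi A) (abs_L1 a) = (LINT g|haar. a g * indicator A g)"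
  using assms by (intro Linfty_apply_abs bounded_range_indicator) auto

lemma chi_null: "A \<in> null_sets haar \<Longrightarrow> chi A = 0"
proof -
  assume A: "A \<in> null_sets (haar :: 'a measure)"
  have "norm (chi A) \<le> 0"
    by (intro Linfty_functional_apply(2) bounded_range_indicator)
      (use A AE_not_in[OF A] in \<open>auto elim!: eventually_mono\<close>)
  then show ?thesis by simp
qed

lemma chi_Un:
  assumes "A \<in> sets haar" "B \<in> sets haar" "A \<inter> B = {}"
  shows "chi (A \<union> B) = chi A + chi B"
proof -
  have "(indicator (A \<union> B) :: _ \<Rightarrow> real) = (\<lambda>x. indicator A x + indicator B x)"
    using assms(3) by (auto simp: indicator_def fun_eq_iff)
  then show ?thesis using assms by (simp add: Linfty_add bounded_range_indicator)
qed

text \<open>Test the functional against \<open>sgn f\<close> on the set where \<open>|f|\<close>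
  exceeds the norm. The positive integrable weight \<open>w\<close> is needed since that set may
  have infinite measure.\<close>

lemma Linfty_AE_le:
  fixes f :: "'g::haar_group \<Rightarrow> real"
  assumes f: "f \<in> borel_measurable haar" and bdd: "bounded (range f)"
  shows "AE x in haar. \<bar>f x\<bar> \<le> norm (Linfty_functional f)"
proof -
  define c where "c = norm (Linfty_functional f)"
  obtain w :: "'g \<Rightarrow> real" where w: "w \<in> borel_measurable haar" "\<And>x. 0 < w x" "\<And>x. w x \<le> 1" "integrable haar w"
    using haar.obtain_positive_integrable_function by blast
  define A where "A = {x. c < \<bar>f x\<bar>}"
  have A: "A \<in> sets haar" using borel_measurable_less[of "\<lambda>_. c" haar "\<lambda>x. \<bar>f x\<bar>"] f by (simp add: A_def pred_def)
  define a where "a = (\<lambda>x. w x * indicator A x * sgn (f x))"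
  define u where "u = (\<lambda>x. w x * indicator A x)"
  have u: "integrable haar u"
    using integrable_mult_indicator[OF A w(4)] by (simp add: u_def mult.commute)
  have a: "integrable haar a"
  proof (rule Bochner_Integration.integrable_bound[OF u])
    show "a \<in> borel_measurable haar" using w(1) A f unfolding a_def by measurable
    show "AE x in haar. norm (a x) \<le> norm (u x)"
      by (auto intro!: AE_I2 simp: a_def u_def abs_mult indicator_def sgn_if)
  qed
  have af: "a x * f x = u x * \<bar>f x\<bar>" for x by (simp add: a_def u_def mult.assoc sgn_mult_abs abs_sgn mult.commute[of "sgn _"])
  have int_uf: "integrable haar (\<lambda>x. u x * \<bar>f x\<bar>)"
  proof -
    obtain B where B: "\<And>x. \<bar>f x\<bar> \<le> B" using bdd unfolding bounded_iff by auto
    show ?thesis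
    proof (rule Bochner_Integration.integrable_bound[OF integrable_mult_right[OF u, of B]])
      show "(\<lambda>x. u x * \<bar>f x\<bar>) \<in> borel_measurable haar" using u f by auto
      show "AE x in haar. norm (u x * \<bar>f x\<bar>) \<le> norm (B * u x)"
      proof (rule AE_I2)
        fix x
        have "\<bar>u x\<bar> * \<bar>f x\<bar> \<le> \<bar>u x\<bar> * \<bar>B\<bar>" using B[of x] by (intro mult_left_mono) auto
        then show "norm (u x * \<bar>f x\<bar>) \<le> norm (B * u x)" by (simp add: abs_mult mult.commute)
      qed
    qed
  qed
  have "(LINT x|haar. u x * \<bar>f x\<bar>) = blinfun_apply (Linfty_functional f) (abs_L1 a)"
    unfolding Linfty_apply_abs[OF f bdd a] af ..
  also have "\<dots> \<le> c * norm (abs_L1 a)" using norm_blinfun[of "Linfty_functional f" "abs_L1 a"] by (simp add: c_def)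
  also have "\<dots> \<le> c * (LINT x|haar. u x)"
  proof (rule mult_left_mono)
    have "(LINT x|haar. \<bar>a x\<bar>) \<le> (LINT x|haar. u x)"
      by (rule integral_mono[OF integrable_abs[OF a] u]) (use w(2) in \<open>auto simp: a_def u_def abs_mult indicator_def sgn_if less_imp_le\<close>)
    then show "norm (abs_L1 a) \<le> (LINT x|haar. u x)" using a by (simp add: norm_abs_L1)
  qed (simp add: c_def)
  finally have "(LINT x|haar. u x * \<bar>f x\<bar> - c * u x) \<le> 0" using u int_uf by simp
  moreover have nonneg: "0 \<le> u x * \<bar>f x\<bar> - c * u x" for x
  proof -
    have "u x * \<bar>f x\<bar> - c * u x = u x * (\<bar>f x\<bar> - c)" by (simp add: algebra_simps)
    then show ?thesis using w(2)[of x] by (simp add: u_def A_def indicator_def)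
  qed
  moreover have "0 \<le> (LINT x|haar. u x * \<bar>f x\<bar> - c * u x)" by (rule integral_nonneg_AE[OF AE_I2[OF nonneg]])
  ultimately have "(LINT x|haar. u x * \<bar>f x\<bar> - c * u x) = 0" by linarith
  then have "AE x in haar. u x * \<bar>f x\<bar> - c * u x = 0"
    using integral_nonneg_eq_0_iff_AE[of haar "\<lambda>x. u x * \<bar>f x\<bar> - c * u x"] u int_uf nonneg by auto
  then have "AE x in haar. \<bar>f x\<bar> \<le> c"
  proof eventually_elim
    case (elim x)
    then have "u x * (\<bar>f x\<bar> - c) = 0" by (simp add: algebra_simps)
    then show ?case using w(2)[of x] by (auto simp: u_def A_def indicator_def split: if_splits)
  qed
  then show ?thesis by (simp add: c_def)
qed

section \<open>Charge integrals through simple functions\<close>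

lemma bounded_simple: "simple_function haar s \<Longrightarrow> bounded (range (s :: 'g::haar_group \<Rightarrow> real))"
  using simple_functionD(1)[of haar s] by (simp add: finite_imp_bounded)

lemma Linfty_sum:
  fixes f :: "'i \<Rightarrow> 'g::haar_group \<Rightarrow> real"
  assumes "finite I" "\<And>i. i \<in> I \<Longrightarrow> f i \<in> borel_measurable haar" "\<And>i. i \<in> I \<Longrightarrow> bounded (range (f i))"
  shows "Linfty_functional (\<lambda>x. \<Sum>i\<in>I. f i x) = (\<Sum>i\<in>I. Linfty_functional (f i)) \<and>
    bounded (range (\<lambda>x. \<Sum>i\<in>I. f i x))"
  using assms
proof (induction I)
  case empty
  have "Linfty_functional (\<lambda>x::'g. 0) = 0"
    using Linfty_cmult[of "\<lambda>_::'g. 0" 0] by simp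
  then show ?case by simp
next
  case (insert i I)
  then show ?case by (simp add: Linfty_add bounded_range_add)
qed

lemma simple_charge_integral_eq:
  fixes \<mu> :: "'g::haar_group L1_bidual"
  assumes s: "simple_function haar s"
  shows "simple_charge_integral (\<lambda>A. blinfun_apply \<mu> (chi A)) s = blinfun_apply \<mu> (Linfty_functional s)"
proof -
  have fin: "finite (range s)" and meas: "\<And>y. s -` {y} \<in> sets haar"
    using simple_functionD[OF s] by auto
  have "s = (\<lambda>x. \<Sum>y\<in>range s. y * indicator (s -` {y}) x)"
  proof
    fix x
    have "(\<Sum>y\<in>range s. y * indicator (s -` {y}) x) = (\<Sum>y\<in>range s. if y = s x then y else 0)"
      by (intro sum.cong) (auto simp: indicator_def)
    then show "s x = (\<Sum>y\<in>range s. y * indicator (s -` {y}) x)" using fin by simp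
  qed
  then have "Linfty_functional s = Linfty_functional (\<lambda>x. \<Sum>y\<in>range s. y * indicator (s -` {y}) x)" by metis
  also have "\<dots> = (\<Sum>y\<in>range s. Linfty_functional (\<lambda>x. y * indicator (s -` {y}) x))"
  proof (intro Linfty_sum[THEN conjunct1] fin)
    fix y
    show "(\<lambda>x. y * indicator (s -` {y}) x) \<in> borel_measurable haar" using meas[of y] by auto
    show "bounded (range (\<lambda>x. y * indicator (s -` {y}) x))"
      using bounded_scaling[OF bounded_range_indicator, of y "s -` {y}"] by (simp add: image_image)
  qed
  also have "\<dots> = (\<Sum>y\<in>range s. y *\<^sub>R chi (s -` {y}))"
    using meas by (intro sum.cong refl Linfty_cmult bounded_range_indicator) auto
  finally show ?thesis
    by (simp add: simple_charge_integral_def blinfun.sum_right blinfun.scaleR_right)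
qed

lemma simple_uniform_approximation:
  fixes f :: "'g::haar_group \<Rightarrow> real"
  assumes f: "f \<in> borel_measurable haar" and bdd: "bounded (range f)"
  obtains s where "\<And>n. simple_function haar (s n)" "\<And>n x. \<bar>s n x - f x\<bar> \<le> 1 / real (Suc n)"
proof -
  obtain B where B: "\<And>x. \<bar>f x\<bar> \<le> B" using bdd unfolding bounded_iff by auto
  \<comment> \<open>Rounding down to multiples of \<open>1 / Suc n\<close>; boundedness of
    \<open>f\<close> leaves finitely many values.\<close>
  define s where "s = (\<lambda>n x. real_of_int \<lfloor>real (Suc n) * f x\<rfloor> / real (Suc n))"
  have "simple_function haar (s n)" for n
  proof (rule simple_function_borel_measurable)
    show "s n \<in> borel_measurable haar" using f unfolding s_def by measurable
    have "\<lfloor>real (Suc n) * f x\<rfloor> \<in> {\<lfloor>- (real (Suc n) * B)\<rfloor>..\<lfloor>real (Suc n) * B\<rfloor>}" for x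
    proof -
      have "\<bar>real (Suc n) * f x\<bar> \<le> real (Suc n) * B"
        unfolding abs_mult using B[of x] by (intro mult_mono) auto
      then have "- (real (Suc n) * B) \<le> real (Suc n) * f x" "real (Suc n) * f x \<le> real (Suc n) * B"
        by linarith+
      then show ?thesis using floor_mono by (metis atLeastAtMost_iff)
    qed
    then have "s n ` space haar \<subseteq> (\<lambda>k. real_of_int k / real (Suc n)) ` {\<lfloor>- (real (Suc n) * B)\<rfloor>..\<lfloor>real (Suc n) * B\<rfloor>}"
      unfolding s_def by blast
    then show "finite (s n ` space haar)" by (rule finite_subset) simp
  qed
  moreover have "\<bar>s n x - f x\<bar> \<le> 1 / real (Suc n)" for n x
  proof -
    have "\<bar>real_of_int \<lfloor>real (Suc n) * f x\<rfloor> - real (Suc n) * f x\<bar> \<le> 1" by linarith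
    then have "\<bar>real_of_int \<lfloor>real (Suc n) * f x\<rfloor> - real (Suc n) * f x\<bar> / real (Suc n) \<le> 1 / real (Suc n)"
      by (rule divide_right_mono) simp
    moreover have "s n x - f x = (real_of_int \<lfloor>real (Suc n) * f x\<rfloor> - real (Suc n) * f x) / real (Suc n)"
      by (simp add: s_def field_simps)
    ultimately show ?thesis by (simp add: abs_divide)
  qed
  ultimately show ?thesis by (rule that)
qed

lemma norm_Linfty_diff_le:
  fixes f g :: "'g::haar_group \<Rightarrow> real"
  assumes f: "f \<in> borel_measurable haar" "bounded (range f)" and g: "g \<in> borel_measurable haar" "bounded (range g)"
    and B: "\<And>x. \<bar>f x - g x\<bar> \<le> B"
  shows "norm (Linfty_functional f - Linfty_functional g) \<le> B"
proof -
  have g': "(\<lambda>x. - 1 * g x) \<in> borel_measurable haar" "bounded (range (\<lambda>x. - 1 * g x))"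
    using g bounded_scaling[OF g(2), of "- 1"] by (auto simp: image_image)
  have "Linfty_functional (\<lambda>x. f x + - 1 * g x) = Linfty_functional f - Linfty_functional g"
    unfolding Linfty_add[OF f g'] Linfty_cmult[OF g] by simp
  moreover have "norm (Linfty_functional (\<lambda>x. f x + - 1 * g x)) \<le> B"
  proof (rule Linfty_functional_apply(2))
    show "(\<lambda>x. f x + - 1 * g x) \<in> borel_measurable haar" using f(1) g'(1) by (rule borel_measurable_add)
    show "bounded (range (\<lambda>x. f x + - 1 * g x))" by (rule bounded_range_add[OF f(2) g'(2)])
    show "0 \<le> B" using B[of undefined] by linarith
  qed (use B in simp)
  ultimately show ?thesis by simp
qed

text \<open>Exactly one level set of a simple function has charge one, so its integral is the value
  taken there. That level set meets \<open>B\<close>, since two disjoint sets of charge one would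
  have a union of charge 2. The two halves of \<epsilon> pay for the uniform approximation of
  \<open>f\<close> and for the limit of the integrals.\<close>

lemma zero_one_chargeD:
  fixes \<mu> :: "'g::haar_group L1_bidual"
  assumes "acts_by_integration \<mu> \<omega>" "\<omega> \<in> ba_haar" "\<omega> UNIV = 1" and zo: "\<forall>A\<in>sets haar. \<omega> A \<in> {0, 1}"
    and f: "f \<in> borel_measurable haar" "bounded (range f)" and "0 < \<epsilon>"
    and B: "B \<in> sets haar" "\<omega> B = 1"
  shows "\<exists>x\<in>B. \<bar>f x - blinfun_apply \<mu> (Linfty_functional f)\<bar> < \<epsilon>"
proof -
  have add: "\<omega> (A \<union> C) = \<omega> A + \<omega> C" if "A \<in> sets haar" "C \<in> sets haar" "A \<inter> C = {}" for A C
    using assms(2) that unfolding ba_haar_def by blast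
  have empty: "\<omega> {} = 0" using add[of "{}" "{}"] by simp
  define I where "I = blinfun_apply \<mu> (Linfty_functional f)"
  have "has_charge_integral \<omega> f I" using assms(1) f unfolding acts_by_integration_def I_def by blast
  then obtain s where s: "\<And>n. simple_function haar (s n)" "uniform_limit UNIV s f sequentially"
    "(\<lambda>n. simple_charge_integral \<omega> (s n)) \<longlonglongrightarrow> I" unfolding has_charge_integral_def by blast
  have "eventually (\<lambda>n. \<forall>x\<in>UNIV. dist (s n x) (f x) < \<epsilon> / 2) sequentially"
    using s(2) \<open>0 < \<epsilon>\<close> by (intro uniform_limitD) auto
  moreover have "eventually (\<lambda>n. dist (simple_charge_integral \<omega> (s n)) I < \<epsilon> / 2) sequentially"
    using s(3) \<open>0 < \<epsilon>\<close> by (intro tendstoD) auto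
  ultimately have "eventually (\<lambda>n. (\<forall>x. dist (s n x) (f x) < \<epsilon> / 2) \<and> dist (simple_charge_integral \<omega> (s n)) I < \<epsilon> / 2) sequentially"
    by eventually_elim simp
  then obtain n where n: "\<And>x. \<bar>s n x - f x\<bar> < \<epsilon> / 2" "\<bar>simple_charge_integral \<omega> (s n) - I\<bar> < \<epsilon> / 2"
    by (auto simp: eventually_sequentially dist_real_def)
  have fin: "finite (range (s n))" and meas: "\<And>Y. s n -` Y \<in> sets haar"
    using simple_functionD[OF s(1)[of n]] by auto
  have sum_eq: "\<omega> (s n -` Y) = (\<Sum>y\<in>Y. \<omega> (s n -` {y}))" if "finite Y" for Y
    using that
  proof (induction Y)
    case (insert y Y)
    have "s n -` insert y Y = s n -` {y} \<union> s n -` Y" by auto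
    then have "\<omega> (s n -` insert y Y) = \<omega> (s n -` {y}) + \<omega> (s n -` Y)"
      using insert.hyps by (subst add[symmetric]) (auto intro: meas)
    then show ?case using insert by simp
  qed (simp add: empty)
  have total: "(\<Sum>y\<in>range (s n). \<omega> (s n -` {y})) = 1"
  proof -
    have "s n -` range (s n) = UNIV" by auto
    then show ?thesis using sum_eq[OF fin] assms(3) by simp
  qed
  then obtain y where y: "y \<in> range (s n)" "\<omega> (s n -` {y}) \<noteq> 0"
    using sum.neutral[of "range (s n)" "\<lambda>y. \<omega> (s n -` {y})"] by (metis zero_neq_one)
  then have y1: "\<omega> (s n -` {y}) = 1" using zo[rule_format, OF meas] by blast
  have "(\<Sum>z\<in>range (s n) - {y}. \<omega> (s n -` {z})) = 0"
    using total y1 fin y(1) by (simp add: sum.remove)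
  moreover have "0 \<le> \<omega> (s n -` {z})" for z using zo[rule_format, OF meas[of "{z}"]] by auto
  ultimately have others: "\<omega> (s n -` {z}) = 0" if "z \<in> range (s n) - {y}" for z
    using sum_nonneg_eq_0_iff[of "range (s n) - {y}" "\<lambda>z. \<omega> (s n -` {z})"] fin that by blast
  have "simple_charge_integral \<omega> (s n) = y + (\<Sum>z\<in>range (s n) - {y}. z * \<omega> (s n -` {z}))"
    unfolding simple_charge_integral_def using fin y(1) y1 by (simp add: sum.remove)
  also have "\<dots> = y" using others by simp
  finally have yI: "\<bar>y - I\<bar> < \<epsilon> / 2" using n(2) by simp
  have "s n -` {y} \<inter> B \<noteq> {}"
  proof
    assume "s n -` {y} \<inter> B = {}"
    then have "\<omega> (s n -` {y} \<union> B) = 2" using add[OF meas B(1)] y1 B(2) by simp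
    then show False using zo[rule_format, of "s n -` {y} \<union> B"] meas B(1) by auto
  qed
  then obtain x where x: "x \<in> B" "s n x = y" by auto
  then have "\<bar>f x - I\<bar> < \<epsilon>" using n(1)[of x] yI by (simp add: abs_if split: if_splits)
  then show ?thesis using x(1) unfolding I_def by blast
qed

text \<open>The charge is recovered from the functional. The approximation property is applied to
  the indicator of \<open>B\<close>, on whichever of \<open>B\<close> and \<open>- B\<close> has
  charge one, with the supposed discrepancy as \<epsilon>.\<close>

lemma zero_one_charges_indicator:
  fixes \<mu> :: "'g::haar_group L1_bidual"
  assumes "acts_by_integration \<mu> \<omega>" "\<omega> \<in> ba_haar" "\<omega> UNIV = 1" and zo: "\<forall>A\<in>sets haar. \<omega> A \<in> {0, 1}"
    and B: "B \<in> sets haar"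
  shows "blinfun_apply \<mu> (chi B) = \<omega> B"
proof (rule ccontr)
  assume ne: "blinfun_apply \<mu> (chi B) \<noteq> \<omega> B"
  define e where "e = \<bar>\<omega> B - blinfun_apply \<mu> (chi B)\<bar>"
  have e: "0 < e" using ne by (simp add: e_def)
  have ind: "indicator B \<in> borel_measurable (haar :: 'g measure)" using B by simp
  note D = zero_one_chargeD[OF assms(1-4) ind bounded_range_indicator e]
  have nB: "- B \<in> sets haar" using B sets.compl_sets[OF B] by (simp add: Compl_eq_Diff_UNIV)
  have "\<omega> (B \<union> - B) = \<omega> B + \<omega> (- B)"
    using assms(2) B nB unfolding ba_haar_def by blast
  then have sum1: "\<omega> B + \<omega> (- B) = 1" using assms(3) by simp
  show False
  proof (cases "\<omega> B = 1")
    case True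
    then show False using D[OF B True] by (auto simp: e_def)
  next
    case False
    then have "\<omega> B = 0" using zo[rule_format, OF B] by simp
    then show False using D[OF nB] sum1 by (auto simp: e_def)
  qed
qed

lemma zero_one_charges_approx:
  fixes \<mu> :: "'g::haar_group L1_bidual"
  assumes "\<mu> \<in> zero_one_charges" and f: "f \<in> borel_measurable haar" "bounded (range f)" and "0 < \<epsilon>"
    and B: "B \<in> sets haar" "blinfun_apply \<mu> (chi B) = 1"
  shows "\<exists>x\<in>B. \<bar>f x - blinfun_apply \<mu> (Linfty_functional f)\<bar> < \<epsilon>"
proof -
  obtain \<omega> where \<omega>: "acts_by_integration \<mu> \<omega>" "\<omega> \<in> ba_haar" "\<omega> UNIV = 1" "\<forall>A\<in>sets haar. \<omega> A \<in> {0, 1}"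
    using assms(1) unfolding zero_one_charges_def by blast
  show ?thesis
    using zero_one_chargeD[OF \<omega> f \<open>0 < \<epsilon>\<close> B(1)] zero_one_charges_indicator[OF \<omega> B(1)] B(2) by simp
qed

text \<open>The set where \<open>|f|\<close> is at most the norm of \<phi> has a null complement,
  hence charge one, and the integral is approximated by values of \<open>f\<close> on it.\<close>

lemma zero_one_charges_norm:
  fixes \<mu> :: "'g::haar_group L1_bidual"
  assumes "\<mu> \<in> zero_one_charges"
  shows "norm \<mu> \<le> 1"
proof (rule norm_blinfun_bound)
  fix \<phi> :: "'g L1_dual"
  obtain f where f: "f \<in> borel_measurable haar" "bounded (range f)" "\<phi> = Linfty_functional f"
    using Linfty_functional_surj by blast
  obtain \<omega> where \<omega>: "acts_by_integration \<mu> \<omega>" "\<omega> \<in> ba_haar" "\<omega> UNIV = 1" "\<forall>A\<in>sets haar. \<omega> A \<in> {0, 1}"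
    using assms unfolding zero_one_charges_def by blast
  define A where "A = {x. \<bar>f x\<bar> \<le> norm \<phi>}"
  have A: "A \<in> sets haar" using borel_measurable_le[of "\<lambda>x. \<bar>f x\<bar>" haar "\<lambda>_. norm \<phi>"] f(1) by (simp add: A_def pred_def)
  have nA: "- A \<in> sets haar" using sets.compl_sets[OF A] by (simp add: Compl_eq_Diff_UNIV)
  have "AE x in haar. x \<notin> - A" using Linfty_AE_le[OF f(1,2)] by (simp add: A_def f(3))
  then have "\<omega> (- A) = 0" using nA \<omega>(2) by (auto simp: ba_haar_def AE_iff_null_sets)
  moreover have "\<omega> (A \<union> - A) = \<omega> A + \<omega> (- A)" using \<omega>(2) A nA unfolding ba_haar_def by blast
  ultimately have A1: "\<omega> A = 1" using \<omega>(3) by simp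
  show "norm (blinfun_apply \<mu> \<phi>) \<le> 1 * norm \<phi>"
  proof (rule field_le_epsilon)
    fix e :: real assume "0 < e"
    obtain x where "x \<in> A" "\<bar>f x - blinfun_apply \<mu> \<phi>\<bar> < e"
      using zero_one_chargeD[OF \<omega> f(1,2) \<open>0 < e\<close> A A1] f(3) by blast
    then show "norm (blinfun_apply \<mu> \<phi>) \<le> 1 * norm \<phi> + e" by (auto simp: A_def)
  qed
qed simp

text \<open>Eliminates the existential charge: what remains are a norm bound and conditions on
  single values of \<mu>, each closed for pointwise convergence. Conversely
  \<open>A \<mapsto> \<mu> (chi A)\<close> is the charge, and norm continuity of \<mu> along uniform
  approximations shows that \<mu> integrates against it.\<close>

theorem zero_one_charges_iff:
  fixes \<mu> :: "'g::haar_group L1_bidual"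
  shows "\<mu> \<in> zero_one_charges \<longleftrightarrow>
    norm \<mu> \<le> 1 \<and> blinfun_apply \<mu> (chi UNIV) = 1 \<and> (\<forall>A\<in>sets haar. blinfun_apply \<mu> (chi A) \<in> {0, 1})"
proof
  assume \<mu>: "\<mu> \<in> zero_one_charges"
  then obtain \<omega> where \<omega>: "acts_by_integration \<mu> \<omega>" "\<omega> \<in> ba_haar" "\<omega> UNIV = 1" "\<forall>A\<in>sets haar. \<omega> A \<in> {0, 1}"
    unfolding zero_one_charges_def by blast
  have "(UNIV :: 'g set) \<in> sets haar" using sets.top[of "haar :: 'g measure"] by simp
  from zero_one_charges_indicator[OF \<omega> this] \<omega>(3) have "blinfun_apply \<mu> (chi UNIV) = 1" by (rule trans)
  then show "norm \<mu> \<le> 1 \<and> blinfun_apply \<mu> (chi UNIV) = 1 \<and> (\<forall>A\<in>sets haar. blinfun_apply \<mu> (chi A) \<in> {0, 1})"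
    using zero_one_charges_indicator[OF \<omega>] \<omega>(4) zero_one_charges_norm[OF \<mu>] by metis
next
  assume \<mu>: "norm \<mu> \<le> 1 \<and> blinfun_apply \<mu> (chi UNIV) = 1 \<and> (\<forall>A\<in>sets haar. blinfun_apply \<mu> (chi A) \<in> {0, 1})"
  define \<omega> where "\<omega> = (\<lambda>A. blinfun_apply \<mu> (chi A))"
  have "\<omega> \<in> ba_haar"
    unfolding ba_haar_def
  proof (intro CollectI conjI ballI impI)
    show "\<exists>K. \<forall>A\<in>sets haar. \<bar>\<omega> A\<bar> \<le> K" using \<mu> by (intro exI[of _ 1]) (auto simp: \<omega>_def)
  qed (auto simp: \<omega>_def chi_Un blinfun.add_right chi_null)
  moreover have "acts_by_integration \<mu> \<omega>"
    unfolding acts_by_integration_def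
  proof (intro ballI impI)
    fix f :: "'g \<Rightarrow> real" assume f: "f \<in> borel_measurable haar" "bounded (range f)"
    have "\<exists>s. (\<forall>n. simple_function haar (s n)) \<and> (\<forall>n x. \<bar>s n x - f x\<bar> \<le> 1 / real (Suc n))"
      by (rule simple_uniform_approximation[OF f]) blast
    then obtain s where s: "\<And>n. simple_function haar (s n)" "\<And>n x. \<bar>s n x - f x\<bar> \<le> 1 / real (Suc n)" by blast
    have z: "(\<lambda>n. 1 / real (Suc n)) \<longlonglongrightarrow> 0" by (rule LIMSEQ_Suc[OF lim_1_over_n])
    have "uniform_limit UNIV s f sequentially"
    proof (rule uniform_limitI)
      fix e :: real assume "0 < e"
      then have "eventually (\<lambda>n. 1 / real (Suc n) < e) sequentially" using z by (intro order_tendstoD) auto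
      then show "eventually (\<lambda>n. \<forall>x\<in>UNIV. dist (s n x) (f x) < e) sequentially"
      proof eventually_elim
        case (elim n)
        then show ?case using s(2)[of n] by (auto simp: dist_real_def intro: le_less_trans)
      qed
    qed
    moreover have "(\<lambda>n. Linfty_functional (s n)) \<longlonglongrightarrow> Linfty_functional f"
    proof (rule LIM_zero_cancel, rule tendsto_norm_zero_cancel, rule tendsto_sandwich[OF _ _ tendsto_const z])
      show "eventually (\<lambda>n. norm (Linfty_functional (s n) - Linfty_functional f) \<le> 1 / real (Suc n)) sequentially"
        using s f by (intro always_eventually allI norm_Linfty_diff_le) (auto intro: borel_measurable_simple_function bounded_simple)
    qed auto
    then have "(\<lambda>n. blinfun_apply \<mu> (Linfty_functional (s n))) \<longlonglongrightarrow> blinfun_apply \<mu> (Linfty_functional f)"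
      by (intro tendsto_intros)
    then have "(\<lambda>n. simple_charge_integral \<omega> (s n)) \<longlonglongrightarrow> blinfun_apply \<mu> (Linfty_functional f)"
      unfolding \<omega>_def using simple_charge_integral_eq[OF s(1)] by simp
    ultimately show "has_charge_integral \<omega> f (blinfun_apply \<mu> (Linfty_functional f))"
      unfolding has_charge_integral_def using s(1) by blast
  qed
  ultimately show "\<mu> \<in> zero_one_charges" using \<mu> unfolding zero_one_charges_def \<omega>_def by blast
qed

section \<open>Compactness of the set of charges and its norming property\<close>

lemma closedin_evaluation:
  "closed S \<Longrightarrow> closedin strong_operator_topology {\<mu> :: 'v::real_normed_vector \<Rightarrow>\<^sub>L real. blinfun_apply \<mu> x \<in> S}"
  using closedin_continuous_map_preimage[OF strong_operator_topology_continuous_evaluation[of x], of S]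
  by (simp add: strong_operator_topology_topspace)

theorem zero_one_charges_compact: "compactin strong_operator_topology (zero_one_charges :: 'g::haar_group L1_bidual set)"
proof -
  have "(zero_one_charges :: 'g L1_bidual set) = cball 0 1 \<inter> \<Inter>(insert {\<mu>. blinfun_apply \<mu> (chi UNIV) \<in> {1}}
      ((\<lambda>A. {\<mu>. blinfun_apply \<mu> (chi A) \<in> {0, 1}}) ` sets haar))"
    by (auto simp: zero_one_charges_iff)
  moreover have "closedin strong_operator_topology (\<Inter>(insert {\<mu> :: 'g L1_bidual. blinfun_apply \<mu> (chi (UNIV :: 'g set)) \<in> {1}}
      ((\<lambda>A. {\<mu>. blinfun_apply \<mu> (chi A) \<in> {0, 1}}) ` sets haar)))"
  proof (rule closedin_Inter)
    fix C assume "C \<in> insert {\<mu> :: 'g L1_bidual. blinfun_apply \<mu> (chi (UNIV :: 'g set)) \<in> {1}} ((\<lambda>A. {\<mu>. blinfun_apply \<mu> (chi A) \<in> {0, 1}}) ` sets haar)"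
    then consider "C = {\<mu>. blinfun_apply \<mu> (chi (UNIV :: 'g set)) \<in> {1}}"
      | A where "C = {\<mu>. blinfun_apply \<mu> (chi (A :: 'g set)) \<in> {0, 1}}" by blast
    then show "closedin strong_operator_topology C"
    proof cases
      case 1
      show ?thesis unfolding 1 by (rule closedin_evaluation) simp
    next
      case (2 A)
      show ?thesis unfolding 2 by (rule closedin_evaluation) simp
    qed
  qed simp
  ultimately show ?thesis
    using closed_Int_compactin[OF _ banach_alaoglu] by (metis Int_commute)
qed

text \<open>Of \<open>C \<inter> B\<close> and \<open>C - B\<close> at least one is not null. This
  finite form of an ultrafilter extension feeds the finite intersection property.\<close>

lemma decided_subset:
  assumes "finite \<B>" "\<B> \<subseteq> sets haar" "A \<in> sets (haar :: 'g::haar_group measure)" "A \<notin> null_sets haar"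
  shows "\<exists>C\<in>sets haar. C \<subseteq> A \<and> C \<notin> null_sets haar \<and> (\<forall>B\<in>\<B>. C \<subseteq> B \<or> C \<inter> B = {})"
  using assms(1,2)
proof (induction \<B>)
  case empty
  then show ?case using assms(3,4) by blast
next
  case (insert B \<B>)
  then obtain C where C: "C \<in> sets haar" "C \<subseteq> A" "C \<notin> null_sets haar" "\<And>B. B \<in> \<B> \<Longrightarrow> C \<subseteq> B \<or> C \<inter> B = {}" by auto
  have B: "B \<in> sets haar" using insert.prems by simp
  have "C \<inter> B \<notin> null_sets haar \<or> C - B \<notin> null_sets haar"
  proof (rule ccontr)
    assume "\<not> ?thesis"
    then have "(C \<inter> B) \<union> (C - B) \<in> null_sets haar" by (intro null_sets.Un) auto
    then show False using C(3) by (simp add: Int_Diff_Un)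
  qed
  then show ?case
  proof
    assume "C \<inter> B \<notin> null_sets haar"
    then show ?case using C B by (intro bexI[of _ "C \<inter> B"] conjI) blast+
  next
    assume "C - B \<notin> null_sets haar"
    then show ?case using C B by (intro bexI[of _ "C - B"] conjI) blast+
  qed
qed

text \<open>Compactness of the dual ball takes the place of the ultrafilter lemma: finitely many of
  the defining conditions are met by an ordinary average over a non-null subset of \<open>A\<close>
  that each of the sets involved contains or misses.\<close>

theorem zero_one_charges_exists:
  fixes A :: "'g::haar_group set"
  assumes A: "A \<in> sets haar" "A \<notin> null_sets haar"
  shows "\<exists>\<mu>\<in>zero_one_charges. blinfun_apply \<mu> (chi A) = 1"
proof -
  define Z where "Z = (\<lambda>B. {\<mu> :: 'g L1_bidual. blinfun_apply \<mu> (chi B) \<in> (if B = UNIV \<or> B = A then {1} else {0, 1})})"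
  have "cball 0 1 \<inter> \<Inter>(Z ` sets haar) \<noteq> {}"
  proof (rule banach_alaoglu[unfolded compactin_fip, THEN conjunct2, rule_format], intro conjI allI impI ballI)
    fix C assume "C \<in> Z ` sets haar"
    then show "closedin strong_operator_topology C" unfolding Z_def by (auto intro!: closedin_evaluation)
  next
    fix \<F> assume "finite \<F> \<and> \<F> \<subseteq> Z ` sets haar"
    then obtain \<B> where \<B>: "finite \<B>" "\<B> \<subseteq> sets haar" "\<F> = Z ` \<B>" by (meson finite_subset_image)
    obtain C where C: "C \<in> sets haar" "C \<subseteq> A" "C \<notin> null_sets haar" "\<And>B. B \<in> \<B> \<Longrightarrow> C \<subseteq> B \<or> C \<inter> B = {}"
      using decided_subset[OF \<B>(1,2) A] by blast
    obtain w :: "'g \<Rightarrow> real" where w: "w \<in> borel_measurable haar" "\<And>x. 0 < w x" "\<And>x. w x \<le> 1" "integrable haar w"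
      using haar.obtain_positive_integrable_function by blast
    define u where "u = (\<lambda>x. w x * indicator C x)"
    have u: "integrable haar u" using integrable_mult_indicator[OF C(1) w(4)] by (simp add: u_def mult.commute)
    have u0: "0 \<le> u x" for x using w(2)[of x] by (simp add: u_def indicator_def)
    define m where "m = (LINT x|haar. u x)"
    have "m \<noteq> 0"
    proof
      assume "m = 0"
      then have "AE x in haar. u x = 0"
        using integral_nonneg_eq_0_iff_AE[OF u] u0 by (simp add: m_def)
      then have "AE x in haar. x \<notin> C"
      proof eventually_elim
        case (elim x)
        then show ?case using w(2)[of x] by (auto simp: u_def indicator_def)
      qed
      then show False using C(1,3) by (simp add: AE_iff_null_sets)
    qed
    moreover have "0 \<le> m" unfolding m_def by (rule integral_nonneg_AE) (simp add: u0)
    ultimately have m: "0 < m" by simp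
    \<comment> \<open>A probability density concentrated on \<open>C\<close>; its average gives
      \<open>chi B\<close> the value 1 if \<open>C\<close> lies in \<open>B\<close> and 0 if they
      are disjoint. Weighting by \<open>w\<close> allows \<open>C\<close> of infinite
      measure.\<close>
    define a where "a = (\<lambda>x. (1 / m) * u x)"
    have a: "integrable haar a" using u by (simp add: a_def)
    have na: "norm (abs_L1 a) = 1" using u0 m by (simp add: norm_abs_L1[OF a]) (simp add: a_def abs_mult m_def[symmetric])
    define \<mu> :: "'g L1_bidual" where "\<mu> = Blinfun (\<lambda>\<phi>. blinfun_apply \<phi> (abs_L1 a))"
    have app: "blinfun_apply \<mu> \<phi> = blinfun_apply \<phi> (abs_L1 a)" for \<phi>
      unfolding \<mu>_def by (simp add: bounded_linear_Blinfun_apply blinfun.bounded_linear_left)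
    have "norm \<mu> \<le> 1"
    proof (rule norm_blinfun_bound)
      fix \<phi>
      show "norm (blinfun_apply \<mu> \<phi>) \<le> 1 * norm \<phi>" using norm_blinfun[of \<phi> "abs_L1 a"] by (simp add: app na)
    qed simp
    moreover have "\<mu> \<in> Z B" if "B \<in> \<B>" for B
    proof -
      have B: "B \<in> sets haar" using that \<B>(2) by blast
      have eq: "blinfun_apply \<mu> (chi B) = (LINT g|haar. a g * indicator B g)"
        unfolding app by (rule chi_apply_abs[OF B a])
      show ?thesis
      proof (cases "C \<subseteq> B")
        case True
        then have "(\<lambda>g. a g * indicator B g) = a" by (auto simp: a_def u_def indicator_def fun_eq_iff)
        moreover have "(LINT g|haar. a g) = 1" using m by (simp add: a_def m_def[symmetric])
        ultimately show ?thesis unfolding Z_def using eq by simp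
      next
        case False
        then have "C \<inter> B = {}" using C(4)[OF that] by blast
        then have "(\<lambda>g. a g * indicator B g) = (\<lambda>_. 0)" by (auto simp: a_def u_def indicator_def fun_eq_iff)
        moreover have "B \<noteq> UNIV" "B \<noteq> A" using False C(2) by auto
        ultimately show ?thesis unfolding Z_def using eq by simp
      qed
    qed
    ultimately have "\<mu> \<in> cball 0 1 \<inter> \<Inter>\<F>" by (auto simp: \<B>(3))
    then show "cball 0 1 \<inter> \<Inter>\<F> \<noteq> {}" by blast
  qed
  then obtain \<mu> where "\<mu> \<in> cball 0 1 \<inter> \<Inter>(Z ` sets haar)" by blast
  then have \<mu>: "norm \<mu> \<le> 1" "\<And>B. B \<in> sets haar \<Longrightarrow> \<mu> \<in> Z B" by auto
  have U: "(UNIV :: 'g set) \<in> sets haar" using sets.top[of "haar :: 'g measure"] by simp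
  have "blinfun_apply \<mu> (chi B) \<in> {0, 1}" if "B \<in> sets haar" for B
    using \<mu>(2)[OF that] by (auto simp: Z_def split: if_splits)
  moreover have "blinfun_apply \<mu> (chi UNIV) = 1" "blinfun_apply \<mu> (chi A) = 1"
    using \<mu>(2)[OF U] \<mu>(2)[OF A(1)] by (auto simp: Z_def)
  ultimately show ?thesis using \<mu>(1) zero_one_charges_iff[of \<mu>] by blast
qed

text \<open>For a level \<open>t\<close> strictly between \<open>K\<close> and the norm, the set
  where \<open>|f|\<close> is at least \<open>t\<close> is not null. A charge giving it mass one
  integrates \<open>f\<close> to a value of modulus greater than \<open>K\<close>.\<close>

theorem zero_one_charges_norming:
  fixes \<phi> :: "'g::haar_group L1_dual"
  assumes bound: "\<And>\<mu>. \<mu> \<in> zero_one_charges \<Longrightarrow> \<bar>blinfun_apply \<mu> \<phi>\<bar> \<le> K"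
  shows "norm \<phi> \<le> K"
proof (rule ccontr)
  assume "\<not> norm \<phi> \<le> K"
  obtain f where f: "f \<in> borel_measurable haar" "bounded (range f)" "\<phi> = Linfty_functional f"
    using Linfty_functional_surj by blast
  have U: "(UNIV :: 'g set) \<in> sets haar" using sets.top[of "haar :: 'g measure"] by simp
  have "(UNIV :: 'g set) \<notin> null_sets haar" using emeasure_haar_UNIV by (auto simp: null_sets_def)
  \<comment> \<open>Some charge exists because the group itself is not null, so \<open>K\<close> is
    nonnegative; hence so is \<open>t\<close>, as the norm estimate below requires.\<close>
  from zero_one_charges_exists[OF U this] bound have K0: "0 \<le> K" by force
  define t where "t = (K + norm \<phi>) / 2"
  have t: "K < t" "t < norm \<phi>" using \<open>\<not> norm \<phi> \<le> K\<close> by (auto simp: t_def)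
  define A where "A = {x. t \<le> \<bar>f x\<bar>}"
  have A: "A \<in> sets haar" using borel_measurable_le[of "\<lambda>_. t" haar "\<lambda>x. \<bar>f x\<bar>"] f(1) by (simp add: A_def pred_def)
  have "A \<notin> null_sets haar"
  proof
    assume "A \<in> null_sets haar"
    then have "AE x in haar. \<bar>f x\<bar> \<le> t" by (auto dest!: AE_not_in elim!: eventually_mono simp: A_def)
    then have "norm \<phi> \<le> t" unfolding f(3) using f(1,2) K0 t by (intro Linfty_functional_apply(2)) auto
    then show False using t by simp
  qed
  then obtain \<mu> where \<mu>: "\<mu> \<in> zero_one_charges" "blinfun_apply \<mu> (chi A) = 1"
    using zero_one_charges_exists[OF A] by blast
  obtain x where "x \<in> A" "\<bar>f x - blinfun_apply \<mu> \<phi>\<bar> < t - K"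
    using zero_one_charges_approx[OF \<mu>(1) f(1,2) _ A \<mu>(2), of "t - K"] t f(3) by auto
  then show False using bound[OF \<mu>(1)] by (auto simp: A_def)
qed

section \<open>Right tame functionals\<close>

text \<open>Two functionals of \<open>M\<close> are taken that sort the indices by the sign of the
  coefficient in opposite ways. Their difference is at least \<open>b - a\<close> per unit of
  coefficient, whatever the position of \<open>a\<close> and \<open>b\<close> relative to zero, and
  costs twice the norm: hence the constant \<open>(b - a) / 2\<close>.\<close>

lemma independent_on_imp_l1_sequence:
  fixes x :: "nat \<Rightarrow> 'v::real_normed_vector" and M :: "('v \<Rightarrow>\<^sub>L real) set"
  assumes M: "\<And>\<psi>. \<psi> \<in> M \<Longrightarrow> norm \<psi> \<le> 1" and x: "\<And>n. norm (x n) \<le> K"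
    and ind: "independent_on M (\<lambda>n \<psi>. blinfun_apply \<psi> (x n))"
  shows "l1_sequence x"
proof -
  from ind have "\<exists>a b. a < b \<and> (\<forall>N L. finite N \<longrightarrow> finite L \<longrightarrow> N \<inter> L = {} \<longrightarrow>
      (\<exists>\<psi>\<in>M. (\<forall>n\<in>N. blinfun_apply \<psi> (x n) \<le> a) \<and> (\<forall>m\<in>L. blinfun_apply \<psi> (x m) \<ge> b)))"
    unfolding independent_on_def by (rule conjunct2)
  then obtain a b where "a < b" and ab: "\<forall>N L. finite N \<longrightarrow> finite L \<longrightarrow> N \<inter> L = {} \<longrightarrow>
      (\<exists>\<psi>\<in>M. (\<forall>n\<in>N. blinfun_apply \<psi> (x n) \<le> a) \<and> (\<forall>m\<in>L. blinfun_apply \<psi> (x m) \<ge> b))"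
    by (elim exE conjE)
  have lower: "(b - a) / 2 * (\<Sum>i<n. \<bar>c i\<bar>) \<le> norm (\<Sum>i<n. c i *\<^sub>R x i)" for n c
  proof -
    define N where "N = {i\<in>{..<n}. c i < 0}"
    define L where "L = {i\<in>{..<n}. 0 \<le> c i}"
    have NL: "finite N" "finite L" "N \<inter> L = {}" "L \<inter> N = {}" by (auto simp: N_def L_def)
    obtain \<psi> where \<psi>: "\<psi> \<in> M" "\<And>i. i \<in> N \<Longrightarrow> blinfun_apply \<psi> (x i) \<le> a" "\<And>i. i \<in> L \<Longrightarrow> blinfun_apply \<psi> (x i) \<ge> b"
      using ab[rule_format, OF NL(1,2,3)] by blast
    obtain \<xi> where \<xi>: "\<xi> \<in> M" "\<And>i. i \<in> L \<Longrightarrow> blinfun_apply \<xi> (x i) \<le> a" "\<And>i. i \<in> N \<Longrightarrow> blinfun_apply \<xi> (x i) \<ge> b"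
      using ab[rule_format, OF NL(2,1,4)] by blast
    let ?v = "\<Sum>i<n. c i *\<^sub>R x i"
    have le: "\<bar>blinfun_apply \<theta> ?v\<bar> \<le> norm ?v" if "\<theta> \<in> M" for \<theta>
    proof -
      have "norm (blinfun_apply \<theta> ?v) \<le> norm \<theta> * norm ?v" by (rule norm_blinfun)
      also have "\<dots> \<le> 1 * norm ?v" using M[OF that] by (intro mult_right_mono) auto
      finally show ?thesis by simp
    qed
    have "(b - a) * (\<Sum>i<n. \<bar>c i\<bar>) = (\<Sum>i<n. (b - a) * \<bar>c i\<bar>)" by (rule sum_distrib_left)
    also have "\<dots> \<le> (\<Sum>i<n. c i * (blinfun_apply \<psi> (x i) - blinfun_apply \<xi> (x i)))"
    proof (rule sum_mono)
      fix i assume i: "i \<in> {..<n}"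
      show "(b - a) * \<bar>c i\<bar> \<le> c i * (blinfun_apply \<psi> (x i) - blinfun_apply \<xi> (x i))"
      proof (cases "c i < 0")
        case True
        then have "blinfun_apply \<psi> (x i) \<le> a" "blinfun_apply \<xi> (x i) \<ge> b" using i \<psi>(2) \<xi>(3) by (auto simp: N_def)
        then have "(b - a) * (- c i) \<le> (blinfun_apply \<xi> (x i) - blinfun_apply \<psi> (x i)) * (- c i)"
          using True by (intro mult_right_mono) auto
        then show ?thesis using True by (simp add: algebra_simps)
      next
        case False
        then have "blinfun_apply \<psi> (x i) \<ge> b" "blinfun_apply \<xi> (x i) \<le> a" using i \<psi>(3) \<xi>(2) by (auto simp: L_def)
        then have "(b - a) * c i \<le> (blinfun_apply \<psi> (x i) - blinfun_apply \<xi> (x i)) * c i"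
          using False by (intro mult_right_mono) auto
        then show ?thesis using False by (simp add: mult.commute)
      qed
    qed
    also have "\<dots> = blinfun_apply \<psi> ?v - blinfun_apply \<xi> ?v"
      by (simp add: blinfun.sum_right blinfun.scaleR_right right_diff_distrib sum_subtractf)
    also have "\<dots> \<le> 2 * norm ?v" using le[OF \<psi>(1)] le[OF \<xi>(1)] by linarith
    finally show ?thesis by simp
  qed
  have upper: "norm (\<Sum>i<n. c i *\<^sub>R x i) \<le> K * (\<Sum>i<n. \<bar>c i\<bar>)" for n c
  proof -
    have "norm (\<Sum>i<n. c i *\<^sub>R x i) \<le> (\<Sum>i<n. \<bar>c i\<bar> * norm (x i))"
      using norm_sum[of "\<lambda>i. c i *\<^sub>R x i" "{..<n}"] by simp
    also have "\<dots> \<le> (\<Sum>i<n. K * \<bar>c i\<bar>)"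
      by (intro sum_mono) (use x in \<open>auto simp: mult.commute[of K] intro!: mult_left_mono\<close>)
    finally show ?thesis by (simp add: sum_distrib_left)
  qed
  show ?thesis unfolding l1_sequence_def
    using lower upper \<open>a < b\<close> by (intro exI[of _ "(b - a) / 2"] conjI exI[of _ K] allI) auto
qed

lemma independent_on_image:
  "independent_on (h ` X) f \<longleftrightarrow> independent_on X (\<lambda>n x. f n (h x))"
  unfolding independent_on_def by simp

theorem theorem6p13:
  fixes \<phi> :: "'g::haar_group L1 \<Rightarrow>\<^sub>L real"
  shows "right_tame \<phi> \<longleftrightarrow>
         co_tame {bidual_act \<omega> \<phi> | \<omega>. \<omega> \<in> (zero_one_charges :: 'g L1_bidual set)}"
proof -
  define G where "G = (zero_one_charges :: 'g L1_bidual set)"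
  have orbit: "{bidual_act \<omega> \<phi> | \<omega>. \<omega> \<in> G} = (\<lambda>\<omega>. bidual_act \<omega> \<phi>) ` G" by blast
  have G: "compactin strong_operator_topology G" unfolding G_def by (rule zero_one_charges_compact)
  have G1: "norm \<omega> \<le> 1" if "\<omega> \<in> G" for \<omega> using that unfolding G_def by (rule zero_one_charges_norm)
  have "continuous_map strong_operator_topology strong_operator_topology (\<lambda>\<omega>. bidual_act \<omega> \<phi>)"
    unfolding continuous_on_strong_operator_topo_iff_coordinatewise bidual_act_apply
    using strong_operator_topology_continuous_evaluation by blast
  then have compact: "weak_star_compact ((\<lambda>\<omega>. bidual_act \<omega> \<phi>) ` G)"
    unfolding weak_star_compact_def by (rule image_compactin[OF G])
  have norm_le: "norm (dual_act \<phi> a) \<le> norm \<phi>" if "a \<in> cball 0 1" for a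
  proof -
    have "norm \<phi> * norm a \<le> norm \<phi> * 1" using that by (intro mult_left_mono) auto
    then show ?thesis using norm_dual_act[of \<phi> a] by simp
  qed
  then have bounded: "bounded (dual_act \<phi> ` cball 0 1)" unfolding bounded_iff by blast
  \<comment> \<open>The orbit is always weak-star compact and the image of the ball always bounded,
    so only these two failures have to be matched.\<close>
  have "(\<exists>x. range x \<subseteq> dual_act \<phi> ` cball 0 1 \<and> l1_sequence x) \<longleftrightarrow>
    (\<exists>v. range v \<subseteq> cball 0 1 \<and> independent_on G (\<lambda>n \<omega>. blinfun_apply \<omega> (dual_act \<phi> (v n))))"
  proof
    assume "\<exists>v. range v \<subseteq> cball 0 1 \<and> independent_on G (\<lambda>n \<omega>. blinfun_apply \<omega> (dual_act \<phi> (v n)))"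
    then obtain v where v: "range v \<subseteq> cball 0 1" "independent_on G (\<lambda>n \<omega>. blinfun_apply \<omega> (dual_act \<phi> (v n)))"
      by blast
    have "l1_sequence (\<lambda>n. dual_act \<phi> (v n))"
    proof (rule independent_on_imp_l1_sequence[where M=G and K="norm \<phi>"])
      show "norm (dual_act \<phi> (v n)) \<le> norm \<phi>" for n
        by (rule norm_le) (rule range_subsetD[OF v(1)])
    qed (fact G1 v(2))+
    moreover have "range (\<lambda>n. dual_act \<phi> (v n)) \<subseteq> dual_act \<phi> ` cball 0 1"
      using range_subsetD[OF v(1)] by (intro image_subsetI imageI)
    ultimately show "\<exists>x. range x \<subseteq> dual_act \<phi> ` cball 0 1 \<and> l1_sequence x"
      by (intro exI[of _ "\<lambda>n. dual_act \<phi> (v n)"] conjI)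
  next
    assume "\<exists>x. range x \<subseteq> dual_act \<phi> ` cball 0 1 \<and> l1_sequence x"
    then obtain x where x: "range x \<subseteq> dual_act \<phi> ` cball 0 1" "l1_sequence x" by blast
    have "\<forall>n. \<exists>a. a \<in> cball 0 1 \<and> x n = dual_act \<phi> a" using x(1) by blast
    then obtain v where v: "\<forall>n. v n \<in> cball 0 1 \<and> x n = dual_act \<phi> (v n)" by (rule choice[THEN exE])
    obtain \<delta> where \<delta>: "0 < \<delta>" "\<And>n c. \<delta> * (\<Sum>i<n. \<bar>c i\<bar>) \<le> norm (\<Sum>i<n. c i *\<^sub>R x i)"
      using x(2) unfolding l1_sequence_def by blast
    have "\<exists>r. strict_mono r \<and> independent_on G (\<lambda>n \<omega>. blinfun_apply \<omega> (x (r n)))"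
    proof (rule l1_on_compact_imp_independent[OF G strong_operator_topology_continuous_evaluation _ \<delta>(1)])
      fix n \<omega> assume "\<omega> \<in> G"
      have "norm (blinfun_apply \<omega> (x n)) \<le> norm \<omega> * norm (x n)" by (rule norm_blinfun)
      also have "\<dots> \<le> 1 * norm \<phi>" using G1[OF \<open>\<omega> \<in> G\<close>] norm_le v by (intro mult_mono) auto
      finally show "\<bar>blinfun_apply \<omega> (x n)\<bar> \<le> norm \<phi>" by simp
    next
      fix n B and c :: "nat \<Rightarrow> real"
      assume B: "\<And>\<omega>. \<omega> \<in> G \<Longrightarrow> \<bar>\<Sum>i<n. c i * blinfun_apply \<omega> (x i)\<bar> \<le> B"
      \<comment> \<open>Norming turns a bound over the charges into a bound for the norm in the
        dual, where the lower estimate of the sequence is available.\<close>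
      have "norm (\<Sum>i<n. c i *\<^sub>R x i) \<le> B"
        by (rule zero_one_charges_norming) (use B in \<open>simp add: G_def blinfun.sum_right blinfun.scaleR_right\<close>)
      then show "\<delta> * (\<Sum>i<n. \<bar>c i\<bar>) \<le> B" using \<delta>(2)[where n=n and c=c] by linarith
    qed
    then obtain r where "independent_on G (\<lambda>n \<omega>. blinfun_apply \<omega> (x (r n)))" by blast
    then show "\<exists>v. range v \<subseteq> cball 0 1 \<and> independent_on G (\<lambda>n \<omega>. blinfun_apply \<omega> (dual_act \<phi> (v n)))"
      using v by (intro exI[of _ "\<lambda>n. v (r n)"]) auto
  qed
  then show ?thesis
    unfolding right_tame_def tame_def co_tame_def G_def[symmetric] orbit independent_on_image bidual_act_apply
    using bounded compact by blast
qed

end
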